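(* Let $1\le r<n$ be integers. Then: (1) the group $\mathrm{Out}(G_{n,r})\cong\mathcal O_{n,r}$ has trivial centre; (2) the index of $\mathcal L_{n,r}$ in $\mathrm{Out}(G_{n,r})\cong\mathcal O_{n,r}$ is infinite.
   Context: $G_{n,r}$ is the Higman–Thompson group; it is known that $\mathrm{Out}(G_{n,r})\cong\mathcal O_{n,r}$, the group of transducers defined below, and the two are identified. **Transducers.** $X_n=\{0,\dots,n-1\}$, $n\ge2$; $X_n^*$ is the set of finite words ($\varepsilon$ the empty word), $X_n^+=X_n^*\setminus\{\varepsilon\}$, $X_n^{\mathbb N}$ the set of right-infinite words, $|w|$ the length of $w$. A transducer is $T=(X_n,Q_T,\pi_T,\lambda_T)$ with $Q_T$ a finite nonempty set of states, $\pi_T:X_n\times Q_T\to Q_T$, $\lambda_T:X_n\times Q_T\to X_n^*$, extended to words by $\pi_T(\varepsilon,q)=q$, $\lambda_T(\varepsilon,q)=\varepsilon$, $\pi_T(wx,q)=\pi_T(x,\pi_T(w,q))$, $\lambda_T(wx,q)=\lambda_T(w,q)\lambda_T(x,\pi_T(w,q))$, and $\lambda_T$ extended to infinite words. Always assumed: if $w\in X_n^+$ and $\pi_T(w,q)=q$ then $\lambda_T(w,q)\ne\varepsilon$. Each state $q$ induces a continuous map $h_q:X_n^{\mathbb N}\to X_n^{\mathbb N}$, $w\mapsto\lambda_T(w,q)$, with image $\mathrm{Image}(q)$. States $p,q$ (possibly of different transducers) are $\omega$-equivalent if $h_p=h_q$; $T$ is weakly minimal if distinct states are never $\omega$-equivalent.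 $\Lambda(w,q)$ is the greatest common prefix of $\{\lambda_T(wx,q):x\in X_n^{\mathbb N}\}$; $|\Lambda(\varepsilon,q)|\in\mathbb N\cup\{\infty\}$ is the extent of incomplete response of $q$, and $q$ is a state of incomplete response if $\Lambda(\varepsilon,q)\neq\varepsilon$. $T$ is strongly synchronizing if for some $k\ge 0$, for each $w\in X_n^k$ the state $\pi_T(w,q)$ is independent of $q$ (the state forced by $w$). The states forced by words of length $k$ form a subtransducer $\mathrm{core}(T)$; $T$ is core if $T=\mathrm{core}(T)$. For $x\in X_n^+$, $Z_x$ is the one-state transducer with output $x$ on every letter. A transducer is called minimal if either it is weakly minimal, strongly connected and has no states of incomplete response, or it is $Z_x$ with $x$ a prime word (not a proper power of a shorter word) lexicographically least among its rotations. Transducers are considered equal if there is a bijection of state sets matching $\omega$-equivalent states. **Reduction.** For a strongly synchronizing core transducer $C$ define a minimal transducer $[C]$: if some (equivalently every) state has infinite extent of incomplete response, each state of $C$ is $\omega$-equivalent to the state of some $Z_x$ with $x$ prime (unique up to rotation) and $[C]:=Z_{\bar x}$ with $\bar x$ the lexicographically least rotation of $x$; otherwise keep states and transitions, replace the output $\lambda_C(x,q)$ ($x\in X_n$) by the word obtained by deleting the prefix $\Lambda(\varepsilon,q)$ from $\Lambda(x,q)$, and then identify $\omega$-equivalent states. **Groups.** $T*U$ has states $Q_T\times Q_U$, $\pi_{T*U}(x,(p,q))=(\pi_T(x,p),\pi_U(\lambda_T(x,p),q))$, $\lambda_{T*U}(x,(p,q))=\lambda_U(\lambda_T(x,p),q)$.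 $\mathcal M_n$ is the monoid of minimal, strongly synchronizing, core transducers over $X_n$ with product $TU:=[\mathrm{core}(T*U)]$. $\widetilde{\mathcal O}_n\subseteq\mathcal M_n$ is the submonoid of those $T$ all of whose states $q$ have $h_q$ injective with clopen image; $\mathcal O_n$ is its largest inverse-closed subset (group of units). For $T\in\mathcal O_n$ and $q\in Q_T$, let $m_q$ be the least number of cones $U_\nu=\{x\in X_n^{\mathbb N}:\nu\text{ is a prefix of }x\}$ needed to write $\mathrm{Image}(q)$ as a union of cones; its residue mod $n-1$ does not depend on $q$ and is denoted $(T)\overline{\mathrm{sig}}$. For $1\le r\le n-1$, $\mathcal O_{n,r}=\{T\in\mathcal O_n: r\cdot (T)\overline{\mathrm{sig}}\equiv r \pmod{n-1}\}$, a subgroup. $\widetilde{\mathcal L}_n\subseteq\mathcal M_n$ is the submonoid of those $T$ with $|\lambda_T(a,q)|=|a|$ whenever $a\in X_n^*$, $q\in Q_T$, $\pi_T(a,q)=q$. $\mathcal L_n:=\mathcal O_n\cap\widetilde{\mathcal L}_n$ and $\mathcal L_{n,r}:=\mathcal L_n\cap\mathcal O_{n,r}$. *)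

theory Defs
  imports
    "HOL-Analysis.Function_Topology"
    "HOL-Library.Extended_Nat"
    "HOL-Library.Omega_Words_Fun"
    "HOL-Library.Sublist"
    "HOL-Number_Theory.Cong"
    "HOL-Algebra.Coset"
begin

text \<open>The alphabet \<open>X_n\<close> is \<open>{..<n}\<close>; the finite words over it are \<open>lists {..<n}\<close>.\<close>

definition cantor :: "nat \<Rightarrow> (nat word) topology" where
  "cantor n = product_topology (\<lambda>_. discrete_topology {..<n}) UNIV"

definition inf_words :: "nat \<Rightarrow> (nat word) set" where
  "inf_words n = topspace (cantor n)"

definition omega_prefix :: "'a list \<Rightarrow> 'a word \<Rightarrow> bool" where
  "omega_prefix u y \<longleftrightarrow> (\<exists>z. y = u \<frown> z)"

definition cone :: "nat \<Rightarrow> nat list \<Rightarrow> (nat word) set" where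
  "cone n \<nu> = {x \<in> inf_words n. omega_prefix \<nu> x}"

definition prime_word :: "'a list \<Rightarrow> bool" where
  "prime_word x \<longleftrightarrow> x \<noteq> [] \<and> \<not> (\<exists>y k. k \<ge> 2 \<and> x = concat (replicate k y))"

definition least_rotation :: "nat list \<Rightarrow> bool" where
  "least_rotation x \<longleftrightarrow> (\<forall>k. (rotate k x, x) \<notin> lexord less_than)"

text \<open>Values of \<open>step\<close> and \<open>out\<close> at letters outside \<open>{..<n}\<close> or at non-states are irrelevant.\<close>

record 'q transducer =
  states :: "'q set"
  step :: "nat \<Rightarrow> 'q \<Rightarrow> 'q"
  out :: "nat \<Rightarrow> 'q \<Rightarrow> nat list"

primrec steps :: "'q transducer \<Rightarrow> nat list \<Rightarrow> 'q \<Rightarrow> 'q" where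
  "steps T [] q = q"
| "steps T (x # w) q = steps T w (step T x q)"

primrec outs :: "'q transducer \<Rightarrow> nat list \<Rightarrow> 'q \<Rightarrow> nat list" where
  "outs T [] q = []"
| "outs T (x # w) q = out T x q @ outs T w (step T x q)"

definition transducer :: "nat \<Rightarrow> 'q transducer \<Rightarrow> bool" where
  "transducer n T \<longleftrightarrow>
     finite (states T) \<and> states T \<noteq> {} \<and>
     (\<forall>x<n. \<forall>q\<in>states T. step T x q \<in> states T \<and> out T x q \<in> lists {..<n}) \<and>
     (\<forall>w\<in>lists {..<n}. \<forall>q\<in>states T. w \<noteq> [] \<and> steps T w q = q \<longrightarrow> outs T w q \<noteq> [])"

text \<open>The map \<open>h_q\<close> on infinite words. For a transducer, the outputs on longer and longer
  prefixes of \<open>w\<close> have unbounded length, so the description is unique.\<close>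

definition omega_out :: "'q transducer \<Rightarrow> 'q \<Rightarrow> nat word \<Rightarrow> nat word" where
  "omega_out T q w = (THE y. \<forall>m. omega_prefix (outs T (w [0 \<rightarrow> m]) q) y)"

definition image_of :: "nat \<Rightarrow> 'q transducer \<Rightarrow> 'q \<Rightarrow> (nat word) set" where
  "image_of n T q = omega_out T q ` inf_words n"

definition omega_equiv :: "nat \<Rightarrow> 'p transducer \<Rightarrow> 'p \<Rightarrow> 'q transducer \<Rightarrow> 'q \<Rightarrow> bool" where
  "omega_equiv n T p U q \<longleftrightarrow> (\<forall>w\<in>inf_words n. omega_out T p w = omega_out U q w)"

definition weakly_minimal :: "nat \<Rightarrow> 'q transducer \<Rightarrow> bool" where
  "weakly_minimal n T \<longleftrightarrow>
     (\<forall>p\<in>states T. \<forall>q\<in>states T. omega_equiv n T p T q \<longrightarrow> p = q)"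

definition transducer_eq :: "nat \<Rightarrow> 'p transducer \<Rightarrow> 'q transducer \<Rightarrow> bool" where
  "transducer_eq n T U \<longleftrightarrow>
     (\<exists>f. bij_betw f (states T) (states U) \<and> (\<forall>q\<in>states T. omega_equiv n T q U (f q)))"

definition common_prefixes :: "nat \<Rightarrow> 'q transducer \<Rightarrow> nat list \<Rightarrow> 'q \<Rightarrow> nat list set" where
  "common_prefixes n T w q =
     {u. \<forall>x\<in>inf_words n. omega_prefix u (omega_out T q (w \<frown> x))}"

text \<open>The greatest common prefix \<open>\<Lambda>(w,q)\<close> may be an infinite word. It is only ever used
  as a word when it is finite, and this definition is meaningful only in that case; its possibly
  infinite length for \<open>w = \<epsilon>\<close> is \<open>extent\<close>.\<close>

definition Lambda :: "nat \<Rightarrow> 'q transducer \<Rightarrow> nat list \<Rightarrow> 'q \<Rightarrow> nat list" where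
  "Lambda n T w q =
     (THE u. u \<in> common_prefixes n T w q \<and> (\<forall>v\<in>common_prefixes n T w q. Sublist.prefix v u))"

definition extent :: "nat \<Rightarrow> 'q transducer \<Rightarrow> 'q \<Rightarrow> enat" where
  "extent n T q = (SUP u\<in>common_prefixes n T [] q. enat (length u))"

definition incomplete_response :: "nat \<Rightarrow> 'q transducer \<Rightarrow> 'q \<Rightarrow> bool" where
  "incomplete_response n T q \<longleftrightarrow> extent n T q \<noteq> 0"

definition strongly_connected :: "nat \<Rightarrow> 'q transducer \<Rightarrow> bool" where
  "strongly_connected n T \<longleftrightarrow>
     (\<forall>p\<in>states T. \<forall>q\<in>states T. \<exists>w\<in>lists {..<n}. steps T w p = q)"

definition sync_level :: "nat \<Rightarrow> 'q transducer \<Rightarrow> nat \<Rightarrow> bool" where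
  "sync_level n T k \<longleftrightarrow>
     (\<forall>w\<in>lists {..<n}. length w = k \<longrightarrow>
        (\<forall>p\<in>states T. \<forall>q\<in>states T. steps T w p = steps T w q))"

definition strongly_synchronizing :: "nat \<Rightarrow> 'q transducer \<Rightarrow> bool" where
  "strongly_synchronizing n T \<longleftrightarrow> (\<exists>k. sync_level n T k)"

text \<open>The set of states forced by words of length \<open>k\<close> is the same for all synchronizing
  levels \<open>k\<close>, so it is harmless to collect them over all such \<open>k\<close>.\<close>

definition core :: "nat \<Rightarrow> 'q transducer \<Rightarrow> 'q transducer" where
  "core n T = T\<lparr>states :=
     {q. \<exists>k w. sync_level n T k \<and> w \<in> lists {..<n} \<and> length w = k \<and>
               (\<forall>p\<in>states T. steps T w p = q)}\<rparr>"

definition is_core :: "nat \<Rightarrow> 'q transducer \<Rightarrow> bool" where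
  "is_core n T \<longleftrightarrow> core n T = T"

text \<open>The transducer \<open>Z_x\<close>, with \<open>s\<close> the name given to its state.\<close>

definition Z_tr :: "'q \<Rightarrow> nat list \<Rightarrow> 'q transducer" where
  "Z_tr s x = \<lparr>states = {s}, step = (\<lambda>_ _. s), out = (\<lambda>_ _. x)\<rparr>"

definition is_Z :: "nat \<Rightarrow> 'q transducer \<Rightarrow> nat list \<Rightarrow> bool" where
  "is_Z n T x \<longleftrightarrow> (\<exists>s. states T = {s} \<and> (\<forall>a<n. step T a s = s \<and> out T a s = x))"

definition minimal :: "nat \<Rightarrow> 'q transducer \<Rightarrow> bool" where
  "minimal n T \<longleftrightarrow>
     (weakly_minimal n T \<and> strongly_connected n T \<and>
        (\<forall>q\<in>states T. \<not> incomplete_response n T q)) \<or>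
     (\<exists>x\<in>lists {..<n}. prime_word x \<and> least_rotation x \<and> is_Z n T x)"

definition remove_incomplete_response :: "nat \<Rightarrow> 'q transducer \<Rightarrow> 'q transducer" where
  "remove_incomplete_response n C =
     C\<lparr>out := \<lambda>x q. drop (length (Lambda n C [] q)) (Lambda n C [x] q)\<rparr>"

definition omega_rel :: "nat \<Rightarrow> 'q transducer \<Rightarrow> ('q \<times> 'q) set" where
  "omega_rel n T = {(p, q) \<in> states T \<times> states T. omega_equiv n T p T q}"

text \<open>Representatives may be chosen arbitrarily because no state of the transducers to which this
  is applied is a state of incomplete response.\<close>

definition identify :: "nat \<Rightarrow> 'q transducer \<Rightarrow> 'q set transducer" where
  "identify n T =
     \<lparr>states = states T // omega_rel n T,
      step = (\<lambda>x P. omega_rel n T `` {step T x (SOME p. p \<in> P)}),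
      out = (\<lambda>x P. out T x (SOME p. p \<in> P))\<rparr>"

text \<open>In the first case the name of the single state is immaterial; \<open>states C\<close> is an
  arbitrary choice of the right type.\<close>

definition reduction :: "nat \<Rightarrow> 'q transducer \<Rightarrow> 'q set transducer" where
  "reduction n C =
     (if \<exists>q\<in>states C. extent n C q = \<infinity>
      then Z_tr (states C)
        (THE x. least_rotation x \<and>
           (\<exists>y\<in>lists {..<n}. prime_word y \<and> (\<exists>k. x = rotate k y) \<and>
              (\<exists>q\<in>states C. omega_equiv n C q (Z_tr () y) ())))
      else identify n (remove_incomplete_response n C))"

definition tr_prod :: "'p transducer \<Rightarrow> 'q transducer \<Rightarrow> ('p \<times> 'q) transducer"  (infixl \<open>\<star>\<close> 70)
  where "T \<star> U =
     \<lparr>states = states T \<times> states U,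
      step = (\<lambda>x (p, q). (step T x p, steps U (out T x p) q)),
      out = (\<lambda>x (p, q). outs U (out T x p) q)\<rparr>"

text \<open>As state sets are finite, every transducer is equal to one whose states are natural numbers.
  Elements of the monoid are classes of such transducers modulo equality.\<close>

definition M_transducers :: "nat \<Rightarrow> nat transducer set" where
  "M_transducers n =
     {T. transducer n T \<and> minimal n T \<and> strongly_synchronizing n T \<and> is_core n T}"

definition tr_class :: "nat \<Rightarrow> 'q transducer \<Rightarrow> nat transducer set" where
  "tr_class n T = {U \<in> M_transducers n. transducer_eq n T U}"

definition id_transducer :: "nat transducer" where
  "id_transducer = \<lparr>states = {0}, step = (\<lambda>_ _. 0), out = (\<lambda>x _. [x])\<rparr>"

definition M_monoid :: "nat \<Rightarrow> nat transducer set monoid" where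
  "M_monoid n =
     \<lparr>carrier = tr_class n ` M_transducers n,
      mult = (\<lambda>A B. \<Union>T\<in>A. \<Union>U\<in>B. tr_class n (reduction n (core n (T \<star> U)))),
      one = tr_class n id_transducer\<rparr>"

definition O_tilde :: "nat \<Rightarrow> nat transducer set monoid" where
  "O_tilde n = (M_monoid n)\<lparr>carrier :=
     {A \<in> carrier (M_monoid n). \<forall>T\<in>A. \<forall>q\<in>states T.
        inj_on (omega_out T q) (inf_words n) \<and>
        openin (cantor n) (image_of n T q) \<and> closedin (cantor n) (image_of n T q)}\<rparr>"

definition O_group :: "nat \<Rightarrow> nat transducer set monoid" where
  "O_group n = units_of (O_tilde n)"

definition cone_number :: "nat \<Rightarrow> 'q transducer \<Rightarrow> 'q \<Rightarrow> nat" where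
  "cone_number n T q =
     (LEAST m. \<exists>V \<subseteq> lists {..<n}. finite V \<and> card V = m \<and> image_of n T q = (\<Union>\<nu>\<in>V. cone n \<nu>))"

text \<open>The residue does not depend on the state \<open>q\<close>.\<close>

definition sig :: "nat \<Rightarrow> 'q transducer \<Rightarrow> nat" where
  "sig n T = cone_number n T (SOME q. q \<in> states T) mod (n - 1)"

definition O_nr :: "nat \<Rightarrow> nat \<Rightarrow> nat transducer set monoid" where
  "O_nr n r = (O_group n)\<lparr>carrier :=
     {A \<in> carrier (O_group n). \<forall>T\<in>A. [r * sig n T = r] (mod (n - 1))}\<rparr>"

definition L_tilde :: "nat \<Rightarrow> nat transducer set set" where
  "L_tilde n = {A \<in> carrier (M_monoid n). \<forall>T\<in>A. \<forall>a\<in>lists {..<n}. \<forall>q\<in>states T.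
     steps T a q = q \<longrightarrow> length (outs T a q) = length a}"

definition L_n :: "nat \<Rightarrow> nat transducer set set" where
  "L_n n = carrier (O_group n) \<inter> L_tilde n"

definition L_nr :: "nat \<Rightarrow> nat \<Rightarrow> nat transducer set set" where
  "L_nr n r = L_n n \<inter> carrier (O_nr n r)"

definition centre :: "('a, 'b) monoid_scheme \<Rightarrow> 'a set" where
  "centre G = {z \<in> carrier G. \<forall>g\<in>carrier G. z \<otimes>\<^bsub>G\<^esub> g = g \<otimes>\<^bsub>G\<^esub> z}"

end

theory Submission
  imports Defs "HOL-Library.Countable_Set"
begin

text \<open>A map \<open>f\<close> on infinite words has at each finite word \<open>w\<close> a local action: \<open>f (w \<frown> x)\<close> is the
  greatest common prefix \<open>lcp f w\<close> of these values followed by \<open>loc f w x\<close>. Strong synchronization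
  says that the local action depends only on the last letters of \<open>w\<close>. An element of the monoid of
  transducers is the same thing as the finite set \<open>recurrent f\<close> of local actions at long words of
  one of its state maps \<open>f\<close>, and the product becomes composition of maps. Two maps
  with the same local actions have tail equivalent values.

  Let \<open>A\<close> and \<open>B\<close> be words whose occurrences can never overlap. Interchanging all occurrences of
  \<open>A\<close> and \<open>B\<close> is an involutive homeomorphism, hence gives an element of each of the groups. Such
  pairs are the words \<open>0\<^sup>N 1 V 0 1\<^sup>N\<close> with different \<open>V\<close>. If \<open>A\<close> and \<open>B\<close> have different lengths,
  the period of \<open>A\<^sup>\<omega>\<close> changes, and longer and longer pairs give infinitely many cosets of the
  elements preserving lengths of circuits.

  A central element commutes with all interchanges. So its image of the periodic word
  \<open>A\<^sup>\<omega>\<close>, \<open>A = 0\<^sup>N 1 V 0 1\<^sup>N\<close>, contains \<open>A\<close> and no other word of this kind, and the output on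
  \<open>A\<close> depends on \<open>V\<close> in the same way as \<open>A\<close> does, up to a multiplicity. Comparing letter counts
  shows that the output is a rotation of a power of \<open>A\<close>, and comparing runs of zeros that it is a
  rotation of \<open>A\<close> by a bounded amount. As \<open>V\<close> is arbitrary, some state acts as the identity.\<close>


subsection \<open>Infinite words and local actions\<close>

text \<open>Two obstacles shape the proof. Equality in the group controls maps only up to finite
  prefixes: two representatives have equal local actions after long words, so their values are
  merely tail equivalent. Periodic words are the remedy, because the tail class of
  \<open>w\<^sup>\<omega>\<close> still determines \<open>w\<close> up to rotation and powers.
  Moreover the state of a transducer in which a word is read is unknown; if \<open>k\<close> is a
  synchronizing level, the runs of a marker with \<open>N\<close> at least \<open>k\<close> force
  it. All markers then label circuits at one state, and the output on such a circuit splits into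
  pieces depending on \<open>N\<close> alone and one piece depending on \<open>V\<close> alone. For
  one fixed \<open>N\<close> there are markers of any large length, so a marker can be exchanged for
  one too long to occur in the periodic output; this excludes foreign markers. The presence of the
  own marker uses the inverse element. Injectivity of the state maps makes all common prefixes
  finite, which removes the transducers \<open>Z_x\<close> and lets products be computed with
  functions. Interchanges lie in the group for every \<open>r\<close> because their images consist
  of 1 modulo \<open>n - 1\<close> cones.\<close>

declare build_cons [simp del] build_append [simp del] in_lists_conv_set [simp del]

lemma replicate_in_lists [simp]: "a \<in> A \<Longrightarrow> replicate k a \<in> lists A"
  by (auto simp: in_lists_conv_set)

lemma take_in_lists [simp]: "w \<in> lists A \<Longrightarrow> take k w \<in> lists A"
  by (auto simp: in_lists_conv_set dest: in_set_takeD)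

lemma drop_in_lists [simp]: "w \<in> lists A \<Longrightarrow> drop k w \<in> lists A"
  by (auto simp: in_lists_conv_set dest: in_set_dropD)

abbreviation wtake :: "nat \<Rightarrow> 'a word \<Rightarrow> 'a list" where
  "wtake k x \<equiv> Omega_Words_Fun.subsequence x 0 k"

abbreviation wdrop :: "nat \<Rightarrow> 'a word \<Rightarrow> 'a word" where
  "wdrop \<equiv> Omega_Words_Fun.suffix"

lemma inf_words_eq: "inf_words n = {x. \<forall>i. x i < n}"
  by (auto simp: inf_words_def cantor_def PiE_def Pi_def)

lemma wdrop_length_conc [simp]: "length u = k \<Longrightarrow> wdrop k (u \<frown> x) = x"
  using suffix_conc_length by blast

lemma conc_in_inf_words [simp]:
  "u \<frown> x \<in> inf_words n \<longleftrightarrow> u \<in> lists {..<n} \<and> x \<in> inf_words n"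
proof
  assume a: "u \<frown> x \<in> inf_words n"
  have "x i < n" for i using a[unfolded inf_words_eq, simplified, rule_format, of "i + length u"] by (simp add: conc_def)
  moreover have "u ! i < n" if "i < length u" for i
    using a[unfolded inf_words_eq, simplified, rule_format, of i] that by simp
  ultimately show "u \<in> lists {..<n} \<and> x \<in> inf_words n"
    by (auto simp: inf_words_eq in_set_conv_nth in_lists_conv_set)
qed (auto simp: inf_words_eq conc_def in_lists_conv_set)

lemma wdrop_in_inf_words [simp]: "x \<in> inf_words n \<Longrightarrow> wdrop k x \<in> inf_words n"
  by (auto simp: inf_words_eq)

lemma subsequence_in_lists [simp]: "x \<in> inf_words n \<Longrightarrow> Omega_Words_Fun.subsequence x i j \<in> lists {..<n}"
  by (auto simp: inf_words_eq in_lists_conv_set)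

lemma iter_in_inf_words: "w \<in> lists {..<n} \<Longrightarrow> w \<noteq> [] \<Longrightarrow> w\<^sup>\<omega> \<in> inf_words n"
  by (auto simp: inf_words_eq in_lists_conv_set)

lemma omega_prefix_iff: "omega_prefix u y \<longleftrightarrow> (\<forall>i<length u. y i = u ! i)"
proof
  assume "\<forall>i<length u. y i = u ! i"
  then have "y = u \<frown> wdrop (length u) y" by (auto simp: fun_eq_iff conc_def)
  then show "omega_prefix u y" unfolding omega_prefix_def by blast
qed (auto simp: omega_prefix_def)

lemma omega_prefix_decomp: "omega_prefix u y \<Longrightarrow> u \<frown> wdrop (length u) y = y"
  by (auto simp: omega_prefix_def)

lemma omega_prefix_conc [simp]: "omega_prefix u (u \<frown> x)"
  by (auto simp: omega_prefix_def)

lemma omega_prefix_comparable: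
  assumes "omega_prefix u y" "omega_prefix v y" "length u \<le> length v"
  shows "Sublist.prefix u v"
proof -
  have "take (length u) v = u"
    using assms by (intro nth_equalityI) (auto simp: omega_prefix_iff)
  then show ?thesis by (metis take_is_prefix)
qed

lemma omega_prefix_conc_iff:
  "length u \<le> length v \<Longrightarrow> omega_prefix u (v \<frown> x) \<longleftrightarrow> Sublist.prefix u v"
  by (metis conc_conc omega_prefix_comparable omega_prefix_conc prefixE)

lemma omega_prefix_append: "omega_prefix (u @ v) (u \<frown> x) \<longleftrightarrow> omega_prefix v x"
  by (metis conc_conc omega_prefix_def same_concat_eq)

definition agree :: "nat \<Rightarrow> 'a word \<Rightarrow> 'a word \<Rightarrow> bool" where
  "agree m x y \<longleftrightarrow> (\<forall>i<m. x i = y i)"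

lemma agree_mono: "agree m x y \<Longrightarrow> k \<le> m \<Longrightarrow> agree k x y"
  by (auto simp: agree_def)

lemma agree_conc: "agree (length u) (u \<frown> x) (u \<frown> y)"
  by (simp add: agree_def)

lemma agree_conc_add: "agree (length u + m) (u \<frown> x) (u \<frown> y) \<longleftrightarrow> agree m x y"
proof
  assume a: "agree (length u + m) (u \<frown> x) (u \<frown> y)"
  show "agree m x y" unfolding agree_def
  proof (intro allI impI)
    fix i assume "i < m"
    then have "(u \<frown> x) (length u + i) = (u \<frown> y) (length u + i)"
      using a unfolding agree_def by (metis nat_add_left_cancel_less)
    then show "x i = y i" by (simp add: conc_def)
  qed
qed (auto simp: agree_def conc_def)

locale alphabet =
  fixes n :: nat
  assumes n2: "2 \<le> n"
begin

abbreviation I :: "nat word set" where "I \<equiv> inf_words n"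
abbreviation W :: "nat list set" where "W \<equiv> lists {..<n}"

lemma zero_in_I [simp]: "(\<lambda>_. 0) \<in> I" and one_in_I [simp]: "(\<lambda>_. Suc 0) \<in> I"
  using n2 by (auto simp: inf_words_eq)

lemma zero_less_n [simp]: "0 < n" and one_less_n [simp]: "Suc 0 < n"
  using n2 by auto

section \<open>Uniformly continuous injections, their common prefixes and local actions\<close>

definition ucont :: "(nat word \<Rightarrow> nat word) \<Rightarrow> bool" where
  "ucont f \<longleftrightarrow> (\<forall>m. \<exists>k. \<forall>x\<in>I. \<forall>y\<in>I. agree k x y \<longrightarrow> agree m (f x) (f y))"

text \<open>Injectivity keeps every common prefix finite, so that \<open>lcp\<close> and
  \<open>loc\<close> make sense at every word; uniform continuity makes \<open>lcp\<close> long on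
  long words.\<close>

definition good :: "(nat word \<Rightarrow> nat word) \<Rightarrow> bool" where
  "good f \<longleftrightarrow> f \<in> I \<rightarrow> I \<and> inj_on f I \<and> ucont f"

text \<open>The counterpart for functions of having no incomplete response.\<close>

definition spread :: "(nat word \<Rightarrow> nat word) \<Rightarrow> bool" where
  "spread g \<longleftrightarrow> (\<exists>x\<in>I. \<exists>y\<in>I. g x 0 \<noteq> g y 0)"

text \<open>\<open>GREATEST\<close> needs an upper bound; it comes from \<open>good_bounded\<close>,
  or from a \<open>spread\<close> remainder as in \<open>loc_unique\<close>.\<close>

definition cplen :: "(nat word \<Rightarrow> nat word) \<Rightarrow> nat list \<Rightarrow> nat" where
  "cplen f w = (GREATEST m. \<forall>x\<in>I. \<forall>y\<in>I. agree m (f (w \<frown> x)) (f (w \<frown> y)))"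

definition lcp :: "(nat word \<Rightarrow> nat word) \<Rightarrow> nat list \<Rightarrow> nat list" where
  "lcp f w = wtake (cplen f w) (f (w \<frown> (\<lambda>_. 0)))"

text \<open>The restriction turns agreement on \<open>I\<close> into equality of functions, so that
  local actions can be collected in sets and counted.\<close>

definition loc :: "(nat word \<Rightarrow> nat word) \<Rightarrow> nat list \<Rightarrow> nat word \<Rightarrow> nat word" where
  "loc f w = restrict (\<lambda>x. wdrop (cplen f w) (f (w \<frown> x))) I"

text \<open>Two values of \<open>g\<close> with different first letters stop the common prefix
  exactly at the end of \<open>u\<close>. Concrete local actions are computed in this way.\<close>

lemma loc_unique:
  assumes w: "w \<in> W" and dec: "\<And>x. x \<in> I \<Longrightarrow> f (w \<frown> x) = u \<frown> g x" and g: "spread g"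
  shows "lcp f w = u" "loc f w = restrict g I"
proof -
  have "cplen f w = length u"
    unfolding cplen_def
  proof (rule Greatest_equality)
    show "\<forall>x\<in>I. \<forall>y\<in>I. agree (length u) (f (w \<frown> x)) (f (w \<frown> y))"
      using dec by (simp add: agree_conc)
  next
    fix m assume m: "\<forall>x\<in>I. \<forall>y\<in>I. agree m (f (w \<frown> x)) (f (w \<frown> y))"
    show "m \<le> length u"
    proof (rule ccontr)
      assume "\<not> m \<le> length u"
      then have lt: "length u < m" by simp
      obtain x y where xy: "x \<in> I" "y \<in> I" "g x 0 \<noteq> g y 0" using g by (auto simp: spread_def)
      have "agree m (f (w \<frown> x)) (f (w \<frown> y))" using m xy by blast
      then have "f (w \<frown> x) (length u) = f (w \<frown> y) (length u)" using lt by (simp add: agree_def)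
      then show False using xy dec by simp
    qed
  qed
  then show "lcp f w = u" "loc f w = restrict g I"
    using dec[of "\<lambda>_. 0"] dec by (auto simp: lcp_def loc_def restrict_def)
qed

lemma goodD: "good f \<Longrightarrow> x \<in> I \<Longrightarrow> f x \<in> I"
  "good f \<Longrightarrow> x \<in> I \<Longrightarrow> y \<in> I \<Longrightarrow> f x = f y \<Longrightarrow> x = y"
  by (auto simp: good_def inj_on_def)

lemma good_ucontD:
  assumes "good f" shows "\<exists>k. \<forall>x\<in>I. \<forall>y\<in>I. agree k x y \<longrightarrow> agree m (f x) (f y)"
  using assms by (auto simp: good_def ucont_def)

text \<open>Injectivity separates the images of two words that begin with \<open>w\<close>; the
  first place where they differ is the bound.\<close>

lemma good_bounded:
  assumes f: "good f" and w: "w \<in> W"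
  shows "\<exists>b. \<forall>m. (\<forall>x\<in>I. \<forall>y\<in>I. agree m (f (w \<frown> x)) (f (w \<frown> y))) \<longrightarrow> m \<le> b"
proof -
  have "f (w \<frown> (\<lambda>_. 0)) \<noteq> f (w \<frown> (\<lambda>_. Suc 0))"
  proof
    assume "f (w \<frown> (\<lambda>_. 0)) = f (w \<frown> (\<lambda>_. Suc 0))"
    then have "w \<frown> (\<lambda>_. 0::nat) = w \<frown> (\<lambda>_. Suc 0)" using goodD(2)[OF f, of "w \<frown> (\<lambda>_. 0)" "w \<frown> (\<lambda>_. Suc 0)"] w by simp
    then have "(\<lambda>_::nat. 0::nat) = (\<lambda>_. Suc 0)" by (simp only: same_concat_eq)
    then show False by (metis nat.distinct(1))
  qed
  then obtain i where i: "f (w \<frown> (\<lambda>_. 0)) i \<noteq> f (w \<frown> (\<lambda>_. Suc 0)) i" by (auto simp: fun_eq_iff)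
  show ?thesis
  proof (rule exI[of _ i], intro allI impI)
    fix m assume "\<forall>x\<in>I. \<forall>y\<in>I. agree m (f (w \<frown> x)) (f (w \<frown> y))"
    then have "agree m (f (w \<frown> (\<lambda>_. 0))) (f (w \<frown> (\<lambda>_. Suc 0)))" by simp
    then show "m \<le> i" using i by (auto simp: agree_def not_less[symmetric])
  qed
qed

lemma cplen_agree:
  assumes f: "good f" and w: "w \<in> W" and xy: "x \<in> I" "y \<in> I"
  shows "agree (cplen f w) (f (w \<frown> x)) (f (w \<frown> y))"
proof -
  obtain b where b: "\<And>m. (\<forall>x\<in>I. \<forall>y\<in>I. agree m (f (w \<frown> x)) (f (w \<frown> y))) \<Longrightarrow> m \<le> b"
    using good_bounded[OF f w] by blast
  let ?P = "\<lambda>m. \<forall>x\<in>I. \<forall>y\<in>I. agree m (f (w \<frown> x)) (f (w \<frown> y))"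
  have "?P (Greatest ?P)"
    by (rule GreatestI_nat[of ?P 0 b]) (auto simp: agree_def[of 0] b)
  then show ?thesis using xy unfolding cplen_def by blast
qed

lemma cplen_greatest:
  assumes f: "good f" and w: "w \<in> W"
    and m: "\<And>x y. x \<in> I \<Longrightarrow> y \<in> I \<Longrightarrow> agree m (f (w \<frown> x)) (f (w \<frown> y))"
  shows "m \<le> cplen f w"
proof -
  obtain b where b: "\<And>m. (\<forall>x\<in>I. \<forall>y\<in>I. agree m (f (w \<frown> x)) (f (w \<frown> y))) \<Longrightarrow> m \<le> b"
    using good_bounded[OF f w] by blast
  show ?thesis unfolding cplen_def by (rule Greatest_le_nat[of _ _ b]) (use m b in auto)
qed

lemma length_lcp [simp]: "length (lcp f w) = cplen f w"
  by (simp add: lcp_def)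

lemma loc_decomp:
  assumes f: "good f" and w: "w \<in> W" and x: "x \<in> I"
  shows "f (w \<frown> x) = lcp f w \<frown> loc f w x"
proof -
  have "omega_prefix (lcp f w) (f (w \<frown> x))"
    using cplen_agree[OF f w x zero_in_I] by (simp add: omega_prefix_iff lcp_def agree_def)
  from omega_prefix_decomp[OF this] show ?thesis using x by (simp add: loc_def)
qed

lemma lcp_in_W:
  assumes "good f" "w \<in> W" shows "lcp f w \<in> W"
proof -
  have "w \<frown> (\<lambda>_. 0) \<in> I" using assms by simp
  then have "f (w \<frown> (\<lambda>_. 0)) \<in> I" using goodD(1) assms by blast
  then have "wtake (cplen f w) (f (w \<frown> (\<lambda>_. 0))) \<in> W" by (rule subsequence_in_lists)
  then show ?thesis unfolding lcp_def .
qed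

text \<open>A first letter shared by all remainders would prolong the greatest common
  prefix.\<close>

lemma spread_loc:
  assumes f: "good f" and w: "w \<in> W" shows "spread (loc f w)"
proof (rule ccontr)
  assume "\<not> spread (loc f w)"
  then have eq: "loc f w x 0 = loc f w y 0" if "x \<in> I" "y \<in> I" for x y
    using that unfolding spread_def by blast
  have "Suc (cplen f w) \<le> cplen f w"
  proof (rule cplen_greatest[OF f w])
    fix x y assume xy: "x \<in> I" "y \<in> I"
    have "agree (length (lcp f w) + 1) (f (w \<frown> x)) (f (w \<frown> y))"
      unfolding loc_decomp[OF f w xy(1)] loc_decomp[OF f w xy(2)] agree_conc_add
      using eq[OF xy] by (simp add: agree_def)
    then show "agree (Suc (cplen f w)) (f (w \<frown> x)) (f (w \<frown> y))" by simp
  qed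
  then show False by simp
qed

lemma restrict_loc [simp]: "restrict (loc f w) I = loc f w"
  by (simp add: loc_def)

lemma good_loc:
  assumes f: "good f" and w: "w \<in> W" shows "good (loc f w)"
proof -
  note d = loc_decomp[OF f w]
  have "loc f w x \<in> I" if "x \<in> I" for x
    using goodD(1)[OF f, of "w \<frown> x"] that w d[OF that] by simp
  moreover have "inj_on (loc f w) I"
  proof (rule inj_onI)
    fix x y assume xy: "x \<in> I" "y \<in> I" "loc f w x = loc f w y"
    then have "f (w \<frown> x) = f (w \<frown> y)" by (simp add: d)
    then show "x = y" using goodD(2)[OF f, of "w \<frown> x" "w \<frown> y"] xy w by simp
  qed
  moreover have "ucont (loc f w)"
    unfolding ucont_def
  proof
    fix m
    obtain k where k: "\<And>x y. x \<in> I \<Longrightarrow> y \<in> I \<Longrightarrow> agree k x y \<Longrightarrow> agree (length (lcp f w) + m) (f x) (f y)"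
      using good_ucontD[OF f, of "length (lcp f w) + m"] by blast
    show "\<exists>k. \<forall>x\<in>I. \<forall>y\<in>I. agree k x y \<longrightarrow> agree m (loc f w x) (loc f w y)"
    proof (rule exI[of _ k], intro ballI impI)
      fix x y assume xy: "x \<in> I" "y \<in> I" "agree k x y"
      then have "agree (length w + k) (w \<frown> x) (w \<frown> y)" by (simp add: agree_conc_add)
      then have "agree k (w \<frown> x) (w \<frown> y)" by (rule agree_mono) simp
      then have "agree (length (lcp f w) + m) (f (w \<frown> x)) (f (w \<frown> y))"
        using xy w by (intro k) simp_all
      then show "agree m (loc f w x) (loc f w y)" unfolding d[OF xy(1)] d[OF xy(2)] agree_conc_add .
    qed
  qed
  ultimately show ?thesis by (auto simp: good_def)
qed

text \<open>Output already written does not influence the local action, so words leading to the same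
  continuation can replace each other.\<close>

lemma loc_factor:
  assumes w: "w \<in> W" and dec: "\<And>x. x \<in> I \<Longrightarrow> f (w \<frown> x) = u \<frown> g (v \<frown> x)" and g: "good g" and v: "v \<in> W"
  shows "lcp f w = u @ lcp g v" "loc f w = loc g v"
proof -
  have "f (w \<frown> x) = (u @ lcp g v) \<frown> loc g v x" if "x \<in> I" for x
    using dec[OF that] loc_decomp[OF g v that] by simp
  from loc_unique[OF w this spread_loc[OF g v]]
  show "lcp f w = u @ lcp g v" "loc f w = loc g v" by auto
qed

text \<open>A chain rule; read letter by letter it gives the transitions and outputs of a transducer
  whose states are local actions.\<close>

lemma loc_append:
  assumes f: "good f" and u: "u \<in> W" and v: "v \<in> W"
  shows "lcp f (u @ v) = lcp f u @ lcp (loc f u) v" "loc f (u @ v) = loc (loc f u) v"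
proof -
  have "f ((u @ v) \<frown> x) = lcp f u \<frown> loc f u (v \<frown> x)" if "x \<in> I" for x
    using loc_decomp[OF f u, of "v \<frown> x"] v that by simp
  from loc_factor[OF _ this good_loc[OF f u] v] u v
  show "lcp f (u @ v) = lcp f u @ lcp (loc f u) v" "loc f (u @ v) = loc (loc f u) v" by auto
qed

lemma loc_spread:
  assumes "spread g" shows "lcp g [] = []" "loc g [] = restrict g I"
  using loc_unique[of "[]" g "[]" g] assms by auto

lemma loc_cong:
  assumes "\<And>x. x \<in> I \<Longrightarrow> f x = g x" "w \<in> W"
  shows "loc f w = loc g w" "lcp f w = lcp g w"
proof -
  have eq: "f (w \<frown> x) = g (w \<frown> x)" if "x \<in> I" for x using assms that by simp
  then have "cplen f w = cplen g w" unfolding cplen_def by simp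
  then show "loc f w = loc g w" "lcp f w = lcp g w"
    using eq[OF zero_in_I] eq by (auto simp: loc_def lcp_def intro!: restrict_ext)
qed

lemma good_cong: "good f \<Longrightarrow> (\<And>x. x \<in> I \<Longrightarrow> f x = g x) \<Longrightarrow> good g"
  by (auto simp: good_def ucont_def Pi_def inj_on_def)

lemma good_comp:
  assumes f: "good f" and g: "good g" shows "good (\<lambda>x. g (f x))"
proof -
  have "ucont (\<lambda>x. g (f x))"
    unfolding ucont_def
  proof
    fix m
    obtain k where k: "\<And>x y. x \<in> I \<Longrightarrow> y \<in> I \<Longrightarrow> agree k x y \<Longrightarrow> agree m (g x) (g y)"
      using good_ucontD[OF g, of m] by blast
    obtain l where l: "\<And>x y. x \<in> I \<Longrightarrow> y \<in> I \<Longrightarrow> agree l x y \<Longrightarrow> agree k (f x) (f y)"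
      using good_ucontD[OF f, of k] by blast
    show "\<exists>k. \<forall>x\<in>I. \<forall>y\<in>I. agree k x y \<longrightarrow> agree m (g (f x)) (g (f y))"
      using k l goodD(1)[OF f] by (intro exI[of _ l]) blast
  qed
  moreover have "inj_on (\<lambda>x. g (f x)) I"
    using goodD[OF f] goodD(2)[OF g] by (intro inj_onI) blast
  ultimately show ?thesis using goodD(1)[OF f] goodD(1)[OF g] by (simp add: good_def)
qed

lemma good_id: "good (\<lambda>x. x)"
  by (auto simp: good_def ucont_def)

lemma good_lcp_long:
  assumes f: "good f" shows "\<exists>K. \<forall>w\<in>W. K \<le> length w \<longrightarrow> m \<le> length (lcp f w)"
proof -
  obtain k where k: "\<And>x y. x \<in> I \<Longrightarrow> y \<in> I \<Longrightarrow> agree k x y \<Longrightarrow> agree m (f x) (f y)"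
    using good_ucontD[OF f, of m] by blast
  show ?thesis
  proof (intro exI[of _ k] ballI impI)
    fix w assume w: "w \<in> W" "k \<le> length w"
    have "m \<le> cplen f w"
    proof (rule cplen_greatest[OF f w(1)])
      fix x y assume xy: "x \<in> I" "y \<in> I"
      have "agree k (w \<frown> x) (w \<frown> y)" by (rule agree_mono[OF agree_conc w(2)])
      then show "agree m (f (w \<frown> x)) (f (w \<frown> y))"
        using xy w by (intro k) simp_all
    qed
    then show "m \<le> length (lcp f w)" by simp
  qed
qed

section \<open>Synchronization and recurrent local actions\<close>

definition sync :: "nat \<Rightarrow> (nat word \<Rightarrow> nat word) \<Rightarrow> bool" where
  "sync K f \<longleftrightarrow> (\<forall>u\<in>W. \<forall>w\<in>W. K \<le> length w \<longrightarrow> loc f (u @ w) = loc f w)"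

definition synchronizing :: "(nat word \<Rightarrow> nat word) \<Rightarrow> bool" where
  "synchronizing f \<longleftrightarrow> good f \<and> (\<exists>K. sync K f)"

text \<open>Demanding arbitrarily long words discards transient actions, as passing to the core
  discards transient states.\<close>

definition recurrent :: "(nat word \<Rightarrow> nat word) \<Rightarrow> (nat word \<Rightarrow> nat word) set" where
  "recurrent f = {g. \<forall>K. \<exists>w\<in>W. K \<le> length w \<and> loc f w = g}"

lemma syncD: "sync K f \<Longrightarrow> u \<in> W \<Longrightarrow> w \<in> W \<Longrightarrow> K \<le> length w \<Longrightarrow> loc f (u @ w) = loc f w"
  by (auto simp: sync_def)

text \<open>Only the last \<open>K\<close> letters of a long word matter, and a word of length
  \<open>K\<close> becomes arbitrarily long by putting zeros in front of it.\<close>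

lemma sync_recurrent:
  assumes "sync K f" shows "recurrent f = {loc f w | w. w \<in> W \<and> K \<le> length w}"
    "recurrent f = {loc f w | w. w \<in> W \<and> length w = K}"
proof -
  have a: "recurrent f \<subseteq> {loc f w | w. w \<in> W \<and> K \<le> length w}" unfolding recurrent_def by blast
  have b: "\<exists>v. loc f w = loc f v \<and> v \<in> W \<and> length v = K" if w: "w \<in> W" "K \<le> length w" for w
  proof -
    let ?u = "take (length w - K) w" let ?v = "drop (length w - K) w"
    have v: "?u \<in> W" "?v \<in> W" "length ?v = K"
      using w by auto
    then have "loc f (?u @ ?v) = loc f ?v" using assms by (intro syncD) auto
    then show ?thesis using v by (metis append_take_drop_id)
  qed
  have c: "loc f w \<in> recurrent f" if w: "w \<in> W" "length w = K" for w
    unfolding recurrent_def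
  proof (intro CollectI allI)
    fix k
    have "loc f (replicate k 0 @ w) = loc f w" using assms w by (intro syncD) auto
    then show "\<exists>wa\<in>W. k \<le> length wa \<and> loc f wa = loc f w"
      using w by (intro bexI[of _ "replicate k 0 @ w"]) auto
  qed
  show 1: "recurrent f = {loc f w | w. w \<in> W \<and> length w = K}"
    using a b c by blast
  show "recurrent f = {loc f w | w. w \<in> W \<and> K \<le> length w}"
    using a b unfolding 1 by blast
qed

lemma finite_words: "finite {w \<in> W. length w = K}"
  using finite_lists_length_eq[of "{..<n}" K] by (auto elim: rev_finite_subset)

lemma finite_recurrent: "synchronizing f \<Longrightarrow> finite (recurrent f)"
proof -
  assume "synchronizing f"
  then obtain K where "sync K f" by (auto simp: synchronizing_def)
  then have "recurrent f = loc f ` {w \<in> W. length w = K}" using sync_recurrent(2) by blast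
  then show ?thesis using finite_words by simp
qed

lemma recurrent_nonempty: "synchronizing f \<Longrightarrow> recurrent f \<noteq> {}"
proof -
  assume "synchronizing f"
  then obtain K where K: "sync K f" by (auto simp: synchronizing_def)
  have "loc f (replicate K 0) \<in> recurrent f" unfolding sync_recurrent(2)[OF K] by force
  then show ?thesis by auto
qed

lemma recurrent_good: "good f \<Longrightarrow> g \<in> recurrent f \<Longrightarrow> good g \<and> spread g \<and> restrict g I = g"
  unfolding recurrent_def using good_loc spread_loc restrict_loc by blast

lemma recurrent_cong: "(\<And>x. x \<in> I \<Longrightarrow> f x = g x) \<Longrightarrow> recurrent f = recurrent g"
proof -
  assume "\<And>x. x \<in> I \<Longrightarrow> f x = g x"
  then have "loc f w = loc g w" if "w \<in> W" for w using that by (rule loc_cong)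
  then have "(\<exists>w\<in>W. K \<le> length w \<and> loc f w = h) \<longleftrightarrow> (\<exists>w\<in>W. K \<le> length w \<and> loc g w = h)" for K h
    by (metis (full_types))
  then show ?thesis by (simp add: recurrent_def)
qed

text \<open>Both functions share some local action; after it, synchronization erases the past.\<close>

lemma recurrent_eq_imp_loc_eq:
  assumes f: "synchronizing f" and g: "synchronizing g" and eq: "recurrent f = recurrent g"
  shows "\<exists>K. \<forall>w\<in>W. K \<le> length w \<longrightarrow> loc f w = loc g w"
proof -
  obtain K where K: "sync K f" "good f" using f by (auto simp: synchronizing_def)
  obtain L where L: "sync L g" "good g" using g by (auto simp: synchronizing_def)
  obtain h where h: "h \<in> recurrent f" "h \<in> recurrent g" using recurrent_nonempty[OF f] eq by auto
  obtain u where u: "u \<in> W" "loc f u = h" using h unfolding recurrent_def by blast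
  obtain v where v: "v \<in> W" "loc g v = h" using h unfolding recurrent_def by blast
  show ?thesis
  proof (intro exI[of _ "max K L"] ballI impI)
    fix w assume w: "w \<in> W" "max K L \<le> length w"
    have "loc f w = loc f (u @ w)" using syncD[OF K(1)] u w by simp
    also have "\<dots> = loc h w" using loc_append(2)[OF K(2)] u w by simp
    also have "\<dots> = loc g (v @ w)" using loc_append(2)[OF L(2)] v w by simp
    also have "\<dots> = loc g w" using syncD[OF L(1)] v w by simp
    finally show "loc f w = loc g w" .
  qed
qed

section \<open>Tail equivalence of infinite words\<close>

definition tail_equiv :: "nat word \<Rightarrow> nat word \<Rightarrow> bool"  (infix "\<sim>" 50) where
  "x \<sim> y \<longleftrightarrow> (\<exists>u v z. x = u \<frown> z \<and> y = v \<frown> z)"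

lemma tail_equivI: "u \<frown> z \<sim> v \<frown> z"
  by (unfold tail_equiv_def, blast)

lemma tail_sym: "x \<sim> y \<Longrightarrow> y \<sim> x"
  unfolding tail_equiv_def by blast

lemma tail_equiv_iff_wdrop: "x \<sim> y \<longleftrightarrow> (\<exists>i j. wdrop i x = wdrop j y)"
proof
  assume "\<exists>i j. wdrop i x = wdrop j y"
  then obtain i j where "wdrop i x = wdrop j y" by auto
  then have "x = wtake i x \<frown> wdrop i x" "y = wtake j y \<frown> wdrop i x"
    using prefix_suffix[of x i] prefix_suffix[of y j] by simp_all
  then show "x \<sim> y" unfolding tail_equiv_def by blast
next
  assume "x \<sim> y"
  then obtain u v z where "x = u \<frown> z" "y = v \<frown> z" unfolding tail_equiv_def by blast
  then have "wdrop (length u) x = wdrop (length v) y" by simp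
  then show "\<exists>i j. wdrop i x = wdrop j y" by blast
qed

lemma tail_trans: "x \<sim> y \<Longrightarrow> y \<sim> z \<Longrightarrow> x \<sim> z"
  unfolding tail_equiv_iff_wdrop
proof (elim exE)
  fix i j k l assume a: "wdrop i x = wdrop j y" "wdrop k y = wdrop l z"
  have "wdrop (i + k) x = wdrop (l + j) z"
    using arg_cong[OF a(1), of "wdrop k"] arg_cong[OF a(2), of "wdrop j"] by (simp add: add.commute)
  then show "\<exists>i l. wdrop i x = wdrop l z" by blast
qed

lemma tail_conc [simp]: "u \<frown> x \<sim> x"
  using tail_equivI[of u x "[]"] by simp

lemma loc_eq_imp_tail:
  assumes f: "good f" and g: "good g" and K: "\<forall>w\<in>W. K \<le> length w \<longrightarrow> loc f w = loc g w" and x: "x \<in> I"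
  shows "f x \<sim> g x"
proof -
  have w: "wtake K x \<in> W" "wdrop K x \<in> I" using x by simp_all
  have "f x = lcp f (wtake K x) \<frown> loc f (wtake K x) (wdrop K x)"
    using loc_decomp[OF f w] prefix_suffix[of x K] by simp
  moreover have "g x = lcp g (wtake K x) \<frown> loc g (wtake K x) (wdrop K x)"
    using loc_decomp[OF g w] prefix_suffix[of x K] by simp
  moreover have "loc f (wtake K x) = loc g (wtake K x)" using K w by simp
  ultimately show ?thesis by (metis tail_equivI)
qed

text \<open>A changed finite beginning is forgotten after \<open>K\<close> further letters; from
  then on only the output already written can differ.\<close>

lemma synchronizing_respects_tail:
  assumes f: "synchronizing f" and x: "x \<in> I" "y \<in> I" "x \<sim> y" shows "f x \<sim> f y"
proof -
  obtain K where K: "sync K f" "good f" using f by (auto simp: synchronizing_def)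
  have *: "f (u \<frown> z) \<sim> f z" if "u \<in> W" "z \<in> I" for u z
  proof -
    have w: "wtake K z \<in> W" "wdrop K z \<in> I" using that by simp_all
    have z: "z = wtake K z \<frown> wdrop K z" by (rule prefix_suffix)
    have 1: "f z = lcp f (wtake K z) \<frown> loc f (wtake K z) (wdrop K z)"
      using loc_decomp[OF K(2) w] z by simp
    have "f (u \<frown> z) = f ((u @ wtake K z) \<frown> wdrop K z)" using z by (metis conc_conc)
    also have "\<dots> = lcp f (u @ wtake K z) \<frown> loc f (u @ wtake K z) (wdrop K z)"
      using loc_decomp[OF K(2), of "u @ wtake K z"] w that by simp
    also have "loc f (u @ wtake K z) = loc f (wtake K z)" using syncD[OF K(1)] w that by simp
    finally show ?thesis using 1 by (metis tail_equivI)
  qed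
  obtain u v z where uvz: "x = u \<frown> z" "y = v \<frown> z" using x by (unfold tail_equiv_def, blast)
  then have "f x \<sim> f z" "f y \<sim> f z" using * x by auto
  then show ?thesis using tail_trans tail_sym by blast
qed

end

subsection \<open>Maps induced by transducers\<close>

lemma wtake_add: "wtake (i + j) x = wtake i x @ wtake j (wdrop i x)"
  by (simp add: subsequence_append)

lemma wtake_length_conc: "length u \<le> k \<Longrightarrow> wtake k (u \<frown> x) = u @ wtake (k - length u) x"
  by simp

lemma steps_append [simp]: "steps T (u @ v) q = steps T v (steps T u q)"
  by (induction u arbitrary: q) auto

lemma outs_append [simp]: "outs T (u @ v) q = outs T u q @ outs T v (steps T u q)"
  by (induction u arbitrary: q) auto

lemma steps_in_states:
  "transducer n T \<Longrightarrow> w \<in> lists {..<n} \<Longrightarrow> q \<in> states T \<Longrightarrow> steps T w q \<in> states T"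
  by (induction w arbitrary: q) (auto simp: transducer_def)

lemma outs_in_lists:
  "transducer n T \<Longrightarrow> w \<in> lists {..<n} \<Longrightarrow> q \<in> states T \<Longrightarrow> outs T w q \<in> lists {..<n}"
  by (induction w arbitrary: q) (auto simp: transducer_def)

lemma outs_mono: "k \<le> m \<Longrightarrow> Sublist.prefix (outs T (wtake k x) q) (outs T (wtake m x) q)"
  using wtake_add[of x k "m - k"] by simp

text \<open>This is what makes the definite description in \<open>omega_out\<close> denote.\<close>

definition unbounded_out :: "'q transducer \<Rightarrow> 'q \<Rightarrow> nat word \<Rightarrow> bool" where
  "unbounded_out T q x \<longleftrightarrow> (\<forall>m. \<exists>k. m \<le> length (outs T (wtake k x) q))"

lemma omega_prefix_mono: "Sublist.prefix u v \<Longrightarrow> omega_prefix v y \<Longrightarrow> omega_prefix u y"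
  by (auto simp: omega_prefix_iff prefix_def nth_append)

text \<open>Prefixes of an infinite set of lengths suffice, so that a proof may look only at the
  convenient ones, for instance those that contain a given initial word.\<close>

lemma omega_out_unique:
  assumes unb: "unbounded_out T q x"
    and y: "\<And>m. \<exists>k\<ge>m. omega_prefix (outs T (wtake k x) q) y"
  shows "omega_out T q x = y"
  unfolding omega_out_def
proof (rule the_equality)
  show "\<forall>m. omega_prefix (outs T (wtake m x) q) y"
  proof
    fix m
    obtain k where k: "m \<le> k" "omega_prefix (outs T (wtake k x) q) y" using y by blast
    show "omega_prefix (outs T (wtake m x) q) y" by (rule omega_prefix_mono[OF outs_mono[OF k(1)] k(2)])
  qed
next
  fix z assume z: "\<forall>m. omega_prefix (outs T (wtake m x) q) z"
  show "z = y"
  proof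
    fix i
    obtain k where k: "Suc i \<le> length (outs T (wtake k x) q)" using unb unfolding unbounded_out_def by blast
    obtain l where l: "k \<le> l" "omega_prefix (outs T (wtake l x) q) y" using y by blast
    then have "Suc i \<le> length (outs T (wtake l x) q)"
      using k prefix_length_le[OF outs_mono[OF l(1)], of T x q] by linarith
    moreover have "omega_prefix (outs T (wtake l x) q) z" using z by blast
    ultimately show "z i = y i" using l(2) unfolding omega_prefix_iff by auto
  qed
qed

lemma omega_out_exists:
  assumes unb: "unbounded_out T q x"
  shows "\<exists>y. \<forall>m. omega_prefix (outs T (wtake m x) q) y"
proof -
  obtain k where k: "\<And>m. m \<le> length (outs T (wtake (k m) x) q)"
    using unb unfolding unbounded_out_def by metis
  define y where "y i = outs T (wtake (k (Suc i)) x) q ! i" for i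
  have "y i = outs T (wtake m x) q ! i" if i: "i < length (outs T (wtake m x) q)" for i m
  proof (cases "m \<le> k (Suc i)")
    case True
    from outs_mono[OF this, of T x q] show ?thesis using i by (auto simp: y_def prefix_def nth_append)
  next
    case False
    then have "Sublist.prefix (outs T (wtake (k (Suc i)) x) q) (outs T (wtake m x) q)"
      by (intro outs_mono) simp
    moreover have "i < length (outs T (wtake (k (Suc i)) x) q)" using k[of "Suc i"] by simp
    ultimately show ?thesis by (auto simp: y_def prefix_def nth_append)
  qed
  then show ?thesis unfolding omega_prefix_iff by blast
qed

lemma omega_out_prefix:
  assumes unb: "unbounded_out T q x"
  shows "omega_prefix (outs T (wtake m x) q) (omega_out T q x)"
proof -
  obtain y where y: "\<forall>m. omega_prefix (outs T (wtake m x) q) y" using omega_out_exists[OF unb] by blast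
  then have "omega_out T q x = y" by (intro omega_out_unique[OF unb]) blast
  then show ?thesis using y by simp
qed

text \<open>By the pigeonhole principle a word of this length visits some state twice, and the
  circuit in between has nonempty output.\<close>

lemma outs_nonempty:
  assumes T: "transducer n T" and q: "q \<in> states T" and w: "w \<in> lists {..<n}" "card (states T) \<le> length w"
  shows "outs T w q \<noteq> []"
proof -
  have fin: "finite (states T)" using T by (simp add: transducer_def)
  let ?f = "\<lambda>i. steps T (take i w) q"
  have sub: "?f ` {..card (states T)} \<subseteq> states T"
    using steps_in_states[OF T _ q] take_in_lists[OF w(1)] by blast
  have "\<not> inj_on ?f {..card (states T)}"
    using card_inj_on_le[OF _ sub fin] by auto
  then obtain i j where ij: "i < j" "j \<le> card (states T)" "?f i = ?f j"
    unfolding inj_on_def by (metis atMost_iff linorder_neqE_nat)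
  let ?u = "take (j - i) (drop i w)"
  have tj: "take j w = take i w @ ?u" using ij(1) by (metis le_add_diff_inverse less_imp_le take_add)
  have p: "?f i \<in> states T" using sub ij by auto
  have "?u \<noteq> []" using ij w by auto
  moreover have "steps T ?u (?f i) = ?f i" using ij(3) unfolding tj by simp
  moreover have "?u \<in> lists {..<n}" using w by simp
  ultimately have "outs T ?u (?f i) \<noteq> []" using T p unfolding transducer_def by blast
  moreover have "w = take i w @ ?u @ drop j w" using tj by (metis append.assoc append_take_drop_id)
  ultimately show ?thesis by (metis append_is_Nil_conv outs_append)
qed

lemma outs_long:
  assumes T: "transducer n T"
  shows "\<exists>K. \<forall>q\<in>states T. \<forall>w\<in>lists {..<n}. K \<le> length w \<longrightarrow> m \<le> length (outs T w q)"
proof (induction m)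
  case (Suc m)
  then obtain K where K: "\<And>q w. q \<in> states T \<Longrightarrow> w \<in> lists {..<n} \<Longrightarrow> K \<le> length w \<Longrightarrow> m \<le> length (outs T w q)"
    by blast
  show ?case
  proof (intro exI[of _ "K + card (states T)"] ballI impI)
    fix q w assume q: "q \<in> states T" and w: "w \<in> lists {..<n}" "K + card (states T) \<le> length w"
    have w': "take K w \<in> lists {..<n}" "drop K w \<in> lists {..<n}" "length (take K w) = K"
      "card (states T) \<le> length (drop K w)" using w by auto
    have "outs T w q = outs T (take K w) q @ outs T (drop K w) (steps T (take K w) q)"
      by (metis append_take_drop_id outs_append)
    moreover have "m \<le> length (outs T (take K w) q)" using K[OF q w'(1)] w'(3) by simp
    moreover have "outs T (drop K w) (steps T (take K w) q) \<noteq> []"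
      using outs_nonempty[OF T steps_in_states[OF T w'(1) q] w'(2,4)] .
    then have "1 \<le> length (outs T (drop K w) (steps T (take K w) q))" by (simp add: Suc_le_eq)
    ultimately show "Suc m \<le> length (outs T w q)" by simp
  qed
qed simp

lemma transducer_unbounded_out:
  assumes T: "transducer n T" and q: "q \<in> states T" and x: "x \<in> inf_words n"
  shows "unbounded_out T q x"
  unfolding unbounded_out_def
proof
  fix m
  obtain K where K: "\<And>w. w \<in> lists {..<n} \<Longrightarrow> K \<le> length w \<Longrightarrow> m \<le> length (outs T w q)"
    using outs_long[OF T, of m] q by blast
  show "\<exists>k. m \<le> length (outs T (wtake k x) q)"
    by (rule exI[of _ K], rule K) (use x in simp_all)
qed

lemma omega_out_conc:
  assumes T: "transducer n T" and q: "q \<in> states T" and x: "x \<in> inf_words n" and w: "w \<in> lists {..<n}"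
  shows "omega_out T q (w \<frown> x) = outs T w q \<frown> omega_out T (steps T w q) x"
proof (rule omega_out_unique)
  show "unbounded_out T q (w \<frown> x)"
    by (rule transducer_unbounded_out[OF T q]) (use x w in simp)
next
  fix m
  have unb: "unbounded_out T (steps T w q) x"
    by (rule transducer_unbounded_out[OF T steps_in_states[OF T w q] x])
  have "wtake (length w + m) (w \<frown> x) = w @ wtake m x" by (simp add: wtake_length_conc)
  then have "outs T (wtake (length w + m) (w \<frown> x)) q = outs T w q @ outs T (wtake m x) (steps T w q)"
    by simp
  then have "omega_prefix (outs T (wtake (length w + m) (w \<frown> x)) q) (outs T w q \<frown> omega_out T (steps T w q) x)"
    using omega_out_prefix[OF unb, of m] by (simp only: omega_prefix_append)
  then show "\<exists>k\<ge>m. omega_prefix (outs T (wtake k (w \<frown> x)) q) (outs T w q \<frown> omega_out T (steps T w q) x)"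
    by (intro exI[of _ "length w + m"]) simp
qed

lemma omega_out_in_inf_words:
  assumes T: "transducer n T" and q: "q \<in> states T" and x: "x \<in> inf_words n"
  shows "omega_out T q x \<in> inf_words n"
  unfolding inf_words_eq
proof (intro CollectI allI)
  fix i
  note unb = transducer_unbounded_out[OF T q x]
  obtain k where k: "Suc i \<le> length (outs T (wtake k x) q)" using unb unfolding unbounded_out_def by blast
  then have "omega_out T q x i = outs T (wtake k x) q ! i"
    using omega_out_prefix[OF unb, of k] by (simp add: omega_prefix_iff)
  moreover have "outs T (wtake k x) q \<in> lists {..<n}" using outs_in_lists[OF T _ q] x by simp
  ultimately show "omega_out T q x i < n" using k
    by (metis Suc_le_lessD in_lists_conv_set lessThan_iff nth_mem)
qed

text \<open>Unfolding the one-letter equation shows that every finite output is a prefix of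
  \<open>g q x\<close>. This is the tool for identifying the maps of constructed
  transducers.\<close>

lemma omega_out_eqI:
  assumes closed: "\<And>q a. q \<in> Q \<Longrightarrow> a < n \<Longrightarrow> step T a q \<in> Q"
    and g: "\<And>q a y. q \<in> Q \<Longrightarrow> a < n \<Longrightarrow> y \<in> inf_words n \<Longrightarrow> g q ([a] \<frown> y) = out T a q \<frown> g (step T a q) y"
    and q: "q \<in> Q" and x: "x \<in> inf_words n" and unb: "unbounded_out T q x"
  shows "omega_out T q x = g q x"
proof (rule omega_out_unique[OF unb])
  have *: "g q (w \<frown> y) = outs T w q \<frown> g (steps T w q) y"
    if "w \<in> lists {..<n}" "y \<in> inf_words n" "q \<in> Q" for w y q
    using that
  proof (induction w arbitrary: q)
    case (Cons a w)
    then have a: "a < n" "w \<in> lists {..<n}" by auto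
    have "g q ((a # w) \<frown> y) = g q ([a] \<frown> (w \<frown> y))" by simp
    also have "\<dots> = out T a q \<frown> g (step T a q) (w \<frown> y)" using Cons.prems a by (intro g) simp_all
    also have "g (step T a q) (w \<frown> y) = outs T w (step T a q) \<frown> g (steps T w (step T a q)) y"
      using Cons.IH a closed Cons.prems by simp
    finally show ?case by simp
  qed simp
  fix m
  have "g q x = g q (wtake m x \<frown> wdrop m x)" using prefix_suffix[of x m] by simp
  also have "\<dots> = outs T (wtake m x) q \<frown> g (steps T (wtake m x) q) (wdrop m x)"
    using x q by (intro *) simp_all
  finally have "omega_prefix (outs T (wtake m x) q) (g q x)" by simp
  then show "\<exists>k\<ge>m. omega_prefix (outs T (wtake k x) q) (g q x)" by blast
qed

lemma steps_tr_prod: "steps (T \<star> U) w (p, q) = (steps T w p, steps U (outs T w p) q)"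
  by (induction w arbitrary: p q) (auto simp: tr_prod_def)

lemma outs_tr_prod: "outs (T \<star> U) w (p, q) = outs U (outs T w p) q"
  by (induction w arbitrary: p q) (auto simp: tr_prod_def)

lemma sync_level_mono:
  assumes "sync_level n T k" "k \<le> length w" "w \<in> lists {..<n}" "transducer n T" "p \<in> states T" "q \<in> states T"
  shows "steps T w p = steps T w q"
proof -
  let ?u = "take (length w - k) w" and ?v = "drop (length w - k) w"
  have u: "?u \<in> lists {..<n}" "?v \<in> lists {..<n}" "length ?v = k" using assms by auto
  have "steps T ?u p \<in> states T" "steps T ?u q \<in> states T"
    using steps_in_states[OF assms(4) u(1)] assms(5,6) by blast+
  then have "steps T ?v (steps T ?u p) = steps T ?v (steps T ?u q)"
    using assms(1) u(2,3) unfolding sync_level_def by blast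
  then have "steps T (?u @ ?v) p = steps T (?u @ ?v) q" by (simp only: steps_append)
  then show ?thesis by simp
qed

context alphabet
begin

section \<open>State maps and minimal transducers\<close>

definition state_map :: "'q transducer \<Rightarrow> 'q \<Rightarrow> nat word \<Rightarrow> nat word" where
  "state_map T q = restrict (omega_out T q) I"

definition state_maps :: "'q transducer \<Rightarrow> (nat word \<Rightarrow> nat word) set" where
  "state_maps T = state_map T ` states T"

definition inj_tr :: "'q transducer \<Rightarrow> bool" where
  "inj_tr T \<longleftrightarrow> (\<forall>q\<in>states T. inj_on (omega_out T q) I)"

lemma state_map_conc:
  assumes "transducer n T" "q \<in> states T" "x \<in> I" "w \<in> W"
  shows "state_map T q (w \<frown> x) = outs T w q \<frown> state_map T (steps T w q) x"
  using omega_out_conc[OF assms] assms by (simp add: state_map_def)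

lemma omega_equiv_iff_state_map: "omega_equiv n T p U q \<longleftrightarrow> state_map T p = state_map U q"
  unfolding omega_equiv_def state_map_def by (auto simp: restrict_def fun_eq_iff)

lemma weakly_minimal_iff: "weakly_minimal n T \<longleftrightarrow> inj_on (state_map T) (states T)"
  unfolding weakly_minimal_def omega_equiv_iff_state_map inj_on_def by blast

text \<open>Distinct states of a weakly minimal transducer have distinct maps, so the bijection is
  forced. From here on elements of the monoid are handled as sets of maps.\<close>

lemma transducer_eq_iff:
  assumes "weakly_minimal n T" "weakly_minimal n U"
  shows "transducer_eq n T U \<longleftrightarrow> state_maps T = state_maps U"
proof
  assume "transducer_eq n T U"
  then obtain f where f: "bij_betw f (states T) (states U)" "\<forall>q\<in>states T. state_map T q = state_map U (f q)"
    unfolding transducer_eq_def omega_equiv_iff_state_map by blast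
  then have "state_map U ` states U = state_map U ` f ` states T" by (simp add: bij_betw_def)
  also have "\<dots> = state_map T ` states T" unfolding image_image using f(2) by simp
  finally show "state_maps T = state_maps U" by (simp add: state_maps_def)
next
  assume eq: "state_maps T = state_maps U"
  have i: "inj_on (state_map T) (states T)" "inj_on (state_map U) (states U)" using assms weakly_minimal_iff by auto
  let ?f = "inv_into (states U) (state_map U) \<circ> state_map T"
  have "bij_betw (state_map T) (states T) (state_maps T)" using i by (simp add: bij_betw_def state_maps_def)
  moreover have "bij_betw (inv_into (states U) (state_map U)) (state_maps T) (states U)"
    unfolding eq unfolding state_maps_def by (rule bij_betw_inv_into) (use i in \<open>simp add: bij_betw_def\<close>)
  ultimately have "bij_betw ?f (states T) (states U)" by (rule bij_betw_trans)
  moreover have "state_map T q = state_map U (?f q)" if "q \<in> states T" for q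
  proof -
    have "state_map T q \<in> state_map U ` states U" using that eq by (auto simp: state_maps_def)
    from f_inv_into_f[OF this] show ?thesis by simp
  qed
  ultimately show "transducer_eq n T U" unfolding transducer_eq_def omega_equiv_iff_state_map by blast
qed

lemma good_state_map:
  assumes T: "transducer n T" and inj: "inj_tr T" and q: "q \<in> states T"
  shows "good (state_map T q)"
proof -
  have "ucont (state_map T q)"
    unfolding ucont_def
  proof
    fix m
    obtain K where K: "\<And>w. w \<in> W \<Longrightarrow> K \<le> length w \<Longrightarrow> m \<le> length (outs T w q)"
      using outs_long[OF T, of m] q by blast
    show "\<exists>k. \<forall>x\<in>I. \<forall>y\<in>I. agree k x y \<longrightarrow> agree m (state_map T q x) (state_map T q y)"
    proof (intro exI[of _ K] ballI impI)
      fix x y assume xy: "x \<in> I" "y \<in> I" "agree K x y"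
      then have eq: "wtake K x = wtake K y"
        by (auto simp: agree_def intro!: nth_equalityI)
      have "omega_prefix (outs T (wtake K x) q) (state_map T q x)" "omega_prefix (outs T (wtake K y) q) (state_map T q y)"
        using omega_out_prefix[OF transducer_unbounded_out[OF T q], of _ K] xy by (simp_all add: state_map_def)
      then have p: "omega_prefix (outs T (wtake K x) q) (state_map T q x)" "omega_prefix (outs T (wtake K x) q) (state_map T q y)"
        by (simp_all only: eq)
      moreover have "m \<le> length (outs T (wtake K x) q)" using K xy by simp
      ultimately show "agree m (state_map T q x) (state_map T q y)" by (simp add: agree_def omega_prefix_iff)
    qed
  qed
  then show ?thesis
    using inj q omega_out_in_inf_words[OF T q] by (auto simp: good_def state_map_def inj_tr_def inj_on_def)
qed

text \<open>A state may still have incomplete response, so its map has to be normalized by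
  \<open>loc\<close> at the empty word before it is a local action.\<close>

lemma loc_state_map:
  assumes T: "transducer n T" and inj: "inj_tr T" and q: "q \<in> states T" and w: "w \<in> W"
  shows "loc (state_map T q) w = loc (state_map T (steps T w q)) []" "lcp (state_map T q) w = outs T w q @ lcp (state_map T (steps T w q)) []"
  using loc_factor[of w "state_map T q" "outs T w q" "state_map T (steps T w q)" "[]"] state_map_conc[OF T q _ w] w
    good_state_map[OF T inj steps_in_states[OF T w q]] by simp_all

definition minimal_inj :: "nat transducer \<Rightarrow> bool" where
  "minimal_inj T \<longleftrightarrow> T \<in> M_transducers n \<and> inj_tr T"

lemma outs_Z:
  assumes "is_Z n T x" "q \<in> states T" "w \<in> W"
  shows "steps T w q = q" "outs T w q = concat (replicate (length w) x)"
proof -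
  have s: "step T a q = q" "out T a q = x" if "a < n" for a
    using assms that unfolding is_Z_def by auto
  show "steps T w q = q" using assms(3) by (induction w) (auto simp: s)
  then show "outs T w q = concat (replicate (length w) x)" using assms(3) by (induction w) (auto simp: s)
qed

lemma M_weakly_minimal: "T \<in> M_transducers n \<Longrightarrow> weakly_minimal n T"
  by (auto simp: M_transducers_def minimal_def is_Z_def weakly_minimal_def)

text \<open>The output of \<open>Z_x\<close> does not depend on the input, so its map is constant,
  whereas \<open>I\<close> has at least two elements.\<close>

lemma not_Z:
  assumes T: "transducer n T" and inj: "inj_tr T" shows "\<not> is_Z n T x"
proof
  assume Z: "is_Z n T x"
  obtain q where q: "q \<in> states T" using T by (auto simp: transducer_def)
  have "omega_out T q y = omega_out T q z" if "y \<in> I" "z \<in> I" for y z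
  proof (rule omega_out_unique[OF transducer_unbounded_out[OF T q that(1)]])
    fix m
    have "outs T (wtake m y) q = outs T (wtake m z) q"
      using outs_Z(2)[OF Z q] that by simp
    then show "\<exists>k\<ge>m. omega_prefix (outs T (wtake k y) q) (omega_out T q z)"
      using omega_out_prefix[OF transducer_unbounded_out[OF T q that(2)], of m] by auto
  qed
  from this[OF zero_in_I one_in_I] have "(\<lambda>_::nat. 0::nat) = (\<lambda>_. Suc 0)"
    using inj q unfolding inj_tr_def inj_on_def by simp
  then show False by (metis nat.distinct(1))
qed

lemma minimal_injD:
  assumes "minimal_inj T"
  shows "transducer n T" "inj_tr T" "weakly_minimal n T" "strongly_connected n T"
    "q \<in> states T \<Longrightarrow> \<not> incomplete_response n T q" "\<exists>k. sync_level n T k" "core n T = T"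
  using assms not_Z[of T] M_weakly_minimal[of T]
  by (auto simp: minimal_inj_def M_transducers_def minimal_def strongly_synchronizing_def is_core_def)

lemma extent_zero_iff_spread:
  assumes "\<And>x. x \<in> I \<Longrightarrow> omega_out T q x \<in> I"
  shows "\<not> incomplete_response n T q \<longleftrightarrow> spread (state_map T q)"
proof
  assume ext: "\<not> incomplete_response n T q"
  show "spread (state_map T q)"
  proof (rule ccontr)
    assume "\<not> spread (state_map T q)"
    then obtain c where c: "\<And>x. x \<in> I \<Longrightarrow> state_map T q x 0 = c"
      using zero_in_I unfolding spread_def by blast
    have "[c] \<in> common_prefixes n T [] q"
      using c by (simp add: common_prefixes_def omega_prefix_iff state_map_def)
    then have "enat 1 \<le> extent n T q" unfolding extent_def by (rule SUP_upper2) simp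
    then show False using ext by (simp add: incomplete_response_def zero_enat_def one_enat_def)
  qed
next
  assume "spread (state_map T q)"
  then obtain x y where xy: "x \<in> I" "y \<in> I" "omega_out T q x 0 \<noteq> omega_out T q y 0"
    by (auto simp: spread_def state_map_def)
  have "length u = 0" if "u \<in> common_prefixes n T [] q" for u
  proof (rule ccontr)
    assume l: "length u \<noteq> 0"
    have "omega_prefix u (omega_out T q x)" "omega_prefix u (omega_out T q y)"
      using that xy unfolding common_prefixes_def by auto
    then have "omega_out T q x 0 = u ! 0" "omega_out T q y 0 = u ! 0"
      using l unfolding omega_prefix_iff by auto
    then show False using xy by simp
  qed
  then have "extent n T q \<le> 0"
    unfolding extent_def by (intro SUP_least) (auto simp: zero_enat_def)
  then have "extent n T q = 0" by simp
  then show "\<not> incomplete_response n T q" by (simp add: incomplete_response_def)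
qed

lemma minimal_inj_spread:
  assumes T: "minimal_inj T" and q: "q \<in> states T"
  shows "spread (state_map T q)"
  using extent_zero_iff_spread[OF omega_out_in_inf_words[OF minimal_injD(1)[OF T] q]]
    minimal_injD(5)[OF T q] by simp

lemma minimal_inj_good:
  assumes T: "minimal_inj T" and q: "q \<in> states T"
  shows "good (state_map T q)"
  by (rule good_state_map[OF minimal_injD(1,2)[OF T] q])

text \<open>Without incomplete response nothing is left to cancel: the transitions and outputs are
  literally the local actions and common prefixes.\<close>

lemma minimal_inj_loc:
  assumes T: "minimal_inj T" and q: "q \<in> states T" and w: "w \<in> W"
  shows "loc (state_map T q) w = state_map T (steps T w q)" "lcp (state_map T q) w = outs T w q"
  using loc_state_map[OF minimal_injD(1,2)[OF T] q w]
    loc_spread[OF minimal_inj_spread[OF T steps_in_states[OF minimal_injD(1)[OF T] w q]]]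
  by (simp_all add: state_map_def)

lemma minimal_inj_sync:
  assumes T: "minimal_inj T" and q: "q \<in> states T" and k: "sync_level n T k"
  shows "sync k (state_map T q)"
  unfolding sync_def
proof (intro ballI impI)
  fix u w assume u: "u \<in> W" and w: "w \<in> W" "k \<le> length w"
  have "steps T w (steps T u q) = steps T w q"
    using sync_level_mono[OF k w(2,1) minimal_injD(1)[OF T]] q steps_in_states[OF minimal_injD(1)[OF T] u q] by blast
  then show "loc (state_map T q) (u @ w) = loc (state_map T q) w"
    using minimal_inj_loc[OF T q] u w by simp
qed

lemma minimal_inj_synchronizing:
  assumes T: "minimal_inj T" and q: "q \<in> states T"
  shows "synchronizing (state_map T q)"
proof -
  obtain k where "sync_level n T k" using minimal_injD(6)[OF T] by blast
  then show ?thesis unfolding synchronizing_def using minimal_inj_good[OF T q] minimal_inj_sync[OF T q] by blast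
qed

text \<open>Every state of a core transducer is forced by a word of synchronizing length, hence is
  reached from \<open>q\<close>. So any single state map determines the whole transducer.\<close>

lemma minimal_inj_recurrent:
  assumes T: "minimal_inj T" and q: "q \<in> states T"
  shows "recurrent (state_map T q) = state_maps T"
proof
  show "recurrent (state_map T q) \<subseteq> state_maps T"
  proof
    fix g assume "g \<in> recurrent (state_map T q)"
    then obtain w where w: "w \<in> W" "loc (state_map T q) w = g" unfolding recurrent_def by blast
    then show "g \<in> state_maps T"
      using minimal_inj_loc[OF T q w(1)] steps_in_states[OF minimal_injD(1)[OF T] w(1) q] by (auto simp: state_maps_def)
  qed
  show "state_maps T \<subseteq> recurrent (state_map T q)"
  proof
    fix g assume "g \<in> state_maps T"
    then obtain p where p: "p \<in> states T" "g = state_map T p" by (auto simp: state_maps_def)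
    then have "p \<in> states (core n T)" using minimal_injD(7)[OF T] by simp
    then obtain k w where kw: "sync_level n T k" "w \<in> W" "length w = k" "\<forall>q\<in>states T. steps T w q = p"
      by (auto simp: core_def)
    then have "g = loc (state_map T q) w" using minimal_inj_loc[OF T q] p q by simp
    then show "g \<in> recurrent (state_map T q)" using sync_recurrent(2)[OF minimal_inj_sync[OF T q kw(1)]] kw by blast
  qed
qed

text \<open>Describes a monoid element by its state maps, without choosing a representative.\<close>

definition transducers_of :: "(nat word \<Rightarrow> nat word) set \<Rightarrow> nat transducer set" where
  "transducers_of S = {V \<in> M_transducers n. state_maps V = S}"

lemma tr_class_eq: "weakly_minimal n T \<Longrightarrow> tr_class n T = transducers_of (state_maps T)"
  unfolding tr_class_def transducers_of_def using transducer_eq_iff M_weakly_minimal by blast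

end

subsection \<open>Realization and products\<close>

lemma steps_states_update [simp]: "steps (T\<lparr>states := S\<rparr>) w q = steps T w q"
  by (induction w arbitrary: q) auto

lemma outs_states_update [simp]: "outs (T\<lparr>states := S\<rparr>) w q = outs T w q"
  by (induction w arbitrary: q) auto

lemma omega_out_states_update [simp]: "omega_out (T\<lparr>states := S\<rparr>) q x = omega_out T q x"
  by (simp add: omega_out_def)

lemma states_core_iff:
  "q \<in> states (core n T) \<longleftrightarrow>
     (\<exists>w\<in>lists {..<n}. sync_level n T (length w) \<and> (\<forall>p\<in>states T. steps T w p = q))"
  by (auto simp: core_def)

lemma core_eq_iff: "core n T = T \<longleftrightarrow> states (core n T) = states T"
proof
  assume "states (core n T) = states T"
  then show "core n T = T"
    unfolding core_def by (cases T) simp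
qed simp

lemma states_core_step:
  assumes T: "transducer n T" and q: "q \<in> states (core n T)" and a: "a < n"
  shows "step T a q \<in> states (core n T)"
proof -
  obtain w where w: "w \<in> lists {..<n}" "sync_level n T (length w)" "\<forall>p\<in>states T. steps T w p = q"
    using q unfolding states_core_iff by blast
  have "sync_level n T (length (w @ [a]))"
    unfolding sync_level_def
  proof (intro ballI impI)
    fix u p p' assume "u \<in> lists {..<n}" "length u = length (w @ [a])" "p \<in> states T" "p' \<in> states T"
    then show "steps T u p = steps T u p'"
      using sync_level_mono[OF w(2) _ _ T, of u p p'] by simp
  qed
  then show ?thesis unfolding states_core_iff using w a by (intro bexI[of _ "w @ [a]"]) simp_all
qed

lemma states_core_subset:
  assumes T: "transducer n T" shows "states (core n T) \<subseteq> states T"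
proof
  fix q assume "q \<in> states (core n T)"
  then obtain w where w: "w \<in> lists {..<n}" "\<forall>p\<in>states T. steps T w p = q"
    unfolding states_core_iff by blast
  obtain p where p: "p \<in> states T" using T by (auto simp: transducer_def)
  show "q \<in> states T" using w(2) p steps_in_states[OF T w(1) p] by simp
qed

text \<open>A circuit of the product projects to a circuit of \<open>T\<close>, and the nonempty
  output of that one labels a circuit of \<open>U\<close>.\<close>

lemma transducer_tr_prod:
  assumes T: "transducer n T" and U: "transducer n U"
  shows "transducer n (T \<star> U)"
  unfolding transducer_def
proof (intro conjI ballI allI impI)
  show "finite (states (T \<star> U))" "states (T \<star> U) \<noteq> {}"
    using T U by (auto simp: transducer_def tr_prod_def)
next
  fix x c assume x: "x < n" and c: "c \<in> states (T \<star> U)"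
  then obtain p q where pq: "c = (p, q)" "p \<in> states T" "q \<in> states U" by (auto simp: tr_prod_def)
  have o: "out T x p \<in> lists {..<n}" "step T x p \<in> states T" using T x pq unfolding transducer_def by blast+
  show "step (T \<star> U) x c \<in> states (T \<star> U)"
    using o steps_in_states[OF U o(1) pq(3)] pq by (simp add: tr_prod_def)
  show "out (T \<star> U) x c \<in> lists {..<n}"
    using outs_in_lists[OF U o(1) pq(3)] pq by (simp add: tr_prod_def)
next
  fix w c assume w: "w \<in> lists {..<n}" and c: "c \<in> states (T \<star> U)" and l: "w \<noteq> [] \<and> steps (T \<star> U) w c = c"
  then obtain p q where pq: "c = (p, q)" "p \<in> states T" "q \<in> states U" by (auto simp: tr_prod_def)
  then have s: "steps T w p = p" "steps U (outs T w p) q = q" using l by (auto simp: steps_tr_prod)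
  have "outs T w p \<noteq> []" using T w pq l s unfolding transducer_def by blast
  moreover have "outs T w p \<in> lists {..<n}" by (rule outs_in_lists[OF T w pq(2)])
  ultimately have "outs U (outs T w p) q \<noteq> []" using U pq s unfolding transducer_def by blast
  then show "outs (T \<star> U) w c \<noteq> []" by (simp add: pq outs_tr_prod)
qed

text \<open>The first \<open>k\<close> letters synchronize \<open>T\<close>; on the next
  \<open>K\<close> letters \<open>T\<close> writes at least \<open>l\<close> letters, which
  synchronize \<open>U\<close>.\<close>

lemma sync_level_tr_prod:
  assumes T: "transducer n T" and U: "transducer n U" and k: "sync_level n T k" and l: "sync_level n U l"
  shows "\<exists>m. sync_level n (T \<star> U) m"
proof -
  obtain K where K: "\<And>w q. q \<in> states T \<Longrightarrow> w \<in> lists {..<n} \<Longrightarrow> K \<le> length w \<Longrightarrow> l \<le> length (outs T w q)"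
    using outs_long[OF T, of l] by blast
  have "sync_level n (T \<star> U) (k + K)"
    unfolding sync_level_def
  proof (intro ballI impI)
    fix w c d assume w: "w \<in> lists {..<n}" "length w = k + K"
      and cd: "c \<in> states (T \<star> U)" "d \<in> states (T \<star> U)"
    obtain p q p' q' where e: "c = (p, q)" "d = (p', q')" "p \<in> states T" "q \<in> states U" "p' \<in> states T" "q' \<in> states U"
      using cd by (auto simp: tr_prod_def)
    let ?u = "take k w" and ?v = "drop k w"
    have u: "?u \<in> lists {..<n}" "?v \<in> lists {..<n}" "length ?u = k" "length ?v = K" using w by auto
    have eq: "steps T ?u p = steps T ?u p'" using k u e unfolding sync_level_def by blast
    let ?r = "steps T ?u p"
    have r: "?r \<in> states T" using steps_in_states[OF T u(1) e(3)] .
    have "steps U (outs T ?v ?r) (steps U (outs T ?u p) q) = steps U (outs T ?v ?r) (steps U (outs T ?u p') q')"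
      using K[OF r u(2)] u(4) outs_in_lists[OF T] steps_in_states[OF U] r u e
      by (intro sync_level_mono[OF l _ _ U]) simp_all
    then have "steps (T \<star> U) (?u @ ?v) c = steps (T \<star> U) (?u @ ?v) d"
      unfolding e steps_tr_prod steps_append outs_append using eq by simp
    then show "steps (T \<star> U) w c = steps (T \<star> U) w d" by simp
  qed
  then show ?thesis by blast
qed

context alphabet
begin

section \<open>The canonical transducer of a synchronizing map\<close>

lemma recurrent_loc_closed:
  assumes f: "good f" and g: "g \<in> recurrent f" and w: "w \<in> W" shows "loc g w \<in> recurrent f"
  unfolding recurrent_def
proof (intro CollectI allI)
  fix K
  obtain u where u: "u \<in> W" "K \<le> length u" "loc f u = g" using g unfolding recurrent_def by blast
  then have "loc f (u @ w) = loc g w" using loc_append(2)[OF f u(1) w] by simp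
  then show "\<exists>v\<in>W. K \<le> length v \<and> loc f v = loc g w" using u w by (intro bexI[of _ "u @ w"]) simp_all
qed

text \<open>The local actions are renamed by natural numbers because elements of the monoid consist
  of transducers on \<open>nat\<close>.\<close>

definition realize :: "(nat word \<Rightarrow> nat word) \<Rightarrow> nat transducer" where
  "realize f = (let e = to_nat_on (recurrent f); d = inv_into (recurrent f) e in
     \<lparr>states = e ` recurrent f, step = (\<lambda>a s. e (loc (d s) [a])), out = (\<lambda>a s. lcp (d s) [a])\<rparr>)"

text \<open>By the chain rule reading \<open>w\<close> in the state named after \<open>g\<close>
  leads to \<open>loc g w\<close> and writes \<open>lcp g w\<close>. Minimality, synchronization and
  being core are then properties of \<open>f\<close>.\<close>

lemma realize:
  assumes f: "synchronizing f"
  shows "realize f \<in> M_transducers n" "state_maps (realize f) = recurrent f"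
proof -
  obtain K where K: "sync K f" and gf: "good f" using f unfolding synchronizing_def by blast
  define e where "e = to_nat_on (recurrent f)"
  define d where "d = inv_into (recurrent f) e"
  define V where "V = realize f"
  have inj: "inj_on e (recurrent f)"
    unfolding e_def by (rule inj_on_to_nat_on) (use finite_recurrent[OF f] countable_finite in blast)
  have d [simp]: "d (e g) = g" if "g \<in> recurrent f" for g unfolding d_def using inj that by (rule inv_into_f_f)
  have V: "V = \<lparr>states = e ` recurrent f, step = (\<lambda>a s. e (loc (d s) [a])), out = (\<lambda>a s. lcp (d s) [a])\<rparr>"
    unfolding V_def realize_def Let_def e_def d_def ..
  have sV: "states V = e ` recurrent f" by (simp add: V)
  have recurrent: "good g" "spread g" "restrict g I = g" if "g \<in> recurrent f" for g using recurrent_good[OF gf that] by auto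
  have steps: "steps V w (e g) = e (loc g w) \<and> outs V w (e g) = lcp g w" if "g \<in> recurrent f" "w \<in> W" for g w
    using that
  proof (induction w arbitrary: g)
    case Nil
    then show ?case using loc_spread[OF recurrent(2)] recurrent(3) by simp
  next
    case (Cons a w)
    then have a: "[a] \<in> W" "w \<in> W" by auto
    have c: "loc g [a] \<in> recurrent f" by (rule recurrent_loc_closed[OF gf Cons.prems(1) a(1)])
    have "loc g ([a] @ w) = loc (loc g [a]) w" "lcp g ([a] @ w) = lcp g [a] @ lcp (loc g [a]) w"
      using loc_append[OF recurrent(1) a] Cons.prems by simp_all
    then show ?case using Cons.IH[OF c a(2)] Cons.prems by (simp add: V)
  qed
  have tr: "transducer n V"
    unfolding transducer_def
  proof (intro conjI ballI allI impI)
    show "finite (states V)" "states V \<noteq> {}" using sV finite_recurrent[OF f] recurrent_nonempty[OF f] by auto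
  next
    fix a s assume a: "a < n" and "s \<in> states V"
    then obtain g where g: "g \<in> recurrent f" "s = e g" unfolding sV by blast
    have "[a] \<in> W" using a by simp
    then show "step V a s \<in> states V" "out V a s \<in> W"
      using g recurrent_loc_closed[OF gf g(1), of "[a]"] lcp_in_W[OF recurrent(1)[OF g(1)], of "[a]"] by (simp_all add: V)
  next
    fix w s assume w: "w \<in> W" and s: "s \<in> states V" and l: "w \<noteq> [] \<and> steps V w s = s"
    obtain g where g: "g \<in> recurrent f" "s = e g" using s unfolding sV by blast
    have "e (loc g w) = e g" using l steps[OF g(1) w] g by simp
    then have lg: "loc g w = g" using inj recurrent_loc_closed[OF gf g(1) w] g(1) by (simp add: inj_on_def)
    show "outs V w s \<noteq> []"
    proof
      assume "outs V w s = []"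
      then have "lcp g w = []" using steps[OF g(1) w] g by simp
      then have "g (w \<frown> x) = g x" if "x \<in> I" for x
        using loc_decomp[OF recurrent(1)[OF g(1)] w that] lg by simp
      \<comment> \<open>A circuit without output would give \<open>g\<close> the same value at
        \<open>x\<close> and at \<open>w\<close> followed by \<open>x\<close>. By injectivity these
        words coincide for all \<open>x\<close>, but \<open>x\<close> may begin with 0 or with
        1.\<close>
      then have wx: "w \<frown> x = x" if "x \<in> I" for x
        using goodD(2)[OF recurrent(1)[OF g(1)], of "w \<frown> x" x] that w by simp
      have "(w \<frown> (\<lambda>_. 0)) 0 = w ! 0" "(w \<frown> (\<lambda>_. Suc 0)) 0 = w ! 0" using l by simp_all
      then show False using wx[OF zero_in_I] wx[OF one_in_I] by simp
    qed
  qed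
  have om: "omega_out V (e g) x = g x" if "g \<in> recurrent f" "x \<in> I" for g x
  proof -
    have "omega_out V (e g) x = d (e g) x"
    proof (rule omega_out_eqI[of "states V" n])
      show "step V a q \<in> states V" if "q \<in> states V" "a < n" for q a
        using tr that unfolding transducer_def by blast
      show "d q ([a] \<frown> y) = out V a q \<frown> d (step V a q) y" if q: "q \<in> states V" and a: "a < n" and y: "y \<in> I" for q a y
      proof -
        obtain g where g: "g \<in> recurrent f" "q = e g" using q unfolding sV by blast
        have aW: "[a] \<in> W" using a by simp
        show ?thesis using loc_decomp[OF recurrent(1)[OF g(1)] aW y] g recurrent_loc_closed[OF gf g(1) aW] by (simp add: V)
      qed
      show "e g \<in> states V" using that sV by simp
      show "x \<in> I" by fact
      show "unbounded_out V (e g) x" by (rule transducer_unbounded_out[OF tr]) (use that sV in simp_all)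
    qed
    then show ?thesis using that by simp
  qed
  have hV: "state_map V (e g) = g" if "g \<in> recurrent f" for g
    using om[OF that] recurrent(3)[OF that] unfolding state_map_def by (metis (no_types, lifting) restrict_ext)
  show state_maps: "state_maps (realize f) = recurrent f"
    unfolding state_maps_def V_def[symmetric] sV image_image using hV by simp
  have wm: "weakly_minimal n V"
    unfolding weakly_minimal_iff sV by (rule inj_onI) (use hV in auto)
  \<comment> \<open>Every state is a local action \<open>loc f u\<close>, so synchronization of
    \<open>f\<close> forces the state after \<open>K\<close> letters. Strong connectivity, the
    synchronizing level and the core property all follow from this.\<close>
  have st: "steps V w (e g) = e (loc f w)" if gHs: "g \<in> recurrent f" and "w \<in> W" "K \<le> length w" for g w
  proof -
    obtain u where u: "u \<in> W" "loc f u = g" using gHs sync_recurrent(2)[OF K] by auto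
    have "loc g w = loc f (u @ w)" using loc_append(2)[OF gf u(1) that(2)] u by simp
    also have "\<dots> = loc f w" using syncD[OF K u(1) that(2,3)] .
    finally show ?thesis using steps[OF that(1,2)] by simp
  qed
  have sc: "strongly_connected n V"
    unfolding strongly_connected_def
  proof (intro ballI)
    fix p q assume "p \<in> states V" "q \<in> states V"
    then obtain g g' where g: "g \<in> recurrent f" "p = e g" "g' \<in> recurrent f" "q = e g'" unfolding sV by blast
    obtain w where w: "w \<in> W" "length w = K" "g' = loc f w" using g(3) sync_recurrent(2)[OF K] by blast
    then have "steps V w p = q" using st[OF g(1) w(1)] g by simp
    then show "\<exists>w\<in>W. steps V w p = q" using w by blast
  qed
  have ir: "\<not> incomplete_response n V q" if q: "q \<in> states V" for q
  proof -
    obtain g where g: "g \<in> recurrent f" "q = e g" using q unfolding sV by blast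
    then have "spread (state_map V q)" using hV recurrent(2) by simp
    then show ?thesis using extent_zero_iff_spread[OF omega_out_in_inf_words[OF tr q]] by simp
  qed
  have sl: "sync_level n V K"
    unfolding sync_level_def sV using st by auto
  have "states V \<subseteq> states (core n V)"
  proof
    fix q assume "q \<in> states V"
    then obtain g where g: "g \<in> recurrent f" "q = e g" unfolding sV by blast
    obtain w where w: "w \<in> W" "length w = K" "g = loc f w" using g(1) sync_recurrent(2)[OF K] by blast
    have "\<forall>p\<in>states V. steps V w p = q" unfolding sV using st[OF _ w(1)] w g by simp
    then show "q \<in> states (core n V)" unfolding states_core_iff using w sl by blast
  qed
  then have "is_core n V" unfolding is_core_def core_eq_iff using states_core_subset[OF tr] by blast
  then show "realize f \<in> M_transducers n"
    using tr wm sc ir sl unfolding V_def[symmetric] M_transducers_def minimal_def strongly_synchronizing_def by blast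
qed

section \<open>Reduction of the core, and products as compositions\<close>

lemma transducer_sync:
  assumes T: "transducer n T" and inj: "inj_tr T" and q: "q \<in> states T" and k: "sync_level n T k"
  shows "sync k (state_map T q)"
  unfolding sync_def
proof (intro ballI impI)
  fix u w assume u: "u \<in> W" and w: "w \<in> W" "k \<le> length w"
  have "steps T w (steps T u q) = steps T w q"
    using sync_level_mono[OF k w(2,1) T steps_in_states[OF T u q] q] .
  then show "loc (state_map T q) (u @ w) = loc (state_map T q) w"
    using loc_state_map(1)[OF T inj q, of "u @ w"] loc_state_map(1)[OF T inj q w(1)] u w by simp
qed

lemma common_prefixes_core:
  assumes X: "transducer n X" and inj: "inj_tr X" and c: "c \<in> states X" and w: "w \<in> W"
  shows "common_prefixes n (core n X) w c = {u. Sublist.prefix u (lcp (state_map X c) w)}"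
proof -
  note g = good_state_map[OF X inj c]
  have cp: "u \<in> common_prefixes n (core n X) w c \<longleftrightarrow> (\<forall>x\<in>I. omega_prefix u (state_map X c (w \<frown> x)))" for u
    using w by (simp add: common_prefixes_def core_def state_map_def)
  show ?thesis
  proof (intro equalityI subsetI)
    fix u assume "u \<in> common_prefixes n (core n X) w c"
    then have u: "\<And>x. x \<in> I \<Longrightarrow> omega_prefix u (state_map X c (w \<frown> x))" unfolding cp by blast
    have "length u \<le> cplen (state_map X c) w"
    proof (rule cplen_greatest[OF g w])
      fix x y assume "x \<in> I" "y \<in> I"
      then show "agree (length u) (state_map X c (w \<frown> x)) (state_map X c (w \<frown> y))"
        using u unfolding omega_prefix_iff agree_def by simp
    qed
    moreover have "omega_prefix (lcp (state_map X c) w) (state_map X c (w \<frown> (\<lambda>_. 0)))"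
      using loc_decomp[OF g w zero_in_I] by simp
    ultimately show "u \<in> {u. Sublist.prefix u (lcp (state_map X c) w)}"
      using omega_prefix_comparable[OF u[OF zero_in_I]] by simp
  next
    fix u assume "u \<in> {u. Sublist.prefix u (lcp (state_map X c) w)}"
    then have u: "Sublist.prefix u (lcp (state_map X c) w)" by simp
    show "u \<in> common_prefixes n (core n X) w c"
      unfolding cp using loc_decomp[OF g w] omega_prefix_mono[OF u] by simp
  qed
qed

lemma Lambda_core:
  assumes "transducer n X" "inj_tr X" "c \<in> states X" "w \<in> W"
  shows "Lambda n (core n X) w c = lcp (state_map X c) w"
  unfolding Lambda_def common_prefixes_core[OF assms]
  by (rule the_equality) (auto intro: prefix_order.antisym)

text \<open>Injectivity bounds the common prefixes, so \<open>reduction\<close> never takes its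
  \<open>Z_tr\<close> branch here.\<close>

lemma extent_core:
  assumes "transducer n X" "inj_tr X" "c \<in> states X"
  shows "extent n (core n X) c \<noteq> \<infinity>"
proof -
  have "extent n (core n X) c \<le> enat (cplen (state_map X c) [])"
    unfolding extent_def common_prefixes_core[OF assms lists.Nil]
    using prefix_length_le by (intro SUP_least) fastforce
  then show ?thesis using enat_ile by fastforce
qed

text \<open>Deleting common prefixes replaces each state map by its local action at the empty word,
  called \<open>G\<close> below; identification removes repetitions. Core states are those forced by
  long words, so exactly the recurrent actions remain.\<close>

lemma reduction_core:
  assumes X: "transducer n X" and inj: "inj_tr X" and k: "sync_level n X k" and c: "c \<in> states X"
  shows "weakly_minimal n (reduction n (core n X))" "state_maps (reduction n (core n X)) = recurrent (state_map X c)"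
proof -
  let ?C = "core n X"
  let ?S = "states ?C"
  define R where "R = remove_incomplete_response n ?C"
  define G where "G c = loc (state_map X c) []" for c
  have sub: "?S \<subseteq> states X" by (rule states_core_subset[OF X])
  have stepR: "step R = step X" and sR: "states R = ?S"
    by (simp_all add: R_def remove_incomplete_response_def core_def)
  have goodG: "good (G c)" if "c \<in> states X" for c
    unfolding G_def by (rule good_loc[OF good_state_map[OF X inj that]]) simp
  have lcpG: "lcp (state_map X c) w = lcp (state_map X c) [] @ lcp (G c) w \<and> loc (G c) w = G (steps X w c)"
    if "c \<in> states X" "w \<in> W" for c w
    using loc_append[OF good_state_map[OF X inj that(1)], of "[]" w] loc_state_map(1)[OF X inj that] that by (simp add: G_def)
  \<comment> \<open>The prefix \<open>Lambda\<close> at \<open>[a]\<close> is \<open>Lambda\<close>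
    at the empty word followed by \<open>lcp (G c) [a]\<close>; \<open>drop\<close> leaves the
    second factor.\<close>
  have outR: "out R a c = lcp (G c) [a]" if "c \<in> states X" "a < n" for a c
    using Lambda_core[OF X inj that(1), of "[a]"] Lambda_core[OF X inj that(1), of "[]"]
      lcpG[OF that(1), of "[a]"] that(2)
    by (simp add: R_def remove_incomplete_response_def)
  have stX: "step X a c \<in> states X" if "c \<in> states X" "a < n" for a c
    using X that unfolding transducer_def by blast
  have outsR: "outs R w c = lcp (G c) w" if "c \<in> states X" "w \<in> W" for c w
    using that
  proof (induction w arbitrary: c)
    case Nil
    have "spread (G c)" unfolding G_def by (rule spread_loc[OF good_state_map[OF X inj Nil(1)]]) simp
    then show ?case using loc_spread(1) by simp
  next
    case (Cons a w)
    then have a: "a < n" "[a] \<in> W" "w \<in> W" by auto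
    have "lcp (G c) ([a] @ w) = lcp (G c) [a] @ lcp (loc (G c) [a]) w"
      by (rule loc_append(1)[OF goodG[OF Cons.prems(1)] a(2,3)])
    also have "loc (G c) [a] = G (step X a c)" using lcpG[OF Cons.prems(1) a(2)] by simp
    finally show ?case
      using Cons.IH[OF stX[OF Cons.prems(1) a(1)] a(3)] outR[OF Cons.prems(1) a(1)] by (simp add: stepR)
  qed
  have Gdec: "G c ([a] \<frown> y) = out R a c \<frown> G (step X a c) y" if "c \<in> states X" "a < n" "y \<in> I" for c a y
    using loc_decomp[OF goodG[OF that(1)], of "[a]" y] lcpG[OF that(1), of "[a]"] outR[OF that(1,2)] that by simp
  have unbR: "unbounded_out R c x" if cx: "c \<in> states X" "x \<in> I" for c x
    unfolding unbounded_out_def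
  proof
    fix m
    obtain K where K: "\<And>w. w \<in> W \<Longrightarrow> K \<le> length w \<Longrightarrow> m \<le> length (lcp (G c) w)"
      using good_lcp_long[OF goodG[OF cx(1)]] by blast
    have "m \<le> length (lcp (G c) (wtake K x))" by (rule K) (use cx in simp_all)
    then have "m \<le> length (outs R (wtake K x) c)" using outsR[OF cx(1), of "wtake K x"] cx by simp
    then show "\<exists>k. m \<le> length (outs R (wtake k x) c)" by blast
  qed
  have omR: "omega_out R c x = G c x" if "c \<in> states X" "x \<in> I" for c x
    by (rule omega_out_eqI[of "states X" n]) (use stX Gdec stepR that unbR in simp_all)
  have hR: "state_map R c = G c" if "c \<in> states X" for c
  proof -
    have "state_map R c = restrict (G c) I" unfolding state_map_def by (rule restrict_ext) (rule omR[OF that])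
    then show ?thesis by (simp add: G_def)
  qed
  have red: "reduction n ?C = identify n R"
    using extent_core[OF X inj] sub unfolding reduction_def R_def by (meson subsetD)
  define D where "D = identify n R"
  let ?E = "omega_rel n R"
  have E: "(p, q) \<in> ?E \<longleftrightarrow> p \<in> ?S \<and> q \<in> ?S \<and> G p = G q" for p q
    unfolding omega_rel_def omega_equiv_iff_state_map sR using hR[OF subsetD[OF sub]] by auto
  have eqv: "equiv ?S ?E"
    by (intro equivI refl_onI symI transI) (auto simp: E)
  have sD: "states D = ?S // ?E" by (simp add: D_def identify_def sR)
  \<comment> \<open>All members of a class have the same \<open>G\<close>, so this choice does not
    influence the maps of the quotient.\<close>
  define rep where "rep P = (SOME p. p \<in> P)" for P :: "'a set"
  have rep: "rep P \<in> P" if "P \<in> ?S // ?E" for P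
    unfolding rep_def using in_quotient_imp_non_empty[OF eqv that] by (simp add: some_in_eq)
  have repS: "rep P \<in> ?S" if "P \<in> ?S // ?E" for P
    using rep[OF that] in_quotient_imp_subset[OF eqv that] by blast
  have Grep: "G (rep (?E `` {p})) = G p" if "p \<in> ?S" for p
  proof -
    have "?E `` {p} \<in> ?S // ?E" using that by (rule quotientI)
    from rep[OF this] show ?thesis by (simp add: E)
  qed
  have stepD: "step D a P = ?E `` {step X a (rep P)}" "out D a P = out R a (rep P)" for a P
    by (simp_all add: D_def identify_def rep_def stepR)
  have stepDin: "step D a P \<in> states D" if "P \<in> states D" "a < n" for a P
    using states_core_step[OF X repS that(2)] that unfolding sD stepD by (simp add: quotientI)
  have outsD: "outs D w P = outs R w (rep P)" if "P \<in> states D" "w \<in> W" for w P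
    using that
  proof (induction w arbitrary: P)
    case (Cons a w)
    then have a: "a < n" "w \<in> W" by auto
    have r: "rep P \<in> ?S" using repS Cons.prems(1) sD by blast
    then have s: "step X a (rep P) \<in> ?S" by (rule states_core_step[OF X _ a(1)])
    have "outs D w (step D a P) = outs R w (rep (step D a P))"
      by (rule Cons.IH[OF stepDin[OF Cons.prems(1) a(1)] a(2)])
    also have "\<dots> = lcp (G (rep (step D a P))) w"
      using outsR[OF _ a(2)] repS[of "step D a P"] stepDin[OF Cons.prems(1) a(1)] sub unfolding sD by blast
    also have "\<dots> = lcp (G (step X a (rep P))) w" using Grep[OF s] by (simp add: stepD)
    also have "\<dots> = outs R w (step X a (rep P))" using outsR[OF _ a(2)] s sub by auto
    finally show ?case by (simp add: stepD stepR)
  qed simp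
  have omD: "omega_out D P x = G (rep P) x" if "P \<in> states D" "x \<in> I" for P x
  proof (rule omega_out_eqI[of "states D" n])
    show "G (rep P) ([a] \<frown> y) = out D a P \<frown> G (rep (step D a P)) y" if P: "P \<in> states D" and a: "a < n" and y: "y \<in> I" for P a y
    proof -
      have r: "rep P \<in> ?S" using repS P sD by blast
      then have s: "step X a (rep P) \<in> ?S" by (rule states_core_step[OF X _ a])
      show ?thesis using Gdec[OF subsetD[OF sub r] a y] Grep[OF s] by (simp add: stepD)
    qed
    have r: "rep P \<in> states X" using repS that(1) sD sub by blast
    note ub = unbR[OF r that(2)]
    show "unbounded_out D P x"
      unfolding unbounded_out_def
    proof
      fix m
      obtain k where "m \<le> length (outs R (wtake k x) (rep P))" using ub unfolding unbounded_out_def by blast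
      then have "m \<le> length (outs D (wtake k x) P)" using outsD[OF that(1)] that(2) by simp
      then show "\<exists>k. m \<le> length (outs D (wtake k x) P)" by blast
    qed
  qed (use stepDin that in simp_all)
  have hD: "state_map D P = G (rep P)" if "P \<in> states D" for P
  proof -
    have "state_map D P = restrict (G (rep P)) I" unfolding state_map_def by (rule restrict_ext) (rule omD[OF that])
    then show ?thesis by (simp add: G_def)
  qed
  have "inj_on (state_map D) (states D)"
  proof (rule inj_onI)
    fix P Q assume PQ: "P \<in> states D" "Q \<in> states D" "state_map D P = state_map D Q"
    then have "(rep P, rep Q) \<in> ?E" unfolding E using hD repS sD by auto
    then show "P = Q" using quotient_eqI[OF eqv _ _ rep rep] PQ(1,2) unfolding sD by blast
  qed
  then show "weakly_minimal n (reduction n ?C)" unfolding weakly_minimal_iff red D_def .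
  have "state_map D ` states D = G ` ?S"
  proof (intro equalityI subsetI)
    fix g assume "g \<in> state_map D ` states D"
    then show "g \<in> G ` ?S" using hD repS sD by auto
  next
    fix g assume "g \<in> G ` ?S"
    then obtain p where p: "p \<in> ?S" "g = G p" by blast
    then have P: "?E `` {p} \<in> states D" unfolding sD by (simp add: quotientI)
    then show "g \<in> state_map D ` states D" using hD[OF P] Grep[OF p(1)] p(2) by (metis imageI)
  qed
  also have "\<dots> = recurrent (state_map X c)"
  proof (intro equalityI subsetI)
    fix g assume "g \<in> G ` ?S"
    then obtain p where p: "p \<in> ?S" "g = G p" by blast
    obtain w where w: "w \<in> W" "sync_level n X (length w)" "\<forall>q\<in>states X. steps X w q = p"
      using p(1) unfolding states_core_iff by blast
    then have "g = loc (state_map X c) w" using loc_state_map(1)[OF X inj c w(1)] c p by (simp add: G_def)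
    then show "g \<in> recurrent (state_map X c)" using sync_recurrent(2)[OF transducer_sync[OF X inj c w(2)]] w by blast
  next
    fix g assume "g \<in> recurrent (state_map X c)"
    then obtain w where w: "w \<in> W" "length w = k" "g = loc (state_map X c) w"
      using sync_recurrent(2)[OF transducer_sync[OF X inj c k]] by blast
    have "steps X w q = steps X w c" if "q \<in> states X" for q
      using k w that c unfolding sync_level_def by blast
    then have "steps X w c \<in> ?S" unfolding states_core_iff using w k by blast
    then show "g \<in> G ` ?S" using loc_state_map(1)[OF X inj c w(1)] w(3) by (auto simp: G_def)
  qed
  finally show "state_maps (reduction n ?C) = recurrent (state_map X c)" unfolding state_maps_def red D_def .
qed

lemma inj_tr_iff: "inj_tr T \<longleftrightarrow> (\<forall>f\<in>state_maps T. inj_on f I)"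
  by (auto simp: inj_tr_def state_maps_def state_map_def inj_on_def)

lemma state_map_tr_prod:
  assumes T: "transducer n T" and U: "transducer n U" and p: "p \<in> states T" and q: "q \<in> states U" and x: "x \<in> I"
  shows "state_map (T \<star> U) (p, q) x = state_map U q (state_map T p x)"
proof -
  have X: "transducer n (T \<star> U)" by (rule transducer_tr_prod[OF T U])
  let ?g = "\<lambda>(p, q) x. omega_out U q (omega_out T p x)"
  have "omega_out (T \<star> U) (p, q) x = ?g (p, q) x"
  proof (rule omega_out_eqI[of "states (T \<star> U)" n])
    show "step (T \<star> U) a c \<in> states (T \<star> U)" if "c \<in> states (T \<star> U)" "a < n" for a c
      using X that unfolding transducer_def by blast
    show "?g c ([a] \<frown> y) = out (T \<star> U) a c \<frown> ?g (step (T \<star> U) a c) y"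
      if c: "c \<in> states (T \<star> U)" and a: "a < n" and y: "y \<in> I" for c a y
    proof -
      obtain p q where pq: "c = (p, q)" "p \<in> states T" "q \<in> states U" using c by (auto simp: tr_prod_def)
      have o: "out T a p \<in> W" "step T a p \<in> states T" using T a pq unfolding transducer_def by blast+
      have "omega_out T p ([a] \<frown> y) = out T a p \<frown> omega_out T (step T a p) y"
        using omega_out_conc[OF T pq(2) y, of "[a]"] a by simp
      moreover have "omega_out U q (out T a p \<frown> omega_out T (step T a p) y)
          = outs U (out T a p) q \<frown> omega_out U (steps U (out T a p) q) (omega_out T (step T a p) y)"
        by (rule omega_out_conc[OF U pq(3) omega_out_in_inf_words[OF T o(2) y] o(1)])
      ultimately show ?thesis by (simp add: pq(1) tr_prod_def)
    qed
    show "(p, q) \<in> states (T \<star> U)" using p q by (simp add: tr_prod_def)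
    then show "unbounded_out (T \<star> U) (p, q) x" by (rule transducer_unbounded_out[OF X _ x])
  qed (rule x)
  then show ?thesis using x omega_out_in_inf_words[OF T p x] by (simp add: state_map_def)
qed

lemma tr_prod_semantics:
  assumes T: "minimal_inj T" and U: "minimal_inj U" and f: "f \<in> state_maps T" and g: "g \<in> state_maps U"
  shows "tr_class n (reduction n (core n (T \<star> U))) = transducers_of (recurrent (\<lambda>x. g (f x)))" "synchronizing (\<lambda>x. g (f x))"
proof -
  obtain p q where pq: "p \<in> states T" "f = state_map T p" "q \<in> states U" "g = state_map U q" using f g unfolding state_maps_def by blast
  let ?X = "T \<star> U"
  have X: "transducer n ?X" by (rule transducer_tr_prod[OF minimal_injD(1)[OF T] minimal_injD(1)[OF U]])
  have hX: "state_map ?X (p, q) x = state_map U q (state_map T p x)" if "p \<in> states T" "q \<in> states U" "x \<in> I" for p q x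
    by (rule state_map_tr_prod[OF minimal_injD(1)[OF T] minimal_injD(1)[OF U] that])
  have "inj_on (state_map ?X c) I" if cX: "c \<in> states ?X" for c
  proof -
    obtain p q where c: "c = (p, q)" "p \<in> states T" "q \<in> states U" using cX by (auto simp: tr_prod_def)
    have "good (\<lambda>x. state_map U q (state_map T p x))"
      using good_comp[OF minimal_inj_good[OF T c(2)] minimal_inj_good[OF U c(3)]] .
    then show ?thesis using hX[OF c(2,3)] unfolding c(1) good_def inj_on_def by simp
  qed
  then have inj: "inj_tr ?X" unfolding inj_tr_iff state_maps_def by blast
  obtain k where k: "sync_level n ?X k"
    using sync_level_tr_prod minimal_injD(1,6)[OF T] minimal_injD(1,6)[OF U] by blast
  have c: "(p, q) \<in> states ?X" using pq by (simp add: tr_prod_def)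
  have eq: "recurrent (state_map ?X (p, q)) = recurrent (\<lambda>x. g (f x))"
    using hX[OF pq(1,3)] pq by (intro recurrent_cong) simp
  show "tr_class n (reduction n (core n (T \<star> U))) = transducers_of (recurrent (\<lambda>x. g (f x)))"
    using tr_class_eq[OF reduction_core(1)[OF X inj k]] reduction_core(2)[OF X inj k c] eq c by simp
  have "loc (state_map ?X (p, q)) w = loc (\<lambda>x. g (f x)) w" if "w \<in> W" for w
    by (rule loc_cong(1)[OF _ that]) (use hX[OF pq(1,3)] pq in simp)
  then have "sync k (\<lambda>x. g (f x))"
    using transducer_sync[OF X inj c k] unfolding sync_def by simp
  moreover have "good (\<lambda>x. g (f x))"
    unfolding pq by (rule good_comp[OF minimal_inj_good[OF T pq(1)] minimal_inj_good[OF U pq(3)]])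
  ultimately show "synchronizing (\<lambda>x. g (f x))" unfolding synchronizing_def by blast
qed

text \<open>The multiplication is a union over all pairs of representatives; every pair yields the
  same class, and there is at least one pair.\<close>

lemma mult_transducers_of:
  assumes T: "minimal_inj T" and U: "minimal_inj U" and f: "f \<in> state_maps T" and g: "g \<in> state_maps U"
  shows "transducers_of (state_maps T) \<otimes>\<^bsub>M_monoid n\<^esub> transducers_of (state_maps U) = transducers_of (recurrent (\<lambda>x. g (f x)))"
proof -
  have *: "minimal_inj T'" if "T' \<in> transducers_of (state_maps T)" "minimal_inj T" for T T'
    using that unfolding transducers_of_def minimal_inj_def inj_tr_iff by simp
  have "tr_class n (reduction n (core n (T' \<star> U'))) = transducers_of (recurrent (\<lambda>x. g (f x)))"
    if "T' \<in> transducers_of (state_maps T)" "U' \<in> transducers_of (state_maps U)" for T' U'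
    using tr_prod_semantics(1)[OF *[OF that(1) T] *[OF that(2) U], of f g] that f g unfolding transducers_of_def by simp
  moreover have "T \<in> transducers_of (state_maps T)" "U \<in> transducers_of (state_maps U)" using T U unfolding transducers_of_def minimal_inj_def by auto
  ultimately show ?thesis by (auto simp: M_monoid_def)
qed

end

subsection \<open>Images, signatures and units\<close>

context alphabet
begin

section \<open>Clopen sets with an explicit depth, and their cone counts modulo
  \<open>n - 1\<close>\<close>

definition determined :: "nat \<Rightarrow> nat word set \<Rightarrow> bool" where
  "determined L C \<longleftrightarrow> C \<subseteq> I \<and> (\<forall>x\<in>I. \<forall>y\<in>I. agree L x y \<longrightarrow> x \<in> C \<longrightarrow> y \<in> C)"

lemma determined_mono: "determined L C \<Longrightarrow> L \<le> M \<Longrightarrow> determined M C"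
  unfolding determined_def using agree_mono by blast

lemma agree_sym: "agree m x y \<Longrightarrow> agree m y x"
  by (simp add: agree_def)

lemma cone_eq: "w \<in> W \<Longrightarrow> cone n w = {w \<frown> x | x. x \<in> I}"
  unfolding cone_def omega_prefix_def using conc_in_inf_words by blast

text \<open>Puts a cone in the form of a basic open set of the product topology.\<close>

lemma cone_PiE: "w \<in> W \<Longrightarrow> cone n w = PiE UNIV (\<lambda>i. if i < length w then {w ! i} else {..<n})"
proof -
  assume w: "w \<in> W"
  then have *: "w ! i < n" if "i < length w" for i
    using that by (metis in_lists_conv_set lessThan_iff nth_mem)
  show ?thesis
  proof (intro equalityI subsetI)
    fix x assume "x \<in> cone n w"
    then show "x \<in> PiE UNIV (\<lambda>i. if i < length w then {w ! i} else {..<n})"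
      by (auto simp: cone_def inf_words_eq omega_prefix_iff)
  next
    fix x assume "x \<in> PiE UNIV (\<lambda>i. if i < length w then {w ! i} else {..<n})"
    then have x: "x i \<in> (if i < length w then {w ! i} else {..<n})" for i
      by (rule PiE_mem) simp
    have "x i < n" for i using x[of i] *[of i] by (auto split: if_splits)
    moreover have "x i = w ! i" if "i < length w" for i using x[of i] that by simp
    ultimately show "x \<in> cone n w" by (simp add: cone_def inf_words_eq omega_prefix_iff)
  qed
qed

lemma openin_cone: "w \<in> W \<Longrightarrow> openin (cantor n) (cone n w)"
proof -
  assume w: "w \<in> W"
  then have *: "w ! i < n" if "i < length w" for i
    using that by (metis in_lists_conv_set lessThan_iff nth_mem)
  let ?P = "\<lambda>i. if i < length w then {w ! i} else {..<n}"
  have "openin (product_topology (\<lambda>_. discrete_topology {..<n}) UNIV) (PiE UNIV ?P)"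
  proof (rule product_topology_basis)
    show "openin (discrete_topology {..<n}) (?P i)" for i using * by simp
    show "finite {i. ?P i \<noteq> topspace (discrete_topology {..<n})}"
      by (rule finite_subset[of _ "{..<length w}"]) auto
  qed
  then show ?thesis unfolding cantor_def cone_PiE[OF w] .
qed

lemma determined_openin:
  assumes "determined L C" shows "openin (cantor n) C"
  unfolding openin_subopen[of _ C]
proof
  fix x assume x: "x \<in> C"
  then have xI: "x \<in> I" using assms unfolding determined_def by blast
  have "cone n (wtake L x) \<subseteq> C"
  proof
    fix y assume y: "y \<in> cone n (wtake L x)"
    then have "agree L x y" by (simp add: cone_def omega_prefix_iff agree_def)
    then show "y \<in> C" using assms x xI y unfolding determined_def cone_def by blast
  qed
  moreover have "x \<in> cone n (wtake L x)" using xI by (simp add: cone_def omega_prefix_iff)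
  moreover have "openin (cantor n) (cone n (wtake L x))" using xI by (intro openin_cone) simp
  ultimately show "\<exists>T. openin (cantor n) T \<and> x \<in> T \<and> T \<subseteq> C" by blast
qed

lemma determined_closedin:
  assumes "determined L C" shows "closedin (cantor n) C"
proof -
  have "determined L (I - C)" using assms agree_sym unfolding determined_def by blast
  then show ?thesis using assms determined_openin
    unfolding closedin_def inf_words_def[symmetric] determined_def by blast
qed

text \<open>When \<open>C\<close> is determined at depth \<open>L\<close>, these words label its
  partition into cones of depth \<open>L\<close>.\<close>

definition words_in :: "nat \<Rightarrow> nat word set \<Rightarrow> nat list set" where
  "words_in L C = {w \<in> W. length w = L \<and> cone n w \<subseteq> C}"

lemma finite_words_in: "finite (words_in L C)"
  by (rule finite_subset[OF _ finite_words[of L]]) (auto simp: words_in_def)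

lemma cone_nonempty: "w \<in> W \<Longrightarrow> \<exists>x\<in>I. w \<frown> x \<in> cone n w"
  by (rule bexI[of _ "\<lambda>_. 0"]) (simp_all add: cone_def)

lemma cone_subset_if_meets:
  assumes C: "determined L C" and w: "w \<in> W" "L \<le> length w" and x: "x \<in> C" "x \<in> cone n w"
  shows "cone n w \<subseteq> C"
proof
  fix y assume y: "y \<in> cone n w"
  have "agree L x y" using x y w by (simp add: cone_def omega_prefix_iff agree_def)
  then show "y \<in> C" using C x y unfolding determined_def cone_def by blast
qed

lemma card_lists_length: "card {w \<in> W. length w = L} = n ^ L"
  using card_lists_length_eq[of "{..<n}" L] by (simp add: lists_eq_set)

lemma n_cong_1: "[n = 1] (mod (n - 1))"
proof -
  have "n = (n - 1) + 1" using n2 by simp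
  then show ?thesis by (metis cong_add_lcancel_0_nat cong_add_rcancel_nat cong_refl mod_add_self1 unique_euclidean_semiring_class.cong_def)
qed

lemma n_pow_cong_1: "[n ^ k = 1] (mod (n - 1))"
  using cong_pow[OF n_cong_1, of k] by simp

text \<open>One step deeper each cone splits into \<open>n\<close> cones. As \<open>n\<close> is 1
  modulo \<open>n - 1\<close>, the residue of the count does not depend on the depth.\<close>

lemma card_words_in_Suc:
  assumes C: "determined L C" shows "card (words_in (Suc L) C) = card (words_in L C) * n"
proof -
  have "bij_betw (\<lambda>(w, a). w @ [a]) (words_in L C \<times> {..<n}) (words_in (Suc L) C)"
    unfolding bij_betw_def
  proof (intro conjI equalityI subsetI)
    show "inj_on (\<lambda>(w, a). w @ [a]) (words_in L C \<times> {..<n})" by (auto simp: inj_on_def)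
  next
    fix v assume "v \<in> (\<lambda>(w, a). w @ [a]) ` (words_in L C \<times> {..<n})"
    then obtain w a where w: "v = w @ [a]" "w \<in> W" "length w = L" "cone n w \<subseteq> C" "a < n" by (auto simp: words_in_def)
    then have "cone n v \<subseteq> cone n w" by (auto simp: cone_def omega_prefix_iff nth_append)
    then show "v \<in> words_in (Suc L) C" using w by (auto simp: words_in_def)
  next
    fix v assume "v \<in> words_in (Suc L) C"
    then have v: "v \<in> W" "length v = Suc L" "cone n v \<subseteq> C" by (auto simp: words_in_def)
    obtain w a where w: "v = w @ [a]" using v(2) by (metis append_butlast_last_id list.size(3) nat.distinct(1))
    obtain x where x: "x \<in> I" "v \<frown> x \<in> cone n v" using cone_nonempty[OF v(1)] by blast
    have "v \<frown> x \<in> cone n w" using x v(1) unfolding w by (auto simp: cone_def omega_prefix_iff nth_append)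
    then have "cone n w \<subseteq> C" using v x w by (intro cone_subset_if_meets[OF C, of w "v \<frown> x"]) auto
    then show "v \<in> (\<lambda>(w, a). w @ [a]) ` (words_in L C \<times> {..<n})"
      using v w by (intro image_eqI[of _ _ "(w, a)"]) (auto simp: words_in_def)
  qed
  from bij_betw_same_card[OF this] show ?thesis by (simp add: card_cartesian_product)
qed

lemma card_words_in_cong:
  assumes C: "determined L C" and "L \<le> M"
  shows "[card (words_in M C) = card (words_in L C)] (mod (n - 1))"
  using assms(2)
proof (induction M rule: dec_induct)
  case (step M)
  have "[card (words_in M C) * n = card (words_in L C) * 1] (mod (n - 1))"
    by (rule cong_mult[OF step.IH n_cong_1])
  then show ?case using card_words_in_Suc[OF determined_mono[OF C step.hyps(1)]] by simp
qed simp

lemma card_words_in_shift: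
  assumes u: "u \<in> W" and C: "C \<subseteq> I"
  shows "card (words_in (length u + L) ((\<lambda>x. u \<frown> x) ` C)) = card (words_in L C)"
proof -
  have "bij_betw (\<lambda>w. u @ w) (words_in L C) (words_in (length u + L) ((\<lambda>x. u \<frown> x) ` C))"
    unfolding bij_betw_def
  proof (intro conjI equalityI subsetI)
    show "inj_on (\<lambda>w. u @ w) (words_in L C)" by (auto simp: inj_on_def)
  next
    fix v assume "v \<in> (\<lambda>w. u @ w) ` words_in L C"
    then obtain w where w: "v = u @ w" "w \<in> W" "length w = L" "cone n w \<subseteq> C" by (auto simp: words_in_def)
    have "cone n v \<subseteq> (\<lambda>x. u \<frown> x) ` C"
    proof
      fix y assume "y \<in> cone n v"
      then obtain x where x: "x \<in> I" "y = (u @ w) \<frown> x" using cone_eq[of v] u w by auto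
      then have "w \<frown> x \<in> C" using cone_eq[OF w(2)] w(4) by blast
      then show "y \<in> (\<lambda>x. u \<frown> x) ` C" using x by (metis conc_conc imageI)
    qed
    then show "v \<in> words_in (length u + L) ((\<lambda>x. u \<frown> x) ` C)" using w u by (auto simp: words_in_def)
  next
    fix v assume "v \<in> words_in (length u + L) ((\<lambda>x. u \<frown> x) ` C)"
    then have v: "v \<in> W" "length v = length u + L" "cone n v \<subseteq> (\<lambda>x. u \<frown> x) ` C" by (auto simp: words_in_def)
    obtain x where x: "x \<in> I" "v \<frown> x \<in> cone n v" using cone_nonempty[OF v(1)] by blast
    then obtain y where "v \<frown> x = u \<frown> y" using v(3) by blast
    then have "omega_prefix u (v \<frown> x)" by simp
    then obtain w where w: "v = u @ w" using omega_prefix_conc_iff[of u v x] v(2) by (auto simp: prefix_def)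
    have "cone n w \<subseteq> C"
    proof
      fix z assume z: "z \<in> cone n w"
      have "w \<in> W" using v(1) w by simp
      then obtain y where "y \<in> I" "z = w \<frown> y" using cone_eq z by blast
      then have "u \<frown> z \<in> cone n v" using cone_eq[OF v(1)] w by auto
      then show "z \<in> C" using v(3) by auto
    qed
    then show "v \<in> (\<lambda>w. u @ w) ` words_in L C" using v w by (auto simp: words_in_def)
  qed
  from bij_betw_same_card[OF this] show ?thesis by simp
qed

text \<open>A cone of depth \<open>L\<close> that meets \<open>C i\<close> lies inside it, so it
  cannot be shared between two of the sets.\<close>

lemma card_words_in_UN:
  assumes F: "finite F" and C: "\<And>i. i \<in> F \<Longrightarrow> determined L (C i)"
    and disj: "\<And>i j. i \<in> F \<Longrightarrow> j \<in> F \<Longrightarrow> i \<noteq> j \<Longrightarrow> C i \<inter> C j = {}"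
  shows "card (words_in L (\<Union>i\<in>F. C i)) = (\<Sum>i\<in>F. card (words_in L (C i)))"
proof -
  have "words_in L (\<Union>i\<in>F. C i) = (\<Union>i\<in>F. words_in L (C i))"
  proof (intro equalityI subsetI)
    fix w assume "w \<in> words_in L (\<Union>i\<in>F. C i)"
    then have w: "w \<in> W" "length w = L" "cone n w \<subseteq> (\<Union>i\<in>F. C i)" by (auto simp: words_in_def)
    obtain x where x: "w \<frown> x \<in> cone n w" using cone_nonempty[OF w(1)] by blast
    then obtain i where i: "i \<in> F" "w \<frown> x \<in> C i" using w(3) by blast
    then have "cone n w \<subseteq> C i" using cone_subset_if_meets[OF C[OF i(1)] w(1) _ i(2) x] w(2) by simp
    then show "w \<in> (\<Union>i\<in>F. words_in L (C i))" using i w by (auto simp: words_in_def)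
  qed (auto simp: words_in_def)
  moreover have "words_in L (C i) \<inter> words_in L (C j) = {}" if "i \<in> F" "j \<in> F" "i \<noteq> j" for i j
    using disj[OF that] cone_nonempty unfolding words_in_def by blast
  ultimately show ?thesis using F finite_words_in by (simp add: card_UN_disjoint)
qed

lemma words_in_UN_cones:
  assumes V: "V \<subseteq> W" and L: "\<And>v. v \<in> V \<Longrightarrow> length v \<le> L"
  shows "words_in L (\<Union>v\<in>V. cone n v) = (\<Union>v\<in>V. (\<lambda>u. v @ u) ` {u \<in> W. length u = L - length v})"
proof (intro equalityI subsetI)
  fix w assume "w \<in> words_in L (\<Union>v\<in>V. cone n v)"
  then have w: "w \<in> W" "length w = L" "cone n w \<subseteq> (\<Union>v\<in>V. cone n v)" by (auto simp: words_in_def)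
  obtain x where x: "w \<frown> x \<in> cone n w" using cone_nonempty[OF w(1)] by blast
  then obtain v where v: "v \<in> V" "w \<frown> x \<in> cone n v" using w(3) by blast
  then have "Sublist.prefix v w"
    using omega_prefix_conc_iff[of v w x] L[OF v(1)] w(2) by (simp add: cone_def)
  then obtain u where u: "w = v @ u" by (auto simp: prefix_def)
  then have uu: "u \<in> {u \<in> W. length u = L - length v}" using w(1,2) by auto
  show "w \<in> (\<Union>v\<in>V. (\<lambda>u. v @ u) ` {u \<in> W. length u = L - length v})"
    unfolding u by (rule UN_I[OF v(1)], rule imageI[OF uu])
next
  fix w assume "w \<in> (\<Union>v\<in>V. (\<lambda>u. v @ u) ` {u \<in> W. length u = L - length v})"
  then obtain v u where vu: "v \<in> V" "w = v @ u" "u \<in> W" "length u = L - length v" by blast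
  then have "cone n w \<subseteq> cone n v" by (auto simp: cone_def omega_prefix_iff nth_append)
  moreover have "v \<in> W" using V vu by blast
  ultimately show "w \<in> words_in L (\<Union>v\<in>V. cone n v)"
    using vu L[OF vu(1)] by (auto simp: words_in_def)
qed

text \<open>A cover by the least number of cones is an antichain, hence disjoint.\<close>

lemma cone_number_cong:
  assumes img: "image_of n T q = C" and C: "determined L C"
  shows "[cone_number n T q = card (words_in L C)] (mod (n - 1))"
proof -
  let ?P = "\<lambda>m. \<exists>V\<subseteq>W. finite V \<and> card V = m \<and> C = (\<Union>\<nu>\<in>V. cone n \<nu>)"
  have "C = (\<Union>v\<in>words_in L C. cone n v)"
  proof (intro equalityI subsetI)
    fix x assume x: "x \<in> C"
    then have xI: "x \<in> I" using C unfolding determined_def by blast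
    then have c: "x \<in> cone n (wtake L x)" by (simp add: cone_def omega_prefix_iff)
    have "cone n (wtake L x) \<subseteq> C" using xI by (intro cone_subset_if_meets[OF C _ _ x c]) simp_all
    then have "wtake L x \<in> words_in L C" using xI by (simp add: words_in_def)
    then show "x \<in> (\<Union>v\<in>words_in L C. cone n v)" using c by blast
  qed (auto simp: words_in_def)
  then have "?P (card (words_in L C))"
    using finite_words_in by (intro exI[of _ "words_in L C"]) (auto simp: words_in_def)
  then have "?P (LEAST m. ?P m)" by (rule LeastI)
  moreover have cn: "cone_number n T q = (LEAST m. ?P m)" unfolding cone_number_def img ..
  ultimately obtain V where V: "V \<subseteq> W" "finite V" "card V = cone_number n T q" "C = (\<Union>\<nu>\<in>V. cone n \<nu>)"
    by metis
  have anti: "\<not> Sublist.prefix v w" if vw: "v \<in> V" "w \<in> V" "v \<noteq> w" for v w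
  proof
    assume "Sublist.prefix v w"
    then have "cone n w \<subseteq> cone n v" unfolding cone_def using omega_prefix_mono by blast
    then have "C = (\<Union>\<nu>\<in>V - {w}. cone n \<nu>)" using V(4) vw by blast
    then have "?P (card (V - {w}))" using V by (intro exI[of _ "V - {w}"]) auto
    then have "cone_number n T q \<le> card (V - {w})" unfolding cn by (rule Least_le)
    then show False using V(2,3) vw(2) by (metis card_Diff1_less not_le)
  qed
  define M where "M = Max (insert L (length ` V))"
  have M: "L \<le> M" "\<And>v. v \<in> V \<Longrightarrow> length v \<le> M" using V(2) by (auto simp: M_def)
  have disj: "(@) v ` {u \<in> W. length u = M - length v} \<inter> (@) w ` {u \<in> W. length u = M - length w} = {}"
    if vw: "v \<in> V" "w \<in> V" "v \<noteq> w" for v w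
  proof (rule ccontr)
    assume "\<not> ?thesis"
    then obtain u u' where "v @ u = w @ u'" by blast
    then have "Sublist.prefix v w \<or> Sublist.prefix w v" by (metis prefixI prefix_same_cases)
    then show False using anti vw by blast
  qed
  have wM: "words_in M C = (\<Union>v\<in>V. (@) v ` {u \<in> W. length u = M - length v})"
    using words_in_UN_cones[OF V(1), of M] M(2) V(4) by simp
  have "card (words_in M C) = (\<Sum>v\<in>V. card ((@) v ` {u \<in> W. length u = M - length v}))"
    unfolding wM by (rule card_UN_disjoint) (use V(2) finite_words disj in simp_all)
  \<comment> \<open>At depth \<open>M\<close> the cone of \<open>v\<close> has become this power of
    \<open>n\<close>, which is 1 modulo \<open>n - 1\<close>; the sum thus counts the cover.\<close>
  also have "\<dots> = (\<Sum>v\<in>V. n ^ (M - length v))"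
    by (rule sum.cong) (simp_all add: card_image inj_on_def card_lists_length)
  finally have "[card (words_in M C) = (\<Sum>v\<in>V. 1)] (mod (n - 1))"
    using cong_sum[of V "\<lambda>v. n ^ (M - length v)" "\<lambda>_. 1" "n - 1"] n_pow_cong_1 by simp
  then have "[card (words_in M C) = cone_number n T q] (mod (n - 1))" using V(3) by simp
  then show ?thesis using card_words_in_cong[OF C M(1)] cong_sym cong_trans by blast
qed

text \<open>The last conjunct makes \<open>f\<close> one of the state maps of its own class, so that
  products can be computed by composing with \<open>f\<close>, and the surjectivity of
  \<open>f\<close> fixes the signature.\<close>

definition involution :: "(nat word \<Rightarrow> nat word) \<Rightarrow> bool" where
  "involution f \<longleftrightarrow> synchronizing f \<and> (\<forall>x\<in>I. f (f x) = x) \<and> restrict f I \<in> recurrent f"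

text \<open>Since \<open>f\<close> is its own inverse, \<open>y\<close> is in the image exactly if
  \<open>f\<close> maps \<open>lcp f w\<close> followed by \<open>y\<close> to a word beginning with
  \<open>w\<close>; by continuity finitely many letters of \<open>y\<close> decide this.\<close>

lemma involution_image_determined:
  assumes f: "involution f" and w: "w \<in> W"
  shows "\<exists>L. determined L (loc f w ` I)"
proof -
  have g: "good f" and ff: "\<And>x. x \<in> I \<Longrightarrow> f (f x) = x" using f unfolding involution_def synchronizing_def by auto
  let ?u = "lcp f w"
  have uW: "?u \<in> W" by (rule lcp_in_W[OF g w])
  have eq: "loc f w ` I = {y \<in> I. omega_prefix w (f (?u \<frown> y))}"
  proof (intro equalityI subsetI)
    fix y assume "y \<in> loc f w ` I"
    then obtain x where x: "x \<in> I" "y = loc f w x" by blast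
    have "f (?u \<frown> y) = f (f (w \<frown> x))" using loc_decomp[OF g w x(1)] x(2) by simp
    also have "\<dots> = w \<frown> x" using ff x w by simp
    finally show "y \<in> {y \<in> I. omega_prefix w (f (?u \<frown> y))}" using goodD(1)[OF good_loc[OF g w] x(1)] x(2) by simp
  next
    fix y assume "y \<in> {y \<in> I. omega_prefix w (f (?u \<frown> y))}"
    then have y: "y \<in> I" "omega_prefix w (f (?u \<frown> y))" by auto
    obtain x where x: "f (?u \<frown> y) = w \<frown> x" using y(2) unfolding omega_prefix_def by blast
    have "?u \<frown> y \<in> I" using uW y by simp
    then have "w \<frown> x \<in> I" using goodD(1)[OF g] x by metis
    then have xI: "x \<in> I" by simp
    have "?u \<frown> y = f (w \<frown> x)" using ff[OF \<open>?u \<frown> y \<in> I\<close>] x by simp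
    also have "\<dots> = ?u \<frown> loc f w x" by (rule loc_decomp[OF g w xI])
    finally show "y \<in> loc f w ` I" using xI by simp
  qed
  obtain k where k: "\<forall>x\<in>I. \<forall>y\<in>I. agree k x y \<longrightarrow> agree (length w) (f x) (f y)"
    using good_ucontD[OF g] by blast
  have "determined k (loc f w ` I)"
    unfolding determined_def eq
  proof (intro conjI ballI impI CollectI)
    fix x y assume xy: "x \<in> I" "y \<in> I" "agree k x y" "x \<in> {y \<in> I. omega_prefix w (f (?u \<frown> y))}"
    have "agree (length ?u + k) (?u \<frown> x) (?u \<frown> y)" using xy(3) by (simp only: agree_conc_add)
    then have "agree k (?u \<frown> x) (?u \<frown> y)" by (rule agree_mono) simp
    then have "agree (length w) (f (?u \<frown> x)) (f (?u \<frown> y))" using k uW xy by simp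
    then show "omega_prefix w (f (?u \<frown> y))" using xy(4) by (simp add: omega_prefix_iff agree_def)
  qed auto
  then show ?thesis by blast
qed

lemma determined_shift:
  assumes u: "u \<in> W" and C: "determined L C" shows "determined (length u + L) ((\<lambda>x. u \<frown> x) ` C)"
  unfolding determined_def
proof (intro conjI ballI impI)
  show "(\<lambda>x. u \<frown> x) ` C \<subseteq> I" using C u unfolding determined_def by auto
next
  fix x y assume xy: "x \<in> I" "y \<in> I" "agree (length u + L) x y" "x \<in> (\<lambda>x. u \<frown> x) ` C"
  then obtain z where z: "z \<in> C" "x = u \<frown> z" by blast
  have "agree (length u) (u \<frown> z) y" using xy(3) unfolding z(2) by (rule agree_mono) simp
  then have "omega_prefix u y" unfolding omega_prefix_iff agree_def by (metis conc_fst)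
  then obtain z' where z': "y = u \<frown> z'" unfolding omega_prefix_def by blast
  have "z' \<in> I" "z \<in> I" using xy z z' by auto
  moreover have "agree L z z'" using xy(3) unfolding z z' by (simp only: agree_conc_add)
  ultimately show "y \<in> (\<lambda>x. u \<frown> x) ` C" using C z z' unfolding determined_def by blast
qed

text \<open>Reading \<open>K\<close> letters splits the image of any recurrent \<open>g\<close> into
  shifted images of the actions \<open>loc f w\<close>, which by synchronization are the same for
  all \<open>g\<close>. Hence all counts have one residue, and \<open>f\<close>, being onto, has
  count \<open>n ^ L\<close>.\<close>

lemma involution_card_words_in:
  assumes f: "involution f"
  shows "\<exists>L. \<forall>g\<in>recurrent f. determined L (g ` I) \<and> [card (words_in L (g ` I)) = 1] (mod (n - 1))"
proof -
  have sf: "synchronizing f" and gf: "good f" using f unfolding involution_def synchronizing_def by auto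
  obtain K where K: "sync K f" using sf unfolding synchronizing_def by blast
  have "\<exists>L. determined L (g ` I)" if g: "g \<in> recurrent f" for g
  proof -
    obtain w where "w \<in> W" "g = loc f w" using g sync_recurrent(2)[OF K] by blast
    then show ?thesis using involution_image_determined[OF f] by blast
  qed
  then obtain l where l: "\<And>g. g \<in> recurrent f \<Longrightarrow> determined (l g) (g ` I)" by metis
  define L where "L = Max (l ` recurrent f)"
  have L: "determined L (g ` I)" if "g \<in> recurrent f" for g
    by (rule determined_mono[OF l[OF that]]) (use finite_recurrent[OF sf] that in \<open>simp add: L_def\<close>)
  define F where "F = {w \<in> W. length w = K}"
  \<comment> \<open>The common residue: no \<open>g\<close> occurs in this sum.\<close>
  define s where "s = (\<Sum>w\<in>F. card (words_in L (loc f w ` I)))"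
  have finF: "finite F" unfolding F_def by (rule finite_words)
  have s: "[card (words_in L (g ` I)) = s] (mod (n - 1))" if g: "g \<in> recurrent f" for g
  proof -
    have gg: "good g" using recurrent_good[OF gf g] by blast
    obtain v where v: "v \<in> W" "g = loc f v" using g sync_recurrent(2)[OF K] by blast
    have lg: "loc g w = loc f w" if "w \<in> F" for w
      using loc_append(2)[OF gf v(1), of w] syncD[OF K v(1), of w] that v(2) by (simp add: F_def)
    have lgH: "loc g w \<in> recurrent f" if "w \<in> F" for w
      using recurrent_loc_closed[OF gf g] that unfolding F_def by blast
    \<comment> \<open>Deep enough to resolve every piece at depth \<open>L\<close> after its prefix
      \<open>lcp g w\<close>.\<close>
    define N where "N = L + Max ((\<lambda>w. length (lcp g w)) ` F)"
    have N: "length (lcp g w) + L \<le> N" if "w \<in> F" for w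
      using finF that by (simp add: N_def)
    let ?C = "\<lambda>w. (\<lambda>x. lcp g w \<frown> x) ` loc g w ` I"
    have img: "?C w = (\<lambda>x. g (w \<frown> x)) ` I" if "w \<in> F" for w
      using loc_decomp[OF gg, of w] that unfolding image_image F_def by (intro image_cong) simp_all
    have "g ` I = (\<Union>w\<in>F. ?C w)"
    proof (intro equalityI subsetI)
      fix y assume "y \<in> g ` I"
      then obtain x where x: "x \<in> I" "y = g x" by blast
      have "wtake K x \<in> F" "wdrop K x \<in> I" "y = g (wtake K x \<frown> wdrop K x)"
        using x by (simp_all add: F_def)
      then have "wtake K x \<in> F" "y \<in> ?C (wtake K x)" unfolding img[OF \<open>wtake K x \<in> F\<close>] by (simp, intro image_eqI)
      then show "y \<in> (\<Union>w\<in>F. ?C w)" by blast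
    next
      fix y assume "y \<in> (\<Union>w\<in>F. ?C w)"
      then obtain w where "w \<in> F" "y \<in> ?C w" by blast
      then obtain x where "w \<in> F" "x \<in> I" "y = g (w \<frown> x)" unfolding img[OF \<open>w \<in> F\<close>] by blast
      then show "y \<in> g ` I" unfolding F_def by simp
    qed
    moreover have "card (words_in N (\<Union>w\<in>F. ?C w)) = (\<Sum>w\<in>F. card (words_in N (?C w)))"
    proof (rule card_words_in_UN[OF finF])
      fix w assume w: "w \<in> F"
      then have "lcp g w \<in> W" using lcp_in_W[OF gg] unfolding F_def by blast
      from determined_shift[OF this L[OF lgH[OF w]]]
      show "determined N (?C w)" by (rule determined_mono) (rule N[OF w])
    next
      fix v w assume vw: "v \<in> F" "w \<in> F" "v \<noteq> w"
      show "?C v \<inter> ?C w = {}"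
      proof (rule ccontr)
        assume "\<not> ?thesis"
        then obtain x y where xy: "x \<in> I" "y \<in> I" "g (v \<frown> x) = g (w \<frown> y)" unfolding img[OF vw(1)] img[OF vw(2)] by blast
        have len: "length v = length w" "v \<frown> x \<in> I" "w \<frown> y \<in> I"
          using vw xy(1,2) by (simp_all add: F_def)
        have "v \<frown> x = w \<frown> y" using goodD(2)[OF gg, of "v \<frown> x" "w \<frown> y"] len(2,3) xy(3) by blast
        then have "v = w" using concat_eq[OF len(1)] by blast
        then show False using vw(3) by contradiction
      qed
    qed
    ultimately have "card (words_in N (g ` I)) = (\<Sum>w\<in>F. card (words_in N (?C w)))" by simp
    moreover have "[(\<Sum>w\<in>F. card (words_in N (?C w))) = s] (mod (n - 1))"
      unfolding s_def
    proof (rule cong_sum)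
      fix w assume w: "w \<in> F"
      have u: "lcp g w \<in> W" using lcp_in_W[OF gg] w unfolding F_def by blast
      have N': "length (lcp g w) + (N - length (lcp g w)) = N" using N[OF w] by simp
      have sub: "loc g w ` I \<subseteq> I" using L[OF lgH[OF w]] unfolding determined_def by blast
      have "card (words_in N (?C w)) = card (words_in (N - length (lcp g w)) (loc g w ` I))"
        using card_words_in_shift[OF u sub, of "N - length (lcp g w)"] unfolding N' .
      moreover have "L \<le> N - length (lcp g w)" using N[OF w] by simp
      ultimately show "[card (words_in N (?C w)) = card (words_in L (loc f w ` I))] (mod (n - 1))"
        using card_words_in_cong[OF L[OF lgH[OF w]]] lg[OF w] by simp
    qed
    moreover have "[card (words_in N (g ` I)) = card (words_in L (g ` I))] (mod (n - 1))"
      by (rule card_words_in_cong[OF L[OF g]]) (simp add: N_def)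
    ultimately show ?thesis using cong_trans cong_sym by metis
  qed
  have fH: "restrict f I \<in> recurrent f" using f unfolding involution_def by blast
  have "restrict f I ` I = I"
  proof (intro equalityI subsetI)
    fix x assume "x \<in> restrict f I ` I"
    then show "x \<in> I" using goodD(1)[OF gf] by auto
  next
    fix x assume x: "x \<in> I"
    then have "x = restrict f I (f x)" "f x \<in> I" using goodD(1)[OF gf] f unfolding involution_def by auto
    then show "x \<in> restrict f I ` I" by blast
  qed
  moreover have "words_in L I = {w \<in> W. length w = L}" by (auto simp: words_in_def cone_def)
  ultimately have "[card (words_in L (restrict f I ` I)) = 1] (mod (n - 1))"
    using card_lists_length n_pow_cong_1 by simp
  then have "[s = 1] (mod (n - 1))" using s[OF fH] cong_trans cong_sym by blast
  then show ?thesis using L s cong_trans by blast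
qed

lemma image_of_state_map: "image_of n T q = state_map T q ` I"
  by (simp add: image_of_def state_map_def)

lemma clsD: "V \<in> transducers_of S \<Longrightarrow> V \<in> M_transducers n" "V \<in> transducers_of S \<Longrightarrow> state_maps V = S"
  by (auto simp: transducers_of_def)

lemma tr_class_M: "T \<in> M_transducers n \<Longrightarrow> tr_class n T = transducers_of (state_maps T)"
  by (rule tr_class_eq[OF M_weakly_minimal])

lemma transducers_of_recurrent_carrier: "synchronizing f \<Longrightarrow> transducers_of (recurrent f) \<in> carrier (M_monoid n)"
  using realize tr_class_M by (fastforce simp: M_monoid_def)

lemma realize_in_transducers_of: "synchronizing f \<Longrightarrow> realize f \<in> transducers_of (recurrent f)"
  using realize by (simp add: transducers_of_def)

lemma realize_minimal_inj:
  assumes f: "synchronizing f" shows "minimal_inj (realize f)"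
proof -
  have "good f" using f unfolding synchronizing_def by blast
  then have "inj_on g I" if "g \<in> recurrent f" for g
    using recurrent_good[OF _ that] unfolding good_def by blast
  then show ?thesis unfolding minimal_inj_def inj_tr_iff realize(2)[OF f] using realize(1)[OF f] by blast
qed

section \<open>Elements of the groups, and involutions among them\<close>

lemma O_tildeD:
  assumes "A \<in> carrier (O_tilde n)"
  shows "\<exists>T. minimal_inj T \<and> A = transducers_of (state_maps T)"
proof -
  obtain T where T: "T \<in> M_transducers n" "A = tr_class n T"
    using assms by (auto simp: O_tilde_def M_monoid_def)
  then have A: "A = transducers_of (state_maps T)" using tr_class_M by simp
  then have "T \<in> A" using T by (simp add: transducers_of_def)
  then have "inj_tr T" using assms by (auto simp: O_tilde_def inj_tr_def)
  then show ?thesis using T A unfolding minimal_inj_def by blast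
qed

lemma involution_O_tilde:
  assumes f: "involution f" shows "transducers_of (recurrent f) \<in> carrier (O_tilde n)"
proof -
  have sf: "synchronizing f" using f unfolding involution_def by blast
  obtain L where L: "\<And>g. g \<in> recurrent f \<Longrightarrow> determined L (g ` I)" using involution_card_words_in[OF f] by blast
  have "inj_on (omega_out T q) I \<and> openin (cantor n) (image_of n T q) \<and> closedin (cantor n) (image_of n T q)"
    if T: "T \<in> transducers_of (recurrent f)" and q: "q \<in> states T" for T q
  proof -
    have hq: "state_map T q \<in> recurrent f" using clsD(2)[OF T] q unfolding state_maps_def by blast
    have "good (state_map T q)" using recurrent_good[OF _ hq] sf unfolding synchronizing_def by blast
    then have "inj_on (omega_out T q) I" unfolding good_def state_map_def inj_on_def by simp
    then show ?thesis
      using determined_openin[OF L[OF hq]] determined_closedin[OF L[OF hq]] by (simp add: image_of_state_map)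
  qed
  then show ?thesis using transducers_of_recurrent_carrier[OF sf] by (simp add: O_tilde_def)
qed

lemma loc_id: "w \<in> W \<Longrightarrow> loc (\<lambda>x. x) w = restrict (\<lambda>x. x) I \<and> lcp (\<lambda>x. x) w = w"
proof -
  assume w: "w \<in> W"
  have "spread (\<lambda>x. x)" unfolding spread_def
    by (rule bexI[of _ "\<lambda>_. 0"], rule bexI[of _ "\<lambda>_. Suc 0"]) simp_all
  from loc_unique[OF w _ this, of "\<lambda>x. x" w] show ?thesis by simp
qed

lemma recurrent_id: "recurrent (\<lambda>x. x) = {restrict (\<lambda>x. x) I}"
proof -
  have "sync 0 (\<lambda>x. x)" unfolding sync_def using loc_id by simp
  from sync_recurrent(2)[OF this] show ?thesis using loc_id by auto
qed

lemma involution_id: "involution (\<lambda>x. x)"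
proof -
  have "sync 0 (\<lambda>x. x)" unfolding sync_def using loc_id by simp
  then show ?thesis unfolding involution_def synchronizing_def using good_id recurrent_id by blast
qed

lemma one_eq: "\<one>\<^bsub>M_monoid n\<^esub> = transducers_of (recurrent (\<lambda>x. x))"
proof -
  let ?T = id_transducer
  have outs: "outs ?T w q = w" for w q
    by (induction w arbitrary: q) (simp_all add: id_transducer_def)
  have "omega_out ?T q x = x" for q x
  proof (rule omega_out_unique)
    show "unbounded_out ?T q x" unfolding unbounded_out_def outs by auto
    show "\<exists>k\<ge>m. omega_prefix (outs ?T (wtake k x) q) x" for m
      unfolding outs by (intro exI[of _ m]) (simp add: omega_prefix_iff)
  qed
  then have "state_map ?T q = restrict (\<lambda>x. x) I" for q by (simp add: state_map_def restrict_def fun_eq_iff)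
  then have "state_maps ?T = recurrent (\<lambda>x. x)" by (simp add: state_maps_def recurrent_id id_transducer_def)
  moreover have "weakly_minimal n ?T" by (simp add: weakly_minimal_def id_transducer_def)
  ultimately have "tr_class n ?T = transducers_of (recurrent (\<lambda>x. x))" using tr_class_eq[of ?T] by simp
  then show ?thesis by (simp add: M_monoid_def)
qed

lemma O_simps [simp]:
  "mult (O_tilde n) = mult (M_monoid n)" "one (O_tilde n) = one (M_monoid n)"
  "mult (O_nr n r) = mult (M_monoid n)" "one (O_nr n r) = one (M_monoid n)"
  by (simp_all add: O_tilde_def O_nr_def O_group_def units_of_def)

text \<open>An involution is its own inverse, and its signature 1 satisfies the defining congruence
  for every \<open>r\<close>.\<close>

lemma involution_O_nr:
  assumes f: "involution f" shows "transducers_of (recurrent f) \<in> carrier (O_nr n r)"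
proof -
  have sf: "synchronizing f" and ff: "\<And>x. x \<in> I \<Longrightarrow> f (f x) = x" and fH: "restrict f I \<in> recurrent f"
    using f unfolding involution_def by auto
  have mi: "minimal_inj (realize f)" and state_maps: "state_maps (realize f) = recurrent f"
    using realize_minimal_inj[OF sf] realize[OF sf] by auto
  have "transducers_of (recurrent f) \<otimes>\<^bsub>M_monoid n\<^esub> transducers_of (recurrent f) = transducers_of (recurrent (\<lambda>x. restrict f I (restrict f I x)))"
    using mult_transducers_of[OF mi mi, of "restrict f I" "restrict f I"] fH unfolding state_maps by blast
  also have "recurrent (\<lambda>x. restrict f I (restrict f I x)) = recurrent (\<lambda>x. x)"
    by (rule recurrent_cong) (use ff goodD(1)[of f] sf in \<open>auto simp: synchronizing_def\<close>)
  finally have "transducers_of (recurrent f) \<in> Units (O_tilde n)"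
    using involution_O_tilde[OF f] one_eq unfolding Units_def by auto
  moreover have "[r * sig n T = r] (mod (n - 1))" if T: "T \<in> transducers_of (recurrent f)" for T
  proof -
    define q where "q = (SOME q. q \<in> states T)"
    have "states T \<noteq> {}" using clsD(1)[OF T] by (auto simp: M_transducers_def transducer_def)
    then have "q \<in> states T" unfolding q_def by (simp add: some_in_eq)
    then have hq: "state_map T q \<in> recurrent f" using clsD(2)[OF T] unfolding state_maps_def by blast
    obtain L where L: "determined L (state_map T q ` I)" "[card (words_in L (state_map T q ` I)) = 1] (mod (n - 1))"
      using involution_card_words_in[OF f] hq by blast
    have "[cone_number n T q = 1] (mod (n - 1))"
      using cone_number_cong[OF image_of_state_map L(1)] L(2) cong_trans by blast
    then have "[sig n T = 1] (mod (n - 1))" unfolding sig_def q_def by (simp add: unique_euclidean_semiring_class.cong_def)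
    from cong_mult[OF cong_refl this] show ?thesis by simp
  qed
  ultimately show ?thesis by (simp add: O_nr_def O_group_def units_of_def)
qed

text \<open>Invertibility is turned into a statement about composites of arbitrary state maps of
  \<open>T\<close> and of its inverse \<open>U\<close>.\<close>

lemma O_nrD:
  assumes "A \<in> carrier (O_nr n r)"
  shows "\<exists>T U. minimal_inj T \<and> minimal_inj U \<and> A = transducers_of (state_maps T) \<and> 
    (\<forall>f\<in>state_maps T. \<forall>g\<in>state_maps U. recurrent (\<lambda>x. g (f x)) = recurrent (\<lambda>x. x) \<and> synchronizing (\<lambda>x. g (f x)))"
proof -
  have "A \<in> Units (O_tilde n)" using assms by (simp add: O_nr_def O_group_def units_of_def)
  then obtain B where A: "A \<in> carrier (O_tilde n)" and B: "B \<in> carrier (O_tilde n)"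
    and AB: "A \<otimes>\<^bsub>M_monoid n\<^esub> B = \<one>\<^bsub>M_monoid n\<^esub>"
    unfolding Units_def by auto
  obtain T where T: "minimal_inj T" "A = transducers_of (state_maps T)" using O_tildeD[OF A] by blast
  obtain U where U: "minimal_inj U" "B = transducers_of (state_maps U)" using O_tildeD[OF B] by blast
  have "recurrent (\<lambda>x. g (f x)) = recurrent (\<lambda>x. x) \<and> synchronizing (\<lambda>x. g (f x))" if fg: "f \<in> state_maps T" "g \<in> state_maps U" for f g
  proof -
    have s: "synchronizing (\<lambda>x. g (f x))" by (rule tr_prod_semantics(2)[OF T(1) U(1) fg])
    have "transducers_of (recurrent (\<lambda>x. g (f x))) = transducers_of (recurrent (\<lambda>x. x))"
      using mult_transducers_of[OF T(1) U(1) fg] AB T U one_eq by simp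
    then have "realize (\<lambda>x. g (f x)) \<in> transducers_of (recurrent (\<lambda>x. x))" using realize_in_transducers_of[OF s] by simp
    then have "state_maps (realize (\<lambda>x. g (f x))) = recurrent (\<lambda>x. x)" by (rule clsD(2))
    then show ?thesis using realize(2)[OF s] s by simp
  qed
  then show ?thesis using T U by blast
qed

end

subsection \<open>Interchanging two blocks\<close>

lemma diff_length_less: "v \<noteq> [] \<Longrightarrow> \<not> i < length v \<Longrightarrow> i - length v < i"
  by (cases v) auto

text \<open>Comparability of \<open>drop r P\<close> with \<open>Q\<close> covers both a partial
  overlap and the containment of one word in the other; only a word lying exactly on itself is
  allowed.\<close>

definition clash_free :: "'a list set \<Rightarrow> bool" where
  "clash_free S \<longleftrightarrow> (\<forall>P\<in>S. \<forall>Q\<in>S. \<forall>r<length P.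
     Sublist.prefix (drop r P) Q \<or> Sublist.prefix Q (drop r P) \<longrightarrow> r = 0 \<and> P = Q)"

lemma clash_free_subset: "clash_free S \<Longrightarrow> T \<subseteq> S \<Longrightarrow> clash_free T"
  unfolding clash_free_def by blast

lemma clash_free_omega:
  assumes "clash_free S" "P \<in> S" "Q \<in> S" "omega_prefix P y" "omega_prefix Q (wdrop j y)" "j < length P"
  shows "j = 0" "P = Q"
proof -
  obtain z where z: "y = P \<frown> z" using assms(4) unfolding omega_prefix_def by blast
  have 1: "omega_prefix Q (drop j P \<frown> z)" using assms(5,6) z by simp
  have 2: "omega_prefix (drop j P) (drop j P \<frown> z)" by simp
  have "Sublist.prefix (drop j P) Q \<or> Sublist.prefix Q (drop j P)"
    using omega_prefix_comparable[OF 1 2] omega_prefix_comparable[OF 2 1] by linarith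
  then show "j = 0" "P = Q" using assms(1,2,3,6) unfolding clash_free_def by blast+
qed

definition occurs :: "'a list \<Rightarrow> 'a word \<Rightarrow> bool" where
  "occurs P y \<longleftrightarrow> (\<exists>j. omega_prefix P (wdrop j y))"

text \<open>The equation moves any position beyond \<open>v\<close> back by \<open>length v\<close>,
  so induction on the position applies.\<close>

lemma iter_unique:
  assumes v: "v \<noteq> []" and y: "y = v \<frown> y" shows "y = v\<^sup>\<omega>"
proof
  fix i
  show "y i = (v\<^sup>\<omega>) i"
  proof (induction i rule: less_induct)
    case (less i)
    show ?case
    proof (cases "i < length v")
      case True
      then have "y i = v ! i" by (subst y) simp
      then show ?thesis using True v by simp
    next
      case False
      then have "y i = y (i - length v)" by (subst y) simp
      also have "\<dots> = (v\<^sup>\<omega>) (i - length v)" using False v by (intro less diff_length_less)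
      also have "\<dots> = (v\<^sup>\<omega>) i" using False v by (simp add: le_mod_geq)
      finally show ?thesis .
    qed
  qed
qed

lemma iter_eq: "v \<noteq> [] \<Longrightarrow> v \<frown> v\<^sup>\<omega> = v\<^sup>\<omega>"
  using iter_unroll[of v] by simp

lemma wdrop_iter: "v \<noteq> [] \<Longrightarrow> wdrop (j + length v) (v\<^sup>\<omega>) = wdrop j (v\<^sup>\<omega>)"
proof
  fix i assume v: "v \<noteq> []"
  have "(j + length v + i) mod length v = (j + i + length v) mod length v" by (simp add: ac_simps)
  also have "\<dots> = (j + i) mod length v" by simp
  finally show "wdrop (j + length v) (v\<^sup>\<omega>) i = wdrop j (v\<^sup>\<omega>) i" using v by simp
qed

lemma wdrop_iter_mod: "v \<noteq> [] \<Longrightarrow> wdrop (j mod length v) (v\<^sup>\<omega>) = wdrop j (v\<^sup>\<omega>)"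
  by (auto simp: fun_eq_iff mod_add_left_eq)

text \<open>A word longer than the period would overlap its own translate by one period.\<close>

lemma occurs_iter_length:
  assumes "clash_free S" "P \<in> S" "v \<noteq> []" "occurs P (v\<^sup>\<omega>)" shows "length P \<le> length v"
proof (rule ccontr)
  assume "\<not> ?thesis"
  obtain j where j: "omega_prefix P (wdrop j (v\<^sup>\<omega>))" using assms(4) unfolding occurs_def by blast
  then have "omega_prefix P (wdrop (length v) (wdrop j (v\<^sup>\<omega>)))"
    using wdrop_iter[OF assms(3), of j] by simp
  from clash_free_omega(1)[OF assms(1,2,2) j this] \<open>\<not> ?thesis\<close> show False using assms(3) by simp
qed

text \<open>Modulo the period the occurrence of \<open>Q\<close> starts inside the first copy of
  \<open>P\<close>, where clash-freeness leaves no room for another word.\<close>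

lemma occurs_iter_other:
  assumes S: "clash_free S" "P \<in> S" "Q \<in> S" and ne: "P \<noteq> []" and occ: "occurs Q (P\<^sup>\<omega>)" shows "P = Q"
proof -
  obtain j where "omega_prefix Q (wdrop j (P\<^sup>\<omega>))" using occ unfolding occurs_def by blast
  then have "omega_prefix Q (wdrop (j mod length P) (P\<^sup>\<omega>))" by (simp only: wdrop_iter_mod[OF ne])
  moreover have "omega_prefix P (P\<^sup>\<omega>)" using iter_eq[OF ne] omega_prefix_conc by metis
  moreover have "j mod length P < length P" using ne by simp
  ultimately show ?thesis using clash_free_omega(2)[OF S] by blast
qed

lemma occurs_conc: "occurs P x \<Longrightarrow> occurs P (u \<frown> x)"
proof -
  assume "occurs P x"
  then obtain j where "omega_prefix P (wdrop j x)" unfolding occurs_def by blast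
  moreover have "wdrop (length u + j) (u \<frown> x) = wdrop j x" by simp
  ultimately show ?thesis unfolding occurs_def by metis
qed

text \<open>For a clash-free pair the greedy parse is the only possible one.\<close>

function swap :: "'a list \<Rightarrow> 'a list \<Rightarrow> 'a word \<Rightarrow> 'a word" where
  "swap A B x i =
     (if A = [] \<or> B = [] then x i
      else if omega_prefix A x then
        (if i < length B then B ! i else swap A B (wdrop (length A) x) (i - length B))
      else if omega_prefix B x then
        (if i < length A then A ! i else swap A B (wdrop (length B) x) (i - length A))
      else if i = 0 then x 0 else swap A B (wdrop 1 x) (i - 1))"
  by pat_completeness auto
termination by (relation "measure (\<lambda>(A, B, x, i). i)") (auto intro: diff_length_less)

declare swap.simps [simp del]

text \<open>The finite counterpart of \<open>swap\<close>; it describes the output on an initial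
  word only if no block straddles its end, see \<open>swap_cut\<close>.\<close>

function swap_list :: "'a list \<Rightarrow> 'a list \<Rightarrow> 'a list \<Rightarrow> 'a list" where
  "swap_list A B u =
     (if u = [] \<or> A = [] \<or> B = [] then u
      else if Sublist.prefix A u then B @ swap_list A B (drop (length A) u)
      else if Sublist.prefix B u then A @ swap_list A B (drop (length B) u)
      else hd u # swap_list A B (tl u))"
  by pat_completeness auto
termination by (relation "measure (\<lambda>(A, B, u). length u)") auto

declare swap_list.simps [simp del]

locale swap_pair = alphabet +
  fixes A B :: "nat list"
  assumes AW: "A \<in> W" and BW: "B \<in> W" and cf: "clash_free {A, B}" and AB: "A \<noteq> B"
begin

abbreviation \<phi> :: "nat word \<Rightarrow> nat word" where "\<phi> \<equiv> swap A B"
abbreviation \<rho> :: "nat list \<Rightarrow> nat list" where "\<rho> \<equiv> swap_list A B"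

text \<open>An empty block would be a prefix of the other one, and clash-freeness at offset 0 would
  make the two equal.\<close>

lemma nonempty [simp]: "A \<noteq> []" "B \<noteq> []" "length A \<noteq> 0" "length B \<noteq> 0" "0 < length A" "0 < length B"
proof -
  have c: "P = Q" if "P \<in> {A, B}" "Q \<in> {A, B}" "0 < length P" "Sublist.prefix Q P" for P Q
    using cf that unfolding clash_free_def by (metis drop0)
  have "A \<noteq> [] \<and> B \<noteq> []"
    using c[of A B] c[of B A] AB by (cases "A = []"; cases "B = []") simp_all
  then show "A \<noteq> []" "B \<noteq> []" "length A \<noteq> 0" "length B \<noteq> 0" "0 < length A" "0 < length B" by auto
qed

lemma clash:
  assumes "P \<in> {A, B}" "Q \<in> {A, B}" "omega_prefix P y" "omega_prefix Q (wdrop j y)" "j < length P"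
  shows "j = 0 \<and> P = Q"
  using clash_free_omega[OF cf assms] by blast

lemma not_both: "omega_prefix A x \<Longrightarrow> \<not> omega_prefix B x"
  using clash[of A B x 0] AB by auto

lemma swap_A: "\<phi> (A \<frown> x) = B \<frown> \<phi> x"
proof
  fix i show "\<phi> (A \<frown> x) i = (B \<frown> \<phi> x) i"
    by (cases "i < length B") (simp_all add: swap.simps[of A B "A \<frown> x" i])
qed

lemma swap_B: "\<phi> (B \<frown> x) = A \<frown> \<phi> x"
proof -
  have "\<not> omega_prefix A (B \<frown> x)" using not_both[of "B \<frown> x"] by auto
  then have "\<phi> (B \<frown> x) i = (A \<frown> \<phi> x) i" for i
    by (cases "i < length A") (simp_all add: swap.simps[of A B "B \<frown> x" i])
  then show ?thesis by blast
qed

lemma swap_other: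
  assumes "\<not> omega_prefix A x" "\<not> omega_prefix B x"
  shows "\<phi> x = [x 0] \<frown> \<phi> (wdrop 1 x)"
proof
  fix i show "\<phi> x i = ([x 0] \<frown> \<phi> (wdrop 1 x)) i"
    using assms by (subst swap.simps) (cases i, simp_all)
qed

lemma swap_cases:
  obtains (A) y where "x = A \<frown> y" | (B) y where "x = B \<frown> y"
  | (other) "\<not> omega_prefix A x" "\<not> omega_prefix B x"
  unfolding omega_prefix_def by blast

lemma swap_in_I: "x \<in> I \<Longrightarrow> \<phi> x \<in> I"
proof -
  assume "x \<in> I"
  then have "\<phi> x i < n" for i
  proof (induction i arbitrary: x rule: less_induct)
    case (less i)
    show ?case
    proof (cases rule: swap_cases[of x])
      case (A y)
      have "B ! i < n" if "i < length B" using BW that by (metis in_lists_conv_set lessThan_iff nth_mem)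
      then show ?thesis
        using less.IH[OF diff_length_less[OF nonempty(2)], of y] less.prems unfolding A swap_A
        by (cases "i < length B") simp_all
    next
      case (B y)
      have "A ! i < n" if "i < length A" using AW that by (metis in_lists_conv_set lessThan_iff nth_mem)
      then show ?thesis
        using less.IH[OF diff_length_less[OF nonempty(1)], of y] less.prems unfolding B swap_B
        by (cases "i < length A") simp_all
    next
      case other
      have "x 0 < n" using less.prems by (simp add: inf_words_eq)
      moreover have "\<phi> (wdrop 1 x) (i - 1) < n" if "i \<noteq> 0"
        using that by (intro less.IH wdrop_in_inf_words less.prems) simp
      ultimately show ?thesis unfolding swap_other[OF other] by (cases "i = 0") simp_all
    qed
  qed
  then show ?thesis by (simp add: inf_words_eq)
qed

lemma swap_skip:
  assumes "\<And>j Q. j < k \<Longrightarrow> Q \<in> {A, B} \<Longrightarrow> \<not> omega_prefix Q (wdrop j x)"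
  shows "\<phi> x = wtake k x \<frown> \<phi> (wdrop k x)"
  using assms
proof (induction k arbitrary: x)
  case (Suc k)
  have 0: "\<not> omega_prefix A x" "\<not> omega_prefix B x" using Suc.prems[of 0] by auto
  have "\<not> omega_prefix Q (wdrop j (wdrop 1 x))" if "j < k" "Q \<in> {A, B}" for j Q
  proof -
    have "\<not> omega_prefix Q (wdrop (1 + j) x)" by (rule Suc.prems) (use that in simp_all)
    then show ?thesis by (simp only: suffix_suffix) simp
  qed
  then have "\<phi> (wdrop 1 x) = wtake k (wdrop 1 x) \<frown> \<phi> (wdrop k (wdrop 1 x))" by (rule Suc.IH)
  then have "\<phi> x = [x 0] \<frown> (wtake k (wdrop 1 x) \<frown> \<phi> (wdrop k (wdrop 1 x)))"
    by (simp only: swap_other[OF 0])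
  also have "\<dots> = ([x 0] @ wtake k (wdrop 1 x)) \<frown> \<phi> (wdrop k (wdrop 1 x))" by (simp only: conc_conc)
  also have "[x 0] @ wtake k (wdrop 1 x) = wtake (1 + k) x" unfolding wtake_add by simp
  also have "wdrop k (wdrop 1 x) = wdrop (1 + k) x" by (rule suffix_suffix)
  finally show ?case by (simp only: plus_1_eq_Suc)
qed simp

text \<open>If no block starts within the first \<open>length P\<close> letters, these letters are
  unchanged. Otherwise the first block, at \<open>j > 0\<close>, is replaced by a block at the same
  place \<open>j\<close> of the output, which would overlap \<open>P\<close>.\<close>

lemma swap_no_new:
  assumes x: "\<not> omega_prefix A x" "\<not> omega_prefix B x" and P: "P \<in> {A, B}"
  shows "\<not> omega_prefix P (\<phi> x)"
proof
  assume pre: "omega_prefix P (\<phi> x)"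
  show False
  proof (cases "\<exists>j<length P. \<exists>Q\<in>{A, B}. omega_prefix Q (wdrop j x)")
    case False
    then have "\<phi> x = wtake (length P) x \<frown> \<phi> (wdrop (length P) x)" by (intro swap_skip) blast
    then have "omega_prefix (wtake (length P) x) (\<phi> x)" by (metis omega_prefix_conc)
    then have "Sublist.prefix P (wtake (length P) x)" using omega_prefix_comparable[OF pre] by simp
    then obtain zs where zs: "wtake (length P) x = P @ zs" by (auto simp: prefix_def)
    from arg_cong[OF this, of length] have "zs = []" by simp
    then have "P = wtake (length P) x" using zs by simp
    then have "omega_prefix P x" by (metis omega_prefix_conc prefix_suffix)
    then show False using x P by auto
  next
    case True
    define j where "j = (LEAST j. \<exists>Q\<in>{A, B}. omega_prefix Q (wdrop j x))"
    have "\<exists>Q\<in>{A, B}. omega_prefix Q (wdrop j x)" unfolding j_def by (rule LeastI_ex) (use True in blast)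
    then obtain Q where Q: "Q \<in> {A, B}" "omega_prefix Q (wdrop j x)" by blast
    obtain j' where j': "j' < length P" "\<exists>Q\<in>{A, B}. omega_prefix Q (wdrop j' x)" using True by blast
    have "j \<le> j'" unfolding j_def by (rule Least_le) (rule j'(2))
    then have jP: "j < length P" using j'(1) by simp
    have "\<phi> x = wtake j x \<frown> \<phi> (wdrop j x)"
      by (rule swap_skip) (use not_less_Least in \<open>unfold j_def, blast\<close>)
    then have "wdrop j (\<phi> x) = wdrop j (wtake j x \<frown> \<phi> (wdrop j x))" by (rule arg_cong)
    then have d: "wdrop j (\<phi> x) = \<phi> (wdrop j x)" by (simp only: wdrop_length_conc subsequence_length diff_zero)
    have "\<exists>Q'\<in>{A, B}. omega_prefix Q' (\<phi> (wdrop j x))"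
    proof (cases "Q = A")
      case True
      then obtain z where "wdrop j x = A \<frown> z" using Q(2) unfolding omega_prefix_def by blast
      then show ?thesis by (simp add: swap_A)
    next
      case False
      then obtain z where "wdrop j x = B \<frown> z" using Q unfolding omega_prefix_def by blast
      then show ?thesis by (simp add: swap_B)
    qed
    then obtain Q' where "Q' \<in> {A, B}" "omega_prefix Q' (wdrop j (\<phi> x))" unfolding d by blast
    then have "j = 0" using clash[OF P _ pre] jP by blast
    then show False using Q x by auto
  qed
qed

text \<open>The output parses like the input: exchanged blocks are recognized again, and
  \<open>swap_no_new\<close> prevents additional ones.\<close>

lemma swap_swap: "\<phi> (\<phi> x) = x"
proof
  fix i show "\<phi> (\<phi> x) i = x i"
  proof (induction i arbitrary: x rule: less_induct)
    case (less i)
    show ?case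
    proof (cases rule: swap_cases[of x])
      case (A y)
      show ?thesis using less[OF diff_length_less[OF nonempty(1)], of y] unfolding A swap_A swap_B
        by (cases "i < length A") simp_all
    next
      case (B y)
      show ?thesis using less[OF diff_length_less[OF nonempty(2)], of y] unfolding B swap_A swap_B
        by (cases "i < length B") simp_all
    next
      case other
      have "\<phi> (\<phi> x) = [\<phi> x 0] \<frown> \<phi> (wdrop 1 (\<phi> x))"
        by (rule swap_other) (use swap_no_new[OF other] in simp_all)
      also have "\<phi> x 0 = x 0" unfolding swap_other[OF other] by simp
      also have "wdrop 1 (\<phi> x) = \<phi> (wdrop 1 x)" unfolding swap_other[OF other] by simp
      finally have eq: "\<phi> (\<phi> x) = [x 0] \<frown> \<phi> (\<phi> (wdrop 1 x))" .
      have "\<phi> (\<phi> (wdrop 1 x)) (i - 1) = wdrop 1 x (i - 1)" if "i \<noteq> 0"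
        using that by (intro less) simp
      then show ?thesis unfolding eq by (cases "i = 0") simp_all
    qed
  qed
qed

section \<open>Continuity and synchronization of the interchange\<close>

definition M :: nat where "M = max (length A) (length B)"

text \<open>Each unfolding of the recursion looks at no more than \<open>M\<close> letters and
  settles at least one letter of the output.\<close>

lemma swap_agree: "agree (Suc i * M) x y \<Longrightarrow> \<phi> x i = \<phi> y i"
proof (induction i arbitrary: x y rule: less_induct)
  case (less i)
  have Mi: "M \<le> Suc i * M" by simp
  have pre: "omega_prefix Q x \<longleftrightarrow> omega_prefix Q y" if "length Q \<le> M" for Q
    using less.prems that Mi unfolding omega_prefix_iff agree_def by (metis le_trans order_less_le_trans)
  have rest: "agree (Suc (i - l) * M) (wdrop k x) (wdrop k y)" if "0 < l" "l \<le> i" "k \<le> M" for l k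
  proof -
    have "Suc (i - l) * M \<le> i * M" using that by (intro mult_le_mono1) simp
    then have "k + Suc (i - l) * M \<le> Suc i * M" using that by simp
    then show ?thesis using less.prems unfolding agree_def by simp
  qed
  have M1: "length A \<le> M" "length B \<le> M" "1 \<le> M" unfolding M_def using nonempty(5) by linarith+
  have A1: "\<phi> x i = \<phi> y i" if "omega_prefix A x"
  proof (cases "i < length B")
    case True
    then show ?thesis using that pre[OF M1(1)] by (subst (1 2) swap.simps) simp
  next
    case False
    then have "\<phi> (wdrop (length A) x) (i - length B) = \<phi> (wdrop (length A) y) (i - length B)"
      by (intro less.IH rest) (use M1 False diff_length_less[OF nonempty(1)] diff_length_less[OF nonempty(2)] in auto)
    then show ?thesis using that pre[OF M1(1)] False by (subst (1 2) swap.simps) simp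
  qed
  have B1: "\<phi> x i = \<phi> y i" if "\<not> omega_prefix A x" "omega_prefix B x"
  proof (cases "i < length A")
    case True
    then show ?thesis using that pre[OF M1(1)] pre[OF M1(2)] by (subst (1 2) swap.simps) simp
  next
    case False
    then have "\<phi> (wdrop (length B) x) (i - length A) = \<phi> (wdrop (length B) y) (i - length A)"
      by (intro less.IH rest) (use M1 False diff_length_less[OF nonempty(1)] diff_length_less[OF nonempty(2)] in auto)
    then show ?thesis using that pre[OF M1(1)] pre[OF M1(2)] False by (subst (1 2) swap.simps) simp
  qed
  have "\<phi> x i = \<phi> y i" if o: "\<not> omega_prefix A x" "\<not> omega_prefix B x"
  proof (cases "i = 0")
    case True
    have "x 0 = y 0" using less.prems M1(3) unfolding agree_def by (metis Mi less_le_trans zero_less_one)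
    then show ?thesis using o pre[OF M1(1)] pre[OF M1(2)] True by (subst (1 2) swap.simps) simp
  next
    case False
    then have "\<phi> (wdrop 1 x) (i - 1) = \<phi> (wdrop 1 y) (i - 1)"
      by (intro less.IH rest) (use M1 False diff_length_less[OF nonempty(1)] diff_length_less[OF nonempty(2)] in auto)
    then show ?thesis using o pre[OF M1(1)] pre[OF M1(2)] False by (subst (1 2) swap.simps) simp
  qed
  then show ?case using A1 B1 by blast
qed

lemma good_swap: "good \<phi>"
  unfolding good_def ucont_def
proof (intro conjI allI)
  show "\<phi> \<in> I \<rightarrow> I" using swap_in_I by blast
  show "inj_on \<phi> I" by (rule inj_onI) (metis swap_swap)
  fix m
  show "\<exists>k. \<forall>x\<in>I. \<forall>y\<in>I. agree k x y \<longrightarrow> agree m (\<phi> x) (\<phi> y)"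
  proof (intro exI[of _ "m * M"] ballI impI)
    fix x y :: "nat word" assume a: "agree (m * M) x y"
    show "agree m (\<phi> x) (\<phi> y)" unfolding agree_def
    proof (intro allI impI)
      fix i assume "i < m"
      then have "Suc i * M \<le> m * M" by (intro mult_le_mono1) simp
      then show "\<phi> x i = \<phi> y i" using swap_agree agree_mono[OF a] by blast
    qed
  qed
qed

text \<open>No block straddles position \<open>k\<close>, so the parse may be broken there.\<close>

definition cut :: "nat word \<Rightarrow> nat \<Rightarrow> bool" where
  "cut y k \<longleftrightarrow> (\<forall>j<k. \<forall>P\<in>{A, B}. omega_prefix P (wdrop j y) \<longrightarrow> j + length P \<le> k)"

lemma cutD: "cut y k \<Longrightarrow> j < k \<Longrightarrow> P \<in> {A, B} \<Longrightarrow> omega_prefix P (wdrop j y) \<Longrightarrow> j + length P \<le> k"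
  unfolding cut_def by blast

lemma cut_drop: "cut y k \<Longrightarrow> s \<le> k \<Longrightarrow> cut (wdrop s y) (k - s)"
  unfolding cut_def
proof (intro allI impI ballI)
  fix j P assume a: "\<forall>j<k. \<forall>P\<in>{A, B}. omega_prefix P (wdrop j y) \<longrightarrow> j + length P \<le> k" "s \<le> k"
    "j < k - s" "P \<in> {A, B}" "omega_prefix P (wdrop j (wdrop s y))"
  then have "s + j < k" "omega_prefix P (wdrop (s + j) y)" by simp_all
  then have "s + j + length P \<le> k" using a(1,4) by blast
  then show "j + length P \<le> k - s" by simp
qed

text \<open>A block straddling the end of \<open>Q\<close> would overlap \<open>Q\<close>, whichever
  of the two starts first.\<close>

lemma cut_after:
  assumes "Q \<in> {A, B}" "omega_prefix Q (wdrop j y)" shows "cut y (j + length Q)"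
  unfolding cut_def
proof (intro allI impI ballI, rule ccontr)
  fix i P assume i: "i < j + length Q" "P \<in> {A, B}" "omega_prefix P (wdrop i y)"
    and c: "\<not> i + length P \<le> j + length Q"
  show False
  proof (cases "j \<le> i")
    case True
    have "omega_prefix P (wdrop (i - j) (wdrop j y))" using i(3) True by simp
    moreover have "i - j < length Q" using i(1) True by linarith
    ultimately have "i - j = 0 \<and> Q = P" using clash[OF assms(1) i(2) assms(2)] by blast
    then show False using c True by simp
  next
    case False
    have "omega_prefix Q (wdrop (j - i) (wdrop i y))" using assms(2) False by simp
    moreover have "j - i < length P" using c False by linarith
    ultimately have "j - i = 0" using clash[OF i(2) assms(1) i(3)] by blast
    then show False using False by simp
  qed
qed

lemma cut_before:
  assumes "Q \<in> {A, B}" "omega_prefix Q (wdrop k y)" shows "cut y k"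
  unfolding cut_def
proof (intro allI impI ballI, rule ccontr)
  fix i P assume i: "i < k" "P \<in> {A, B}" "omega_prefix P (wdrop i y)" and c: "\<not> i + length P \<le> k"
  have "omega_prefix Q (wdrop (k - i) (wdrop i y))" using assms(2) i by simp
  moreover have "k - i < length P" using c i by linarith
  ultimately have "k - i = 0" using clash[OF i(2) assms(1) i(3)] by blast
  then show False using i by simp
qed

lemma swap_cut: "cut (u \<frown> x) (length u) \<Longrightarrow> \<phi> (u \<frown> x) = \<rho> u \<frown> \<phi> x"
proof (induction "length u" arbitrary: u rule: less_induct)
  case less
  show ?case
  proof (cases "u = []")
    case True
    then show ?thesis by (simp add: swap_list.simps)
  next
    case ne: False
    have pre: "omega_prefix P (u \<frown> x) \<longleftrightarrow> Sublist.prefix P u" if P: "P \<in> {A, B}" for P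
    proof
      assume a: "omega_prefix P (u \<frown> x)"
      then have "length P \<le> length u" using cutD[OF less.prems, of 0 P] P ne by simp
      then show "Sublist.prefix P u" using a omega_prefix_conc_iff by blast
    next
      assume "Sublist.prefix P u"
      then show "omega_prefix P (u \<frown> x)" using omega_prefix_mono omega_prefix_conc by blast
    qed
    have sub: "\<phi> (drop k u \<frown> x) = \<rho> (drop k u) \<frown> \<phi> x" if k: "0 < k" "k \<le> length u" for k
    proof (rule less.hyps)
      show "length (drop k u) < length u" using k ne by simp
      have "wdrop k (u \<frown> x) = drop k u \<frown> x" using k by simp
      then show "cut (drop k u \<frown> x) (length (drop k u))" using cut_drop[OF less.prems k(2)] by simp
    qed
    show ?thesis
    proof (cases "Sublist.prefix A u")
      case True
      then have u: "u = A @ drop (length A) u" by (auto simp: prefix_def)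
      then have "length A \<le> length u" by (metis length_append le_add1)
      then have "\<phi> (drop (length A) u \<frown> x) = \<rho> (drop (length A) u) \<frown> \<phi> x" by (intro sub) simp_all
      then have "\<phi> (A \<frown> (drop (length A) u \<frown> x)) = (B @ \<rho> (drop (length A) u)) \<frown> \<phi> x"
        unfolding swap_A by simp
      moreover have "\<rho> u = B @ \<rho> (drop (length A) u)" using ne True by (subst swap_list.simps) simp
      moreover have "A \<frown> (drop (length A) u \<frown> x) = u \<frown> x" using u by (metis conc_conc)
      ultimately show ?thesis by simp
    next
      case nA: False
      show ?thesis
      proof (cases "Sublist.prefix B u")
        case True
        then have u: "u = B @ drop (length B) u" by (auto simp: prefix_def)
        then have "length B \<le> length u" by (metis length_append le_add1)
        then have "\<phi> (drop (length B) u \<frown> x) = \<rho> (drop (length B) u) \<frown> \<phi> x" by (intro sub) simp_all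
        then have "\<phi> (B \<frown> (drop (length B) u \<frown> x)) = (A @ \<rho> (drop (length B) u)) \<frown> \<phi> x"
          unfolding swap_B by simp
        moreover have "\<rho> u = A @ \<rho> (drop (length B) u)" using ne nA True by (subst swap_list.simps) simp
        moreover have "B \<frown> (drop (length B) u \<frown> x) = u \<frown> x" using u by (metis conc_conc)
        ultimately show ?thesis by simp
      next
        case nB: False
        have "\<phi> (u \<frown> x) = [(u \<frown> x) 0] \<frown> \<phi> (wdrop 1 (u \<frown> x))"
          by (rule swap_other) (use pre nA nB in auto)
        also have "(u \<frown> x) 0 = hd u" using ne by (simp add: hd_conv_nth)
        also have "wdrop 1 (u \<frown> x) = drop 1 u \<frown> x" using ne by (simp add: Suc_le_eq)
        also have "\<phi> (drop 1 u \<frown> x) = \<rho> (drop 1 u) \<frown> \<phi> x" using ne by (intro sub) (simp_all add: Suc_le_eq)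
        also have "[hd u] \<frown> (\<rho> (drop 1 u) \<frown> \<phi> x) = (hd u # \<rho> (drop 1 u)) \<frown> \<phi> x" by simp
        also have "hd u # \<rho> (drop 1 u) = \<rho> u" using ne nA nB by (subst (2) swap_list.simps) (simp add: drop_Suc)
        finally show ?thesis .
      qed
    qed
  qed
qed

text \<open>If no block straddles the end of \<open>u\<close>, the parse restarts at
  \<open>w\<close>. Otherwise the straddling block ends inside \<open>w\<close>, and its end is a
  cut both for \<open>u @ w\<close> and for \<open>w\<close> alone, so both local actions equal the
  one at the rest of \<open>w\<close>.\<close>

lemma sync_swap: "sync M \<phi>"
  unfolding sync_def
proof (intro ballI impI)
  fix u w assume u: "u \<in> W" and w: "w \<in> W" "M \<le> length w"
  \<comment> \<open>As \<open>w\<close> has at least \<open>M\<close> letters, a block that starts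
    in \<open>u\<close> is visible in \<open>u @ w\<close>, independently of
    \<open>x\<close>.\<close>
  have pre: "omega_prefix P (wdrop j (u \<frown> (w \<frown> x))) \<longleftrightarrow> Sublist.prefix P (drop j (u @ w))"
    if "P \<in> {A, B}" "j < length u" for P j x
  proof -
    have "length P \<le> M" using that(1) by (auto simp: M_def)
    then have le: "length P \<le> length (drop j (u @ w))" using that w by simp
    have eq: "wdrop j (u \<frown> (w \<frown> x)) = drop j (u @ w) \<frown> x" using that by simp
    show ?thesis unfolding eq by (rule omega_prefix_conc_iff[OF le])
  qed
  show "loc \<phi> (u @ w) = loc \<phi> w"
  proof (cases "\<forall>j<length u. \<forall>P\<in>{A, B}. Sublist.prefix P (drop j (u @ w)) \<longrightarrow> j + length P \<le> length u")
    case True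
    have "\<phi> ((u @ w) \<frown> x) = \<rho> u \<frown> \<phi> (w \<frown> x)" for x
    proof -
      have "cut (u \<frown> (w \<frown> x)) (length u)" using True pre unfolding cut_def by blast
      from swap_cut[OF this] show ?thesis by simp
    qed
    then show ?thesis using loc_factor(2)[of "u @ w" \<phi> "\<rho> u" \<phi> w] good_swap u w by simp
  next
    case False
    then obtain j Q where j: "j < length u" and Q: "Q \<in> {A, B}" "Sublist.prefix Q (drop j (u @ w))"
      and str: "\<not> j + length Q \<le> length u" by blast
    \<comment> \<open>The number of letters of \<open>w\<close> covered by the straddling
      block.\<close>
    define i where "i = j + length Q - length u"
    have iw: "i \<le> length w" using Q(1) w j by (auto simp: i_def M_def)
    have k: "j + length Q = length u + i" using str by (simp add: i_def)
    let ?w0 = "take i w" and ?w1 = "drop i w"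
    have c: "cut ((u @ ?w0) \<frown> (?w1 \<frown> x)) (length u + i)" for x
    proof -
      have "(u @ ?w0) \<frown> (?w1 \<frown> x) = u \<frown> (w \<frown> x)" by simp
      then show ?thesis using cut_after[OF Q(1), of j "u \<frown> (w \<frown> x)"] pre[OF Q(1) j] Q(2) k by simp
    qed
    have "\<phi> ((u @ w) \<frown> x) = \<rho> (u @ ?w0) \<frown> \<phi> (?w1 \<frown> x)" for x
      using swap_cut[of "u @ ?w0" "?w1 \<frown> x"] c[of x] iw by (simp add: min_def)
    then have 1: "loc \<phi> (u @ w) = loc \<phi> ?w1"
      using loc_factor(2)[of "u @ w" \<phi> "\<rho> (u @ ?w0)" \<phi> ?w1] good_swap u w by simp
    have "\<phi> (w \<frown> x) = \<rho> ?w0 \<frown> \<phi> (?w1 \<frown> x)" for x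
    proof -
      have "cut (wdrop (length u) ((u @ ?w0) \<frown> (?w1 \<frown> x))) (length u + i - length u)"
        by (rule cut_drop[OF c]) simp
      moreover have "wdrop (length u) ((u @ ?w0) \<frown> (?w1 \<frown> x)) = ?w0 \<frown> (?w1 \<frown> x)" by simp
      ultimately have "cut (?w0 \<frown> (?w1 \<frown> x)) (length ?w0)" using iw by (simp add: min_def)
      from swap_cut[OF this] show ?thesis by simp
    qed
    then have "loc \<phi> w = loc \<phi> ?w1"
      using loc_factor(2)[of w \<phi> "\<rho> ?w0" \<phi> ?w1] good_swap w by simp
    with 1 show ?thesis by simp
  qed
qed

lemma spread_swap: "spread \<phi>"
  unfolding spread_def
  by (rule bexI[of _ "\<phi> (\<lambda>_. 0)"], rule bexI[of _ "\<phi> (\<lambda>_. Suc 0)"]) (simp_all add: swap_swap swap_in_I)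

lemma concat_replicate_in_lists: "v \<in> lists S \<Longrightarrow> concat (replicate k v) \<in> lists S"
  by (induction k) auto

lemma swap_power_A: "\<phi> (concat (replicate k A) \<frown> x) = concat (replicate k B) \<frown> \<phi> x"
proof (induction k)
  case (Suc k)
  have "\<phi> (concat (replicate (Suc k) A) \<frown> x) = \<phi> (A \<frown> (concat (replicate k A) \<frown> x))" by simp
  then show ?case unfolding swap_A Suc by simp
qed simp

lemma involution_swap: "involution \<phi>"
  unfolding involution_def synchronizing_def
proof (intro conjI ballI)
  show "good \<phi>" by (rule good_swap)
  show "\<exists>K. sync K \<phi>" using sync_swap by blast
  show "\<phi> (\<phi> x) = x" for x by (rule swap_swap)
  show "restrict \<phi> I \<in> recurrent \<phi>"
    unfolding recurrent_def
  proof (intro CollectI allI)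
    fix k
    let ?w = "concat (replicate k A)"
    have w: "?w \<in> W" by (rule concat_replicate_in_lists[OF AW])
    \<comment> \<open>After a power of \<open>A\<close> the parse restarts, so arbitrarily long
      words have the local action \<phi> itself.\<close>
    have "loc \<phi> ?w = restrict \<phi> I"
      by (rule loc_unique(2)[OF w swap_power_A spread_swap])
    moreover have "k \<le> length ?w" 
      using nonempty(1) by (simp add: length_concat sum_list_replicate Suc_le_eq)
    ultimately show "\<exists>w\<in>W. k \<le> length w \<and> loc \<phi> w = restrict \<phi> I" using w by blast
  qed
qed

lemma swap_iter_A: "\<phi> (A\<^sup>\<omega>) = B\<^sup>\<omega>"
  by (rule iter_unique) (use iter_eq[of A] swap_A[of "A\<^sup>\<omega>"] in simp_all)

lemma swap_fix:
  assumes "\<not> occurs A x" "\<not> occurs B x" shows "\<phi> x = x"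
proof
  fix i
  have "\<phi> x = wtake (Suc i) x \<frown> \<phi> (wdrop (Suc i) x)"
    by (rule swap_skip) (use assms in \<open>auto simp: occurs_def\<close>)
  then have "\<phi> x i = (wtake (Suc i) x \<frown> \<phi> (wdrop (Suc i) x)) i" by simp
  then show "\<phi> x i = x i" by (simp del: subseq_to_Suc)
qed

end

subsection \<open>Markers and the index\<close>

text \<open>Moving an occurrence by \<open>k\<close> whole periods puts it beyond position
  \<open>k\<close>.\<close>

lemma occurs_wdrop_iter:
  assumes "v \<noteq> []" "occurs P (v\<^sup>\<omega>)" shows "occurs P (wdrop k (v\<^sup>\<omega>))"
proof -
  obtain j where j: "omega_prefix P (wdrop j (v\<^sup>\<omega>))" using assms(2) unfolding occurs_def by blast
  have "wdrop (j + k * length v) (v\<^sup>\<omega>) = wdrop ((j + k * length v) mod length v) (v\<^sup>\<omega>)"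
    by (rule wdrop_iter_mod[OF assms(1), symmetric])
  also have "\<dots> = wdrop (j mod length v) (v\<^sup>\<omega>)" by simp
  also have "\<dots> = wdrop j (v\<^sup>\<omega>)" by (rule wdrop_iter_mod[OF assms(1)])
  finally have "omega_prefix P (wdrop (j + k * length v) (v\<^sup>\<omega>))" using j by simp
  moreover have "k \<le> j + k * length v" using assms(1) by (cases v) auto
  ultimately have "omega_prefix P (wdrop (j + k * length v - k) (wdrop k (v\<^sup>\<omega>)))" by simp
  then show ?thesis unfolding occurs_def by blast
qed

text \<open>The inner 1 and 0 close the two runs, so that the word begins with exactly
  \<open>N\<close> zeros and ends with exactly \<open>N\<close> ones whatever \<open>V\<close>
  is.\<close>

definition marked :: "nat \<Rightarrow> nat list \<Rightarrow> nat list" where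
  "marked N V = replicate N 0 @ 1 # V @ 0 # replicate N 1"

text \<open>The closing letters are included because a run inside \<open>V\<close> could otherwise
  be completed by them.\<close>

definition admissible :: "nat \<Rightarrow> nat list \<Rightarrow> bool" where
  "admissible N V \<longleftrightarrow> (\<forall>a. \<not> sublist (replicate N a) (1 # V @ [0]))"

lemma length_marked [simp]: "length (marked N V) = 2 * N + 2 + length V"
  by (simp add: marked_def)

lemma marked_ne_Nil [simp]: "marked N V \<noteq> []"
  by (simp add: marked_def)

lemma admissible_pos: "admissible N V \<Longrightarrow> 0 < N"
  unfolding admissible_def by (cases N) auto

lemma marked_nth:
  "i < N \<Longrightarrow> marked N V ! i = 0"
  "N \<le> i \<Longrightarrow> i < N + 2 + length V \<Longrightarrow> marked N V ! i = (1 # V @ [0]) ! (i - N)"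
  "N + 2 + length V \<le> i \<Longrightarrow> i < 2 * N + 2 + length V \<Longrightarrow> marked N V ! i = 1"
proof -
  have m: "marked N V = replicate N 0 @ (1 # V @ [0]) @ replicate N 1" by (simp add: marked_def)
  show "i < N \<Longrightarrow> marked N V ! i = 0" by (simp add: marked_def nth_append)
  show "N \<le> i \<Longrightarrow> i < N + 2 + length V \<Longrightarrow> marked N V ! i = (1 # V @ [0]) ! (i - N)"
    unfolding m by (subst nth_append, simp del: append.simps, subst nth_append) simp
  show "N + 2 + length V \<le> i \<Longrightarrow> i < 2 * N + 2 + length V \<Longrightarrow> marked N V ! i = 1"
    unfolding m by (subst nth_append, simp del: append.simps, subst nth_append) (simp add: nth_append)
qed

lemma run_sublist:
  assumes "r + N \<le> length u" "\<And>i. i < N \<Longrightarrow> u ! (r + i) = a"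
  shows "sublist (replicate N a) u"
proof -
  have "take N (drop r u) = replicate N a"
    using assms by (intro nth_equalityI) simp_all
  moreover have "u = take r u @ take N (drop r u) @ drop N (drop r u)" by (simp del: drop_drop)
  ultimately show ?thesis unfolding sublist_def by metis
qed

text \<open>A window of \<open>N\<close> letters that does not start at 0 contains the 1 at position
  \<open>N\<close>, or ends among the final ones, or lies inside \<open>1 # V @ [0]\<close>.\<close>

lemma marked_no_zero_run:
  assumes ok: "admissible N V" and r: "0 < r" "r + N \<le> length (marked N V)"
  shows "\<exists>i<N. marked N V ! (r + i) \<noteq> 0"
proof (rule ccontr)
  assume "\<not> ?thesis"
  then have z: "\<And>i. i < N \<Longrightarrow> marked N V ! (r + i) = 0" by blast
  have N: "0 < N" using ok by (rule admissible_pos)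
  consider "r \<le> N" | "N < r" "N + length V + 2 < r + N" | "N < r" "r + N \<le> N + length V + 2" by linarith
  then show False
  proof cases
    case 1
    then have "marked N V ! (r + (N - r)) = 0" using r by (intro z) simp
    then show False using 1 marked_nth(2)[of N N V] by simp
  next
    case 2
    have "marked N V ! (r + (N - 1)) = 0" using N by (intro z) simp
    moreover have "marked N V ! (r + (N - 1)) = 1" using 2 N r by (intro marked_nth(3)) simp_all
    ultimately show False by simp
  next
    case 3
    have "sublist (replicate N 0) (1 # V @ [0])"
    proof (rule run_sublist[of "r - N"])
      show "r - N + N \<le> length (1 # V @ [0])" using 3 by simp
      fix i assume i: "i < N"
      have "marked N V ! (r + i) = (1 # V @ [0]) ! (r + i - N)" using 3 i by (intro marked_nth(2)) simp_all
      then show "(1 # V @ [0]) ! (r - N + i) = 0" using z[OF i] 3 by simp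
    qed
    then show False using ok unfolding admissible_def by blast
  qed
qed

text \<open>The mirror image of \<open>marked_no_zero_run\<close>; the strict inequality exempts the
  final run itself.\<close>

lemma marked_no_one_run:
  assumes ok: "admissible N V" and r: "r + N < length (marked N V)"
  shows "\<exists>i<N. marked N V ! (r + i) \<noteq> 1"
proof (rule ccontr)
  assume "\<not> ?thesis"
  then have z: "\<And>i. i < N \<Longrightarrow> marked N V ! (r + i) = 1" by blast
  have N: "0 < N" using ok by (rule admissible_pos)
  consider "r < N" | "N + 1 + length V < r + N" | "N \<le> r" "r + N \<le> N + 1 + length V" by linarith
  then show False
  proof cases
    case 1
    then show False using z[of 0] N marked_nth(1)[of r N V] by simp
  next
    case 2
    have "marked N V ! (r + (N + 1 + length V - r)) = 1" using 2 r by (intro z) simp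
    moreover have "marked N V ! (N + 1 + length V) = 0" using marked_nth(2)[of N "N + 1 + length V" V] by simp
    ultimately show False using r by simp
  next
    case 3
    have "sublist (replicate N 1) (1 # V @ [0])"
    proof (rule run_sublist[of "r - N"])
      show "r - N + N \<le> length (1 # V @ [0])" using 3 by simp
      fix i assume i: "i < N"
      have "marked N V ! (r + i) = (1 # V @ [0]) ! (r + i - N)" using 3 i by (intro marked_nth(2)) simp_all
      then show "(1 # V @ [0]) ! (r - N + i) = 1" using z[OF i] 3 by simp
    qed
    then show False using ok unfolding admissible_def by blast
  qed
qed

lemma prefix_nth: "Sublist.prefix u v \<Longrightarrow> i < length u \<Longrightarrow> u ! i = v ! i"
  by (auto simp: prefix_def nth_append)

text \<open>A shorter marker as a prefix would put its final \<open>N\<close> ones before the end of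
  the longer marker.\<close>

lemma marked_prefix_eq:
  assumes V: "admissible N V" and pre: "Sublist.prefix (marked N U) (marked N V)"
  shows "marked N U = marked N V"
proof -
  have le: "length U \<le> length V" using prefix_length_le[OF pre] by simp
  have "\<not> length U < length V"
  proof
    assume lt: "length U < length V"
    obtain i where i: "i < N" "marked N V ! (N + 2 + length U + i) \<noteq> 1"
      using marked_no_one_run[OF V, of "N + 2 + length U"] lt by auto
    have "marked N U ! (N + 2 + length U + i) = 1" using i(1) by (intro marked_nth(3)) simp_all
    moreover have "marked N U ! (N + 2 + length U + i) = marked N V ! (N + 2 + length U + i)"
      using i(1) by (intro prefix_nth[OF pre]) simp
    ultimately show False using i(2) by simp
  qed
  then have "length (marked N U) = length (marked N V)" using le by simp
  then show ?thesis using pre by (metis append_eq_conv_conj prefix_def take_all_iff order_refl)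
qed

text \<open>In a short overlap a final 1 of \<open>P\<close> meets an initial 0 of \<open>Q\<close>;
  in a longer one the \<open>N\<close> initial zeros of \<open>Q\<close> would appear in
  \<open>P\<close> at a positive offset. Offset 0 is left to
  \<open>marked_prefix_eq\<close>.\<close>

lemma clash_free_marked: "clash_free {marked N V | V. admissible N V}"
  unfolding clash_free_def
proof (intro ballI allI impI)
  fix P Q r assume "P \<in> {marked N V | V. admissible N V}" "Q \<in> {marked N V | V. admissible N V}"
    and r: "r < length P" and c: "Sublist.prefix (drop r P) Q \<or> Sublist.prefix Q (drop r P)"
  then obtain V U where P: "P = marked N V" and V: "admissible N V" and Q: "Q = marked N U" and U: "admissible N U" by blast
  have N: "0 < N" using V by (rule admissible_pos)
  have eq: "P ! (r + i) = Q ! i" if "i < length P - r" "i < length Q" for i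
    using c
  proof
    assume "Sublist.prefix (drop r P) Q"
    from prefix_nth[OF this, of i] show ?thesis using that r by simp
  next
    assume "Sublist.prefix Q (drop r P)"
    from prefix_nth[OF this, of i] show ?thesis using that r by simp
  qed
  have "r = 0"
  proof (rule ccontr)
    assume r0: "r \<noteq> 0"
    show False
    proof (cases "length P - r \<le> N")
      case True
      have "P ! (r + (length P - r - 1)) = Q ! (length P - r - 1)"
        using r True by (intro eq) (simp_all add: Q)
      moreover have "Q ! (length P - r - 1) = 0" unfolding Q using r True by (intro marked_nth(1)) simp
      moreover have "P ! (r + (length P - r - 1)) = 1" unfolding P using r N by (intro marked_nth(3)) (simp_all add: P)
      ultimately show False by simp
    next
      case False
      then have "r + N \<le> length (marked N V)" using r unfolding P by linarith
      then obtain i where i: "i < N" "P ! (r + i) \<noteq> 0"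
        using marked_no_zero_run[OF V, of r] r0 unfolding P by blast
      moreover have "P ! (r + i) = Q ! i" using False i by (intro eq) (simp_all add: Q)
      moreover have "Q ! i = 0" unfolding Q using i by (intro marked_nth(1))
      ultimately show False by simp
    qed
  qed
  moreover from this have "P = Q" using c marked_prefix_eq[OF V, of U] marked_prefix_eq[OF U, of V] unfolding P Q by auto
  ultimately show "r = 0 \<and> P = Q" by blast
qed

lemma marked_inj: "marked N V = marked N U \<longleftrightarrow> V = U"
proof
  assume e: "marked N V = marked N U"
  from arg_cong[OF e, of length] have "length V = length U" by simp
  then show "V = U" using e by (simp add: marked_def)
qed simp

text \<open>A run of \<open>N\<close> letters would fill all of \<open>1 # V @ [0]\<close>, which
  begins with 1 and ends with 0.\<close>

lemma admissible_short: "length V + 2 \<le> N \<Longrightarrow> admissible N V"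
  unfolding admissible_def
proof (intro allI notI)
  fix a assume le: "length V + 2 \<le> N" and s: "sublist (replicate N a) (1 # V @ [0])"
  from sublist_length_le[OF s] have N: "N = length V + 2" using le by simp
  obtain ps ss where e: "1 # V @ [0] = ps @ replicate N a @ ss" using s unfolding sublist_def by blast
  from arg_cong[OF e, of length] have "ps = []" "ss = []" using N by simp_all
  then have e': "1 # V @ [0] = replicate N a" using e by simp
  have "a = 1" using arg_cong[OF e', of hd] N by simp
  moreover have "a = 0" using arg_cong[OF e', of last] N by (simp add: last_replicate split: if_splits)
  ultimately show False by simp
qed

text \<open>Placed between 1 and 0 this word continues the alternation, which yields admissible
  words of unbounded length for a fixed \<open>N\<close>.\<close>

definition alternating :: "nat \<Rightarrow> nat list" where
  "alternating m = map (\<lambda>i. i mod 2) [0..<2 * m]"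

lemma length_alternating [simp]: "length (alternating m) = 2 * m"
  by (simp add: alternating_def)

lemma admissible_alternating:
  assumes N: "2 \<le> N" shows "admissible N (alternating m)"
  unfolding admissible_def
proof (intro allI notI)
  fix a assume s: "sublist (replicate N a) (1 # alternating m @ [0])"
  have nth: "(1 # alternating m @ [0]) ! i = Suc i mod 2" if "i < 2 * m + 2" for i
  proof (cases i)
    case (Suc j)
    then have "j < 2 * m \<or> j = 2 * m" using that by linarith
    then show ?thesis using Suc by (auto simp: alternating_def nth_append mod_Suc_Suc_eq)
  qed simp
  obtain ps ss where e: "1 # alternating m @ [0] = ps @ replicate N a @ ss" using s unfolding sublist_def by blast
  from arg_cong[OF e, of length] have l: "length ps + 1 < 2 * m + 2" using N by simp
  have "(1 # alternating m @ [0]) ! length ps = a" "(1 # alternating m @ [0]) ! (length ps + 1) = a"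
    unfolding e using N by (simp_all add: nth_append)
  then have "Suc (length ps) mod 2 = Suc (length ps + 1) mod 2"
    using nth[of "length ps"] nth[of "length ps + 1"] l by linarith
  then show False by presburger
qed

context alphabet
begin

lemma marked_in_W: "V \<in> W \<Longrightarrow> marked N V \<in> W"
  by (simp add: marked_def)

lemma alternating_in_W: "alternating m \<in> W"
  using n2 by (auto simp: alternating_def in_lists_conv_set)

lemma swap_pair_marked:
  assumes "V \<in> W" "U \<in> W" "admissible N V" "admissible N U" "V \<noteq> U"
  shows "swap_pair n (marked N V) (marked N U)"
proof
  show "marked N V \<in> W" "marked N U \<in> W" using assms marked_in_W by auto
  show "clash_free {marked N V, marked N U}"
    by (rule clash_free_subset[OF clash_free_marked[of N]]) (use assms in auto)
  show "marked N V \<noteq> marked N U" using assms marked_inj by blast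
qed

lemma occurs_tail_iter:
  assumes "u \<noteq> []" "occurs P (u\<^sup>\<omega>)" "u\<^sup>\<omega> \<sim> x" shows "occurs P x"
proof -
  obtain i j where ij: "wdrop i (u\<^sup>\<omega>) = wdrop j x" using assms(3) unfolding tail_equiv_iff_wdrop by blast
  have "occurs P (wdrop j x)" using occurs_wdrop_iter[OF assms(1,2), of i] ij by simp
  then have "occurs P (wtake j x \<frown> wdrop j x)" by (rule occurs_conc)
  then show ?thesis by simp
qed

text \<open>\<open>w\<close> commutes with its power \<open>?v\<close>, and the state forced by that
  power is therefore fixed by \<open>w\<close>.\<close>

lemma forced_loop:
  assumes T: "transducer n T" and k: "sync_level n T k" and w: "w \<in> W" "w \<noteq> []"
  shows "\<exists>q\<in>states T. steps T w q = q"
proof -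
  obtain p where p: "p \<in> states T" using T by (auto simp: transducer_def)
  let ?v = "concat (replicate k w)"
  have v: "?v \<in> W" using w(1) by (induction k) auto
  have lv: "k \<le> length ?v" using w(2) by (simp add: length_concat sum_list_replicate Suc_le_eq)
  have "concat (replicate k w) @ w = w @ concat (replicate k w)"
    by (induction k) auto
  then have "steps T w (steps T ?v p) = steps T ?v (steps T w p)" by (metis steps_append)
  also have "\<dots> = steps T ?v p" by (rule sync_level_mono[OF k lv v T steps_in_states[OF T w(1) p] p])
  finally show ?thesis using steps_in_states[OF T v p] by blast
qed

lemma state_map_iter:
  assumes T: "transducer n T" and q: "q \<in> states T" "steps T w q = q" and w: "w \<in> W" "w \<noteq> []"
  shows "state_map T q (w\<^sup>\<omega>) = (outs T w q)\<^sup>\<omega>" "outs T w q \<noteq> []"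
proof -
  show ne: "outs T w q \<noteq> []" using T q w unfolding transducer_def by blast
  have "state_map T q (w \<frown> w\<^sup>\<omega>) = outs T w q \<frown> state_map T q (w\<^sup>\<omega>)"
    using state_map_conc[OF T q(1) iter_in_inf_words[OF w] w(1)] q(2) by simp
  then show "state_map T q (w\<^sup>\<omega>) = (outs T w q)\<^sup>\<omega>" unfolding iter_eq[OF w(2)] by (rule iter_unique[OF ne])
qed

section \<open>Infinitely many cosets\<close>

lemma recurrent_eq_imp_tail:
  assumes "synchronizing f" "synchronizing g" "recurrent f = recurrent g" "x \<in> I" shows "f x \<sim> g x"
  using recurrent_eq_imp_loc_eq[OF assms(1-3)] loc_eq_imp_tail[of f g _ x] assms unfolding synchronizing_def by blast

lemma transducers_of_recurrent_inject:
  assumes f: "synchronizing f" and eq: "transducers_of (recurrent f) = transducers_of S" shows "recurrent f = S"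
proof -
  have "realize f \<in> transducers_of S" using realize_in_transducers_of[OF f] unfolding eq .
  then have "state_maps (realize f) = S" by (rule clsD(2))
  then show ?thesis unfolding realize(2)[OF f] .
qed

lemma mult_involution:
  assumes T: "minimal_inj T" and f: "f \<in> state_maps T" and g: "involution g"
  shows "transducers_of (state_maps T) \<otimes>\<^bsub>M_monoid n\<^esub> transducers_of (recurrent g) = transducers_of (recurrent (\<lambda>x. g (f x)))" "synchronizing (\<lambda>x. g (f x))"
    "transducers_of (recurrent g) \<otimes>\<^bsub>M_monoid n\<^esub> transducers_of (state_maps T) = transducers_of (recurrent (\<lambda>x. f (g x)))" "synchronizing (\<lambda>x. f (g x))"
proof -
  have sg: "synchronizing g" and gH: "restrict g I \<in> recurrent g" using g unfolding involution_def by auto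
  have U: "minimal_inj (realize g)" and HU: "state_maps (realize g) = recurrent g"
    using realize_minimal_inj[OF sg] realize(2)[OF sg] by auto
  have gU: "restrict g I \<in> state_maps (realize g)" using gH HU by simp
  have "good f" using f minimal_inj_good[OF T] unfolding state_maps_def by blast
  then have fI: "f x \<in> I" if "x \<in> I" for x using goodD(1) that by blast
  have gI: "g x \<in> I" if "x \<in> I" for x using goodD(1)[of g x] sg that unfolding synchronizing_def by blast
  have e1: "restrict g I (f x) = g (f x)" if "x \<in> I" for x using fI[OF that] by simp
  have e2: "f (restrict g I x) = f (g x)" if "x \<in> I" for x using that by simp
  show "transducers_of (state_maps T) \<otimes>\<^bsub>M_monoid n\<^esub> transducers_of (recurrent g) = transducers_of (recurrent (\<lambda>x. g (f x)))"
    using mult_transducers_of[OF T U f gU] recurrent_cong[OF e1] HU by simp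
  show "transducers_of (recurrent g) \<otimes>\<^bsub>M_monoid n\<^esub> transducers_of (state_maps T) = transducers_of (recurrent (\<lambda>x. f (g x)))"
    using mult_transducers_of[OF U T gU f] recurrent_cong[OF e2] HU by simp
  have *: "synchronizing b" if ab: "synchronizing a" "\<And>x. x \<in> I \<Longrightarrow> a x = b x" for a b
  proof -
    obtain k where k: "sync k a" "good a" using ab(1) unfolding synchronizing_def by blast
    have "loc a w = loc b w" if "w \<in> W" for w using loc_cong(1)[OF ab(2) that] .
    then have "sync k b" using k(1) unfolding sync_def by simp
    then show ?thesis using good_cong[OF k(2) ab(2)] unfolding synchronizing_def by blast
  qed
  show "synchronizing (\<lambda>x. g (f x))" by (rule *[OF tr_prod_semantics(2)[OF T U f gU] e1])
  show "synchronizing (\<lambda>x. f (g x))" by (rule *[OF tr_prod_semantics(2)[OF U T gU f] e2])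
qed

text \<open>\<open>i + 2\<close> is the least run length for which \<open>admissible_short\<close>
  accepts \<open>i\<close> zeros. As it grows with \<open>i\<close>, later interchanges leave words
  of short period alone.\<close>

definition lengthener :: "nat \<Rightarrow> nat word \<Rightarrow> nat word" where
  "lengthener i = swap (marked (i + 2) []) (marked (i + 2) (replicate i 0))"

lemma swap_pair_lengthener:
  "0 < i \<Longrightarrow> swap_pair n (marked (i + 2) []) (marked (i + 2) (replicate i 0))"
  by (rule swap_pair_marked) (auto intro: admissible_short)

lemma one_in_L_nr: "\<one>\<^bsub>M_monoid n\<^esub> \<in> L_nr n r"
proof -
  have c: "\<one>\<^bsub>M_monoid n\<^esub> \<in> carrier (O_nr n r)" unfolding one_eq by (rule involution_O_nr[OF involution_id])
  then have d: "\<one>\<^bsub>M_monoid n\<^esub> \<in> carrier (O_group n)" by (simp add: O_nr_def)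
  have si: "synchronizing (\<lambda>x. x)" using involution_id unfolding involution_def by blast
  have "length (outs T a q) = length a"
    if T: "T \<in> transducers_of (recurrent (\<lambda>x. x))" and a: "a \<in> W" and q: "q \<in> states T" for T a q
  proof -
    have hq: "state_map T q = restrict (\<lambda>x. x) I" using clsD(2)[OF T] q unfolding state_maps_def recurrent_id by blast
    have "\<forall>f\<in>state_maps T. inj_on f I" unfolding clsD(2)[OF T] recurrent_id by simp
    then have "minimal_inj T" unfolding minimal_inj_def inj_tr_iff using clsD(1)[OF T] by blast
    then have "outs T a q = lcp (restrict (\<lambda>x. x) I) a" using minimal_inj_loc(2) q a hq by metis
    also have "\<dots> = lcp (\<lambda>x. x) a" by (rule loc_cong(2)[OF _ a]) simp
    finally show ?thesis using loc_id[OF a] by simp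
  qed
  then have "\<one>\<^bsub>M_monoid n\<^esub> \<in> L_tilde n"
    unfolding L_tilde_def one_eq using transducers_of_recurrent_carrier[OF si] by simp
  then show ?thesis using c d by (simp add: L_nr_def L_n_def)
qed

lemma one_mult_involution:
  assumes g: "involution g" shows "\<one>\<^bsub>M_monoid n\<^esub> \<otimes>\<^bsub>M_monoid n\<^esub> transducers_of (recurrent g) = transducers_of (recurrent g)"
proof -
  have si: "synchronizing (\<lambda>x. x)" using involution_id unfolding involution_def by blast
  have T: "minimal_inj (realize (\<lambda>x. x))" "state_maps (realize (\<lambda>x. x)) = recurrent (\<lambda>x. x)"
    using realize_minimal_inj[OF si] realize(2)[OF si] by auto
  have "transducers_of (state_maps (realize (\<lambda>x. x))) \<otimes>\<^bsub>M_monoid n\<^esub> transducers_of (recurrent g) = transducers_of (recurrent (\<lambda>x. g (restrict (\<lambda>x. x) I x)))"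
    by (rule mult_involution(1)[OF T(1) _ g]) (simp only: T(2) recurrent_id singletonI)
  also have "recurrent (\<lambda>x. g (restrict (\<lambda>x. x) I x)) = recurrent g" by (rule recurrent_cong) simp
  finally show ?thesis by (simp add: T(2) one_eq)
qed

text \<open>A representative of \<open>A\<close> maps \<open>?w\<^sup>\<omega>\<close> to a word
  with a period of the same length, too short to contain a block of \<open>lengthener j\<close>. But
  \<open>lengthener i\<close> makes out of \<open>?w\<^sup>\<omega>\<close> a periodic word
  containing \<open>?v\<close>, which is longer than this period.\<close>

lemma lengthener_not_in_coset:
  assumes ij: "0 < i" "i < j" and A: "A \<in> L_nr n r"
  shows "transducers_of (recurrent (lengthener i)) \<noteq> A \<otimes>\<^bsub>M_monoid n\<^esub> transducers_of (recurrent (lengthener j))"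
proof
  assume eq: "transducers_of (recurrent (lengthener i)) = A \<otimes>\<^bsub>M_monoid n\<^esub> transducers_of (recurrent (lengthener j))"
  interpret i: swap_pair n "marked (i + 2) []" "marked (i + 2) (replicate i 0)"
    by (rule swap_pair_lengthener[OF ij(1)])
  interpret j: swap_pair n "marked (j + 2) []" "marked (j + 2) (replicate j 0)"
    by (rule swap_pair_lengthener) (use ij in simp)
  have invi: "involution (lengthener i)" and invj: "involution (lengthener j)"
    using i.involution_swap j.involution_swap unfolding lengthener_def by auto
  obtain T where T: "minimal_inj T" "A = transducers_of (state_maps T)" using O_nrD[of A r] A unfolding L_nr_def by blast
  let ?w = "marked (i + 2) []" and ?v = "marked (i + 2) (replicate i 0)"
  have w: "?w \<in> W" "?w \<noteq> []" using i.AW by simp_all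
  obtain k where k: "sync_level n T k" using minimal_injD(6)[OF T(1)] by blast
  obtain q where q: "q \<in> states T" "steps T ?w q = q" using forced_loop[OF minimal_injD(1)[OF T(1)] k w] by blast
  define u where "u = outs T ?w q"
  have "T \<in> A" using T unfolding transducers_of_def minimal_inj_def by simp
  moreover have "A \<in> L_tilde n" using A by (simp add: L_nr_def L_n_def)
  ultimately have lu: "length u = length ?w" using q w(1) unfolding L_tilde_def u_def by blast
  have hu: "state_map T q (?w\<^sup>\<omega>) = u\<^sup>\<omega>" "u \<noteq> []" using state_map_iter[OF minimal_injD(1)[OF T(1)] q w] unfolding u_def by auto
  have hH: "state_map T q \<in> state_maps T" using q by (simp add: state_maps_def)
  have "transducers_of (recurrent (lengthener i)) = transducers_of (recurrent (\<lambda>x. lengthener j (state_map T q x)))"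
    using mult_involution(1)[OF T(1) hH invj] eq T(2) by simp
  then have "recurrent (lengthener i) = recurrent (\<lambda>x. lengthener j (state_map T q x))"
    using transducers_of_recurrent_inject invi unfolding involution_def by blast
  then have "lengthener i (?w\<^sup>\<omega>) \<sim> lengthener j (state_map T q (?w\<^sup>\<omega>))"
    using recurrent_eq_imp_tail[OF _ mult_involution(2)[OF T(1) hH invj] _ iter_in_inf_words[OF w]] invi
    unfolding involution_def by blast
  moreover have "lengthener i (?w\<^sup>\<omega>) = ?v\<^sup>\<omega>" unfolding lengthener_def by (rule i.swap_iter_A)
  \<comment> \<open>The shorter block of \<open>lengthener j\<close> has length
    \<open>2 * j + 6\<close>, more than the period \<open>2 * i + 6\<close>.\<close>
  moreover have "lengthener j (u\<^sup>\<omega>) = u\<^sup>\<omega>"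
    unfolding lengthener_def
    using occurs_iter_length[OF j.cf _ hu(2), of "marked (j + 2) []"]
      occurs_iter_length[OF j.cf _ hu(2), of "marked (j + 2) (replicate j 0)"] lu ij
    by (intro j.swap_fix) auto
  ultimately have "?v\<^sup>\<omega> \<sim> u\<^sup>\<omega>" using hu by simp
  moreover have "occurs ?v (?v\<^sup>\<omega>)"
    unfolding occurs_def by (rule exI[of _ 0]) (metis i.nonempty(2) iter_eq omega_prefix_conc suffix_0)
  ultimately have "occurs ?v (u\<^sup>\<omega>)" using occurs_tail_iter i.nonempty(2) by blast
  then have "length ?v \<le> length u" using occurs_iter_length[OF i.cf _ hu(2)] by blast
  then show False using lu ij by simp
qed

lemma infinite_rcosets: "infinite (rcosets\<^bsub>O_nr n r\<^esub> (L_nr n r))"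
proof -
  \<comment> \<open>\<open>Suc i\<close>, because \<open>lengthener 0\<close> would exchange a word
    with itself.\<close>
  let ?a = "\<lambda>i. transducers_of (recurrent (lengthener (Suc i)))"
  let ?f = "\<lambda>i. L_nr n r #>\<^bsub>O_nr n r\<^esub> ?a i"
  have inv: "involution (lengthener (Suc i))" for i
    using swap_pair.involution_swap[OF swap_pair_lengthener[of "Suc i"]] unfolding lengthener_def by simp
  have "?f i \<noteq> ?f j" if ij: "i < j" for i j
  proof
    assume "?f i = ?f j"
    moreover have "?a i \<in> ?f i"
      unfolding r_coset_def using one_in_L_nr one_mult_involution[OF inv[of i]] by force
    ultimately obtain A where "A \<in> L_nr n r" "?a i = A \<otimes>\<^bsub>M_monoid n\<^esub> ?a j"
      unfolding r_coset_def by auto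
    then show False using lengthener_not_in_coset[of "Suc i" "Suc j"] ij by blast
  qed
  then have "inj ?f" by (intro injI) (metis linorder_neqE_nat)
  then have "infinite (range ?f)" by (rule range_inj_infinite)
  moreover have "range ?f \<subseteq> rcosets\<^bsub>O_nr n r\<^esub> (L_nr n r)"
    unfolding RCOSETS_def using involution_O_nr[OF inv] by blast
  ultimately show ?thesis using infinite_super by blast
qed

end

subsection \<open>The centre\<close>

lemma iter_rotate:
  assumes "s @ t \<noteq> []" shows "(t @ s)\<^sup>\<omega> = t \<frown> (s @ t)\<^sup>\<omega>"
proof -
  have "t \<frown> (s @ t)\<^sup>\<omega> = t \<frown> ((s @ t) \<frown> (s @ t)\<^sup>\<omega>)" by (simp only: iter_eq[OF assms])
  also have "\<dots> = (t @ s) \<frown> (t \<frown> (s @ t)\<^sup>\<omega>)" by simp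
  finally have eq: "t \<frown> (s @ t)\<^sup>\<omega> = (t @ s) \<frown> (t \<frown> (s @ t)\<^sup>\<omega>)" .
  have "t @ s \<noteq> []" using assms by auto
  then show ?thesis using eq by (rule iter_unique[symmetric])
qed

lemma conc_eq_prefix: "u \<frown> x = v \<frown> y \<Longrightarrow> length u \<le> length v \<Longrightarrow> Sublist.prefix u v"
  using omega_prefix_comparable[of u "u \<frown> x" v] omega_prefix_conc[of v y] omega_prefix_conc[of u x] by simp

lemma length_power: "length (concat (replicate j v)) = j * length v"
  by (simp add: length_concat sum_list_replicate)

lemma occurs_iter_rotate:
  assumes v: "v \<noteq> []" and occ: "occurs P (v\<^sup>\<omega>)"
  obtains s t where "v = s @ t" "omega_prefix P ((t @ s)\<^sup>\<omega>)"
proof -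
  obtain j where "omega_prefix P (wdrop j (v\<^sup>\<omega>))" using occ unfolding occurs_def by blast
  then have j: "omega_prefix P (wdrop (j mod length v) (v\<^sup>\<omega>))" by (simp only: wdrop_iter_mod[OF v])
  let ?i = "j mod length v"
  let ?s = "take ?i v" and ?t = "drop ?i v"
  have i: "?i < length v" using v by simp
  have "wdrop ?i (v\<^sup>\<omega>) = wdrop ?i (v \<frown> v\<^sup>\<omega>)" by (simp only: iter_eq[OF v])
  also have "v \<frown> v\<^sup>\<omega> = ?s \<frown> (?t \<frown> v\<^sup>\<omega>)" by simp
  also have "wdrop ?i (?s \<frown> (?t \<frown> v\<^sup>\<omega>)) = ?t \<frown> v\<^sup>\<omega>" by (rule wdrop_length_conc) (use i in simp)
  also have "\<dots> = (?t @ ?s)\<^sup>\<omega>" using iter_rotate[of ?s ?t] v by simp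
  finally have "omega_prefix P ((?t @ ?s)\<^sup>\<omega>)" using j by (simp only:)
  then show thesis using that[of ?s ?t] by simp
qed

text \<open>If the lengths differed, the difference \<open>m\<close> would force every value to be
  \<open>m\<^sup>\<omega>\<close>; two distinct values of \<open>F\<close> exclude this.\<close>

lemma conc_eq_imp_eq:
  assumes "\<And>x. x \<in> S \<Longrightarrow> a \<frown> F x = b \<frown> F x" and "x \<in> S" "y \<in> S" "F x \<noteq> F y"
  shows "a = b"
proof -
  have aux: False if le: "length a < length b" and eq: "\<And>x. x \<in> S \<Longrightarrow> a \<frown> F x = b \<frown> F x" for a b
  proof -
    have "Sublist.prefix a b"
      using conc_eq_prefix[OF eq[OF assms(2)]] le by simp
    then obtain m where m: "b = a @ m" by (auto simp: prefix_def)
    then have "m \<noteq> []" using le by auto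
    have "F z = m \<frown> F z" if "z \<in> S" for z
    proof -
      have "a \<frown> F z = a \<frown> (m \<frown> F z)" using eq[OF that] m by simp
      then show ?thesis by (simp only: same_concat_eq)
    qed
    then have "F z = m\<^sup>\<omega>" if "z \<in> S" for z using that iter_unique[OF \<open>m \<noteq> []\<close>] by blast
    then show False using assms(2-4) by simp
  qed
  have "length a = length b"
    using aux[of a b] aux[of b a] assms(1) by (metis linorder_neqE_nat)
  then show ?thesis using assms(1)[OF assms(2)] concat_eq by blast
qed

text \<open>Comparing the two equations shows that \<open>a\<close> and \<open>b\<close> are conjugate words.\<close>

lemma conc_conjugate_mset:
  assumes 1: "\<And>x. x \<in> S \<Longrightarrow> s \<frown> R x = d \<frown> F x"
    and 2: "\<And>x. x \<in> S \<Longrightarrow> s \<frown> (b \<frown> R x) = d \<frown> (a \<frown> F x)"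
    and xy: "x \<in> S" "y \<in> S" "F x \<noteq> F y"
  shows "mset b = mset a"
proof (cases "length s \<le> length d")
  case True
  have "Sublist.prefix s d"
    using conc_eq_prefix[OF 1[OF xy(1)]] True by simp
  then obtain e where e: "d = s @ e" by (auto simp: prefix_def)
  have R: "R z = e \<frown> F z" if "z \<in> S" for z
    using 1[OF that] unfolding e conc_conc[symmetric] same_concat_eq .
  have "(b @ e) \<frown> F z = (e @ a) \<frown> F z" if "z \<in> S" for z
  proof -
    have "s \<frown> (b \<frown> R z) = s \<frown> (e \<frown> (a \<frown> F z))" using 2[OF that] unfolding e by simp
    then show ?thesis unfolding same_concat_eq R[OF that] by simp
  qed
  then have "b @ e = e @ a" using conc_eq_imp_eq[of S "b @ e" F "e @ a"] xy by blast
  from arg_cong[OF this, of mset] show ?thesis by simp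
next
  case False
  have "Sublist.prefix d s"
    using conc_eq_prefix[OF 1[OF xy(1), symmetric]] False by simp
  then obtain e where e: "s = d @ e" by (auto simp: prefix_def)
  have F: "F z = e \<frown> R z" if "z \<in> S" for z
    using 1[OF that, symmetric] unfolding e conc_conc[symmetric] same_concat_eq .
  have "(e @ b) \<frown> R z = (a @ e) \<frown> R z" if "z \<in> S" for z
  proof -
    have "d \<frown> (e \<frown> (b \<frown> R z)) = d \<frown> (a \<frown> F z)" using 2[OF that] unfolding e by simp
    then show ?thesis unfolding same_concat_eq F[OF that] by simp
  qed
  moreover have "R x \<noteq> R y" using xy F by metis
  ultimately have "e @ b = a @ e" using conc_eq_imp_eq[of S "e @ b" R "a @ e"] xy by blast
  from arg_cong[OF this, of mset] show ?thesis by simp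
qed

text \<open>The number of replacements made by \<open>swap_list\<close> in a word without the other
  block.\<close>

function greedy_count :: "'a list \<Rightarrow> 'a list \<Rightarrow> nat" where
  "greedy_count A u = (if u = [] \<or> A = [] then 0
     else if Sublist.prefix A u then Suc (greedy_count A (drop (length A) u)) else greedy_count A (tl u))"
  by pat_completeness auto
termination by (relation "measure (\<lambda>(A, u). length u)") auto

declare greedy_count.simps [simp del]

text \<open>Every replacement exchanges the letters of \<open>A\<close> for those of
  \<open>B\<close>. Terms are added on both sides to avoid truncated subtraction of
  multisets.\<close>

lemma mset_swap_list:
  assumes "A \<noteq> []" "B \<noteq> []" "\<not> sublist B u"
  shows "mset (swap_list A B u) + repeat_mset (greedy_count A u) (mset A) = mset u + repeat_mset (greedy_count A u) (mset B)"
  using assms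
proof (induction "length u" arbitrary: u rule: less_induct)
  case less
  have sub: "\<not> sublist B (drop i u)" for i
    using less.prems(3) sublist_drop sublist_order.order_trans by blast
  show ?case
  proof (cases "u = []")
    case True
    then show ?thesis by (simp add: swap_list.simps greedy_count.simps)
  next
    case ne: False
    show ?thesis
    proof (cases "Sublist.prefix A u")
      case True
      have l: "length (drop (length A) u) < length u" using ne less.prems(1) by simp
      have r: "swap_list A B u = B @ swap_list A B (drop (length A) u)" "greedy_count A u = Suc (greedy_count A (drop (length A) u))"
        using ne True less.prems by (simp_all add: swap_list.simps[of A B u] greedy_count.simps[of A u])
      have "u = A @ drop (length A) u" using True by (auto simp: prefix_def)
      from arg_cong[OF this, of mset] have u: "mset u = mset A + mset (drop (length A) u)" by (simp only: mset_append)
      show ?thesis using less.hyps[OF l less.prems(1,2) sub] unfolding r u by (simp add: ac_simps)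
    next
      case False
      have l: "length (tl u) < length u" using ne by simp
      have "\<not> Sublist.prefix B u" using less.prems(3) prefix_imp_sublist by blast
      then have r: "swap_list A B u = hd u # swap_list A B (tl u)" "greedy_count A u = greedy_count A (tl u)"
        using ne False less.prems by (simp_all add: swap_list.simps[of A B u] greedy_count.simps[of A u])
      have "\<not> sublist B (tl u)" using sub[of 1] by (simp add: drop_Suc)
      from less.hyps[OF l less.prems(1,2) this] show ?thesis
        unfolding r using ne by (cases u) (simp_all add: ac_simps)
    qed
  qed
qed

text \<open>Each counted copy consumes \<open>length A\<close> letters and each skipped letter
  counts nothing, so equality leaves no skipped letter.\<close>

lemma greedy_count_length:
  assumes "A \<noteq> []"
  shows "greedy_count A u * length A \<le> length u \<and> (greedy_count A u * length A = length u \<longrightarrow> u = concat (replicate (greedy_count A u) A))"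
proof (induction "length u" arbitrary: u rule: less_induct)
  case less
  show ?case
  proof (cases "u = []")
    case True
    then show ?thesis by (simp add: greedy_count.simps)
  next
    case ne: False
    show ?thesis
    proof (cases "Sublist.prefix A u")
      case True
      then obtain v where u: "u = A @ v" by (auto simp: prefix_def)
      have c: "greedy_count A u = Suc (greedy_count A v)" using ne assms u by (subst greedy_count.simps) simp
      have "length v < length u" using u assms by simp
      from less.hyps[OF this] show ?thesis unfolding c unfolding u by auto
    next
      case False
      have c: "greedy_count A u = greedy_count A (tl u)" using ne assms False by (subst greedy_count.simps) simp
      have l: "length (tl u) < length u" using ne by simp
      from less.hyps[OF l] l show ?thesis unfolding c by auto
    qed
  qed
qed

lemma greedy_count_pos: "A \<noteq> [] \<Longrightarrow> Sublist.prefix A u \<Longrightarrow> 0 < greedy_count A u"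
  by (subst greedy_count.simps) auto

lemma replicate_concat_snoc: "concat (replicate m v) @ v = v @ concat (replicate m v)"
  by (induction m) auto

lemma power_rotate: "concat (replicate (Suc m) (s @ t)) = s @ concat (replicate m (t @ s)) @ t"
  by (induction m) auto

text \<open>\<open>T\<close> represents a central element. \<open>g\<close> stands for a state map
  of its inverse, of which only the effect on tail classes is recorded.\<close>

locale central = alphabet +
  fixes T :: "nat transducer" and k :: nat and g :: "nat word \<Rightarrow> nat word"
  assumes T: "minimal_inj T" and k: "sync_level n T k"
    and comm: "\<And>f q. involution f \<Longrightarrow> q \<in> states T \<Longrightarrow> recurrent (\<lambda>x. f (state_map T q x)) = recurrent (\<lambda>x. state_map T q (f x))"
    and g_tail: "\<And>x y. x \<in> I \<Longrightarrow> y \<in> I \<Longrightarrow> x \<sim> y \<Longrightarrow> g x \<sim> g y"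
    and g_inv: "\<And>q x. q \<in> states T \<Longrightarrow> x \<in> I \<Longrightarrow> g (state_map T q x) \<sim> x"
begin

lemmas tr = minimal_injD(1)[OF T]

section \<open>States forced by runs, and outputs on markers\<close>

definition st :: "nat list \<Rightarrow> nat" where
  "st w = steps T w (SOME q. q \<in> states T)"

lemma some_state: "(SOME q. q \<in> states T) \<in> states T"
  using tr by (auto simp: transducer_def some_in_eq)

lemma st_in: "w \<in> W \<Longrightarrow> st w \<in> states T"
  unfolding st_def by (rule steps_in_states[OF tr _ some_state])

lemma steps_forced:
  assumes "p \<in> states T" "u \<in> W" "w \<in> W" "k \<le> length w"
  shows "steps T (u @ w) p = st w"
  unfolding st_def steps_append
  by (rule sync_level_mono[OF k assms(4,3) tr steps_in_states[OF tr assms(2,1)] some_state])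

text \<open>Reading further letters \<open>a\<close> keeps this state, so longer runs only repeat
  the output of a one-letter circuit.\<close>

definition run_state :: "nat \<Rightarrow> nat" where "run_state a = st (replicate k a)"

lemma run_state_in [simp]: "a < n \<Longrightarrow> run_state a \<in> states T"
  unfolding run_state_def by (rule st_in) simp

lemma steps_to_run_state:
  assumes "p \<in> states T" "u \<in> W" "a < n" "k \<le> m"
  shows "steps T (u @ replicate m a) p = run_state a"
proof -
  have "replicate m a = replicate (m - k) a @ replicate k a" using assms(4) by (simp flip: replicate_add)
  then have "steps T (u @ replicate m a) p = steps T ((u @ replicate (m - k) a) @ replicate k a) p" by simp
  also have "\<dots> = run_state a" unfolding run_state_def by (rule steps_forced) (use assms in simp_all)
  finally show ?thesis .
qed

lemma steps_run_state: "a < n \<Longrightarrow> steps T (replicate m a) (run_state a) = run_state a"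
proof -
  assume a: "a < n"
  have "steps T (replicate m a) (run_state a) = steps T ([] @ replicate (k + m) a) (SOME q. q \<in> states T)"
    by (simp add: run_state_def st_def replicate_add)
  also have "\<dots> = run_state a" by (rule steps_to_run_state) (use a some_state in simp_all)
  finally show ?thesis .
qed

lemma outs_run_state: "a < n \<Longrightarrow> outs T (replicate m a) (run_state a) = concat (replicate m (outs T [a] (run_state a)))"
proof (induction m)
  case (Suc m)
  have "outs T (replicate (Suc m) a) (run_state a) = outs T ([a] @ replicate m a) (run_state a)" by simp
  also have "\<dots> = outs T [a] (run_state a) @ outs T (replicate m a) (steps T (replicate 1 a) (run_state a))"
    unfolding outs_append by simp
  finally show ?case using Suc steps_run_state[OF Suc.prems, of 1] by simp
qed simp

text \<open>Pieces of the circuit labelled by a marker at \<open>run_state 1\<close>: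
  \<open>E\<close> is written on the way to \<open>run_state 0\<close>, \<open>u0\<close> and
  \<open>u1\<close> in the one-letter circuits, and \<open>\<beta> V\<close> on the way back. In
  \<open>marked_outs\<close> only the exponents depend on \<open>N\<close> and only
  \<open>\<beta> V\<close> on \<open>V\<close>.\<close>

definition \<beta> :: "nat list \<Rightarrow> nat list" where "\<beta> V = outs T (1 # V @ 0 # replicate k 1) (run_state 0)"
definition E :: "nat list" where "E = outs T (replicate k 0) (run_state 1)"
definition u0 :: "nat list" where "u0 = outs T [0] (run_state 0)"
definition u1 :: "nat list" where "u1 = outs T [1] (run_state 1)"
definition \<alpha> :: "nat \<Rightarrow> nat list \<Rightarrow> nat list" where "\<alpha> N V = outs T (marked N V) (run_state 1)"

lemma outs_after_marker:
  assumes V: "V \<in> W" and N: "k \<le> N"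
  shows "outs T (1 # V @ 0 # replicate N 1) (run_state 0) = \<beta> V @ concat (replicate (N - k) u1)"
    "steps T (1 # V @ 0 # replicate N 1) (run_state 0) = run_state 1"
proof -
  have w: "1 # V @ 0 # replicate N 1 = (1 # V @ 0 # replicate k 1) @ replicate (N - k) 1"
    using N by (simp flip: replicate_add)
  have s: "steps T (1 # V @ 0 # replicate m 1) (run_state 0) = run_state 1" if "k \<le> m" for m
    using steps_to_run_state[of "run_state 0" "1 # V @ [0]" 1 m] V that by simp
  show "outs T (1 # V @ 0 # replicate N 1) (run_state 0) = \<beta> V @ concat (replicate (N - k) u1)"
    unfolding w outs_append s[OF order_refl] \<beta>_def u1_def by (subst outs_run_state) simp_all
  show "steps T (1 # V @ 0 # replicate N 1) (run_state 0) = run_state 1" by (rule s[OF N])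
qed

lemma marked_outs:
  assumes V: "V \<in> W" and N: "k \<le> N"
  shows "\<alpha> N V = E @ concat (replicate (N - k) u0) @ \<beta> V @ concat (replicate (N - k) u1)"
    "steps T (marked N V) (run_state 1) = run_state 1"
proof -
  have m: "marked N V = (replicate k 0 @ replicate (N - k) 0) @ (1 # V @ 0 # replicate N 1)"
    using N by (simp add: marked_def flip: replicate_add)
  have s: "steps T (replicate k 0) (run_state 1) = run_state 0" using steps_to_run_state[of "run_state 1" "[]" 0 k] by simp
  have s': "steps T (replicate k 0 @ replicate (N - k) 0) (run_state 1) = run_state 0"
    unfolding steps_append s by (rule steps_run_state) simp
  have o: "outs T (replicate k 0 @ replicate (N - k) 0) (run_state 1) = E @ concat (replicate (N - k) u0)"
    unfolding outs_append s E_def u0_def by (subst outs_run_state) simp_all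
  show "\<alpha> N V = E @ concat (replicate (N - k) u0) @ \<beta> V @ concat (replicate (N - k) u1)"
    unfolding \<alpha>_def m outs_append[of _ "replicate k 0 @ replicate (N - k) 0"] s' o outs_after_marker(1)[OF V N] by simp
  show "steps T (marked N V) (run_state 1) = run_state 1"
    unfolding m steps_append[of _ "replicate k 0 @ replicate (N - k) 0"] s' by (rule outs_after_marker(2)[OF V N])
qed

abbreviation f :: "nat word \<Rightarrow> nat word" where "f \<equiv> state_map T (run_state 1)"

lemma good_f: "good f" and spread_f: "spread f"
  using minimal_inj_good[OF T, of "run_state 1"] minimal_inj_spread[OF T, of "run_state 1"] by simp_all

lemma f_marked:
  assumes "V \<in> W" "k \<le> N" "x \<in> I"
  shows "f (marked N V \<frown> x) = \<alpha> N V \<frown> f x"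
  using state_map_conc[OF tr _ assms(3) marked_in_W[OF assms(1)], of "run_state 1" N] marked_outs(2)[OF assms(1,2)]
  by (simp add: \<alpha>_def)

lemma f_iter:
  assumes "V \<in> W" "k \<le> N"
  shows "f ((marked N V)\<^sup>\<omega>) = (\<alpha> N V)\<^sup>\<omega>" "\<alpha> N V \<noteq> []" "\<alpha> N V \<in> W"
  using state_map_iter[OF tr _ marked_outs(2)[OF assms] marked_in_W[OF assms(1)]]
    outs_in_lists[OF tr marked_in_W[OF assms(1)], of "run_state 1" N]
  by (simp_all add: \<alpha>_def)

lemma f_comm_tail:
  assumes "involution i" "x \<in> I" shows "i (f x) \<sim> f (i x)"
proof (rule recurrent_eq_imp_tail[of "\<lambda>x. i (f x)" "\<lambda>x. f (i x)", OF _ _ _ assms(2)])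
  have "f \<in> state_maps T" by (simp add: state_maps_def)
  then show "synchronizing (\<lambda>x. i (f x))" "synchronizing (\<lambda>x. f (i x))" using mult_involution(2,4)[OF T _ assms(1)] by blast+
  show "recurrent (\<lambda>x. i (f x)) = recurrent (\<lambda>x. f (i x))" by (rule comm[OF assms(1)]) simp
qed

section \<open>Which markers occur in the image of a periodic marker word\<close>

lemma exists_long_admissible:
  assumes "2 \<le> N" shows "\<exists>V\<in>W. admissible N V \<and> m < length V"
  by (rule bexI[of _ "alternating (Suc m)"]) (use admissible_alternating[OF assms] alternating_in_W in simp_all)

lemma marked_occurs_iter_length:
  assumes "admissible N V" "v \<noteq> []" "occurs (marked N V) (v\<^sup>\<omega>)" shows "length (marked N V) \<le> length v"
  by (rule occurs_iter_length[OF clash_free_marked _ assms(2,3)]) (use assms(1) in blast)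

lemma marked_occurs_iter_other:
  assumes "admissible N V" "admissible N V'" "occurs (marked N V') ((marked N V)\<^sup>\<omega>)" shows "V = V'"
  using occurs_iter_other[OF clash_free_marked, of "marked N V" N "marked N V'"] assms marked_inj by auto

lemma occurs_self: "v \<noteq> [] \<Longrightarrow> occurs v (v\<^sup>\<omega>)"
  unfolding occurs_def by (rule exI[of _ 0]) (metis iter_eq omega_prefix_conc suffix_0)

text \<open>Interchanging \<open>V'\<close> with a huge \<open>U\<close> fixes the periodic word of
  \<open>V\<close>, hence the tail class of its image. If \<open>V'\<close> occurred in that image,
  the interchange would bring in the marker of \<open>U\<close>, which is too long for the
  period.\<close>

lemma other_marker_absent:
  assumes N: "k \<le> N" "2 \<le> N" and V: "V \<in> W" "admissible N V" and V': "V' \<in> W" "admissible N V'" and ne: "V \<noteq> V'"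
  shows "\<not> occurs (marked N V') ((\<alpha> N V)\<^sup>\<omega>)"
proof
  assume occ: "occurs (marked N V') ((\<alpha> N V)\<^sup>\<omega>)"
  \<comment> \<open>Longer than \<open>V\<close> and \<open>V'\<close> to differ from both, longer
    than \<open>\<alpha> N V\<close> to exceed the period.\<close>
  obtain U where U: "U \<in> W" "admissible N U" "length V + length V' + length (\<alpha> N V) < length U"
    using exists_long_admissible[OF N(2)] by blast
  interpret s: swap_pair n "marked N V'" "marked N U"
    by (rule swap_pair_marked) (use V' U in auto)
  note a = f_iter[OF V(1) N(1)]
  have aI: "(\<alpha> N V)\<^sup>\<omega> \<in> I" by (rule iter_in_inf_words) (use a in auto)
  have "s.\<phi> ((marked N V)\<^sup>\<omega>) = (marked N V)\<^sup>\<omega>"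
  proof (rule s.swap_fix)
    show "\<not> occurs (marked N V') ((marked N V)\<^sup>\<omega>)" using marked_occurs_iter_other[OF V(2) V'(2)] ne by blast
    show "\<not> occurs (marked N U) ((marked N V)\<^sup>\<omega>)" using marked_occurs_iter_other[OF V(2) U(2)] U(3) by auto
  qed
  then have t: "s.\<phi> ((\<alpha> N V)\<^sup>\<omega>) \<sim> (\<alpha> N V)\<^sup>\<omega>"
    using f_comm_tail[OF s.involution_swap iter_in_inf_words[OF marked_in_W[OF V(1), of N] marked_ne_Nil]] a(1) by simp
  obtain x y where xy: "\<alpha> N V = x @ y" "omega_prefix (marked N V') ((y @ x)\<^sup>\<omega>)"
    using occurs_iter_rotate[OF a(2) occ] by blast
  let ?c = "y @ x"
  have c: "?c \<noteq> []" using a(2) xy(1) by auto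
  have "length (marked N V') \<le> length ?c"
    using marked_occurs_iter_length[OF V'(2) a(2) occ] xy(1) by simp
  then have pre: "Sublist.prefix (marked N V') ?c"
    using xy(2) omega_prefix_conc_iff[of "marked N V'" ?c "?c\<^sup>\<omega>"] iter_eq[OF c] by simp
  \<comment> \<open>The period was rotated so as to begin with a block; each end of a period is then
    a cut, and the interchanged word is periodic again.\<close>
  have "s.cut (?c \<frown> ?c\<^sup>\<omega>) (length ?c)"
    by (rule s.cut_before[of "marked N V'"]) (use xy(2) in simp_all)
  then have "s.\<phi> (?c \<frown> ?c\<^sup>\<omega>) = s.\<rho> ?c \<frown> s.\<phi> (?c\<^sup>\<omega>)" by (rule s.swap_cut)
  then have eq: "s.\<phi> (?c\<^sup>\<omega>) = s.\<rho> ?c \<frown> s.\<phi> (?c\<^sup>\<omega>)" unfolding iter_eq[OF c] .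
  have \<rho>: "s.\<rho> ?c = marked N U @ s.\<rho> (drop (length (marked N V')) ?c)"
    using pre c by (subst swap_list.simps) simp
  then have \<rho>ne: "s.\<rho> ?c \<noteq> []" by simp
  have it: "s.\<phi> (?c\<^sup>\<omega>) = (s.\<rho> ?c)\<^sup>\<omega>" by (rule iter_unique[OF \<rho>ne eq])
  have "(\<alpha> N V)\<^sup>\<omega> \<sim> ?c\<^sup>\<omega>"
  proof -
    have "?c\<^sup>\<omega> = y \<frown> (\<alpha> N V)\<^sup>\<omega>" using iter_rotate[of x y] a(2) xy(1) by simp
    then show ?thesis using tail_sym tail_conc by metis
  qed
  moreover have "?c \<in> W" using a(3) xy(1) by simp
  then have "?c\<^sup>\<omega> \<in> I" using c by (rule iter_in_inf_words)
  moreover have "synchronizing s.\<phi>" using s.involution_swap unfolding involution_def by blast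
  ultimately have "s.\<phi> ((\<alpha> N V)\<^sup>\<omega>) \<sim> s.\<phi> (?c\<^sup>\<omega>)" using synchronizing_respects_tail aI by blast
  then have "(s.\<rho> ?c)\<^sup>\<omega> \<sim> (\<alpha> N V)\<^sup>\<omega>" unfolding it using t tail_sym tail_trans by blast
  moreover have "occurs (marked N U) ((s.\<rho> ?c)\<^sup>\<omega>)"
  proof -
    have "omega_prefix (marked N U) (s.\<rho> ?c \<frown> (s.\<rho> ?c)\<^sup>\<omega>)" unfolding \<rho> conc_conc[symmetric] by (rule omega_prefix_conc)
    then show ?thesis unfolding iter_eq[OF \<rho>ne] occurs_def by (intro exI[of _ 0]) simp
  qed
  ultimately have "occurs (marked N U) ((\<alpha> N V)\<^sup>\<omega>)" using occurs_tail_iter[OF \<rho>ne] by blast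
  then have "length (marked N U) \<le> length (\<alpha> N V)" by (rule marked_occurs_iter_length[OF U(2) a(2)])
  then show False using U(3) by simp
qed

text \<open>Otherwise the interchange of \<open>V\<close> with another \<open>U\<close> fixes the
  image, so the periodic words of \<open>V\<close> and \<open>U\<close> have tail equivalent images.
  The inverse would make these two words themselves tail equivalent.\<close>

lemma own_marker_present:
  assumes N: "k \<le> N" "2 \<le> N" and V: "V \<in> W" "admissible N V"
  shows "occurs (marked N V) ((\<alpha> N V)\<^sup>\<omega>)"
proof (rule ccontr)
  assume no: "\<not> occurs (marked N V) ((\<alpha> N V)\<^sup>\<omega>)"
  obtain U where U: "U \<in> W" "admissible N U" "length V < length U"
    using exists_long_admissible[OF N(2)] by blast
  then have ne: "V \<noteq> U" by auto
  interpret s: swap_pair n "marked N V" "marked N U"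
    by (rule swap_pair_marked) (use V U in auto)
  let ?x = "(marked N V)\<^sup>\<omega>" and ?y = "(marked N U)\<^sup>\<omega>"
  have xy: "?x \<in> I" "?y \<in> I" using marked_in_W V(1) U(1) by (auto intro!: iter_in_inf_words)
  have "s.\<phi> ((\<alpha> N V)\<^sup>\<omega>) = (\<alpha> N V)\<^sup>\<omega>"
    by (rule s.swap_fix[OF no other_marker_absent[OF N V U(1,2) ne]])
  then have "s.\<phi> (f ?x) = f ?x" using f_iter(1)[OF V(1) N(1)] by simp
  then have "f ?x \<sim> f ?y" using f_comm_tail[OF s.involution_swap xy(1)] s.swap_iter_A by simp
  moreover have "f ?x \<in> I" "f ?y \<in> I" using goodD(1)[OF good_f] xy by blast+
  ultimately have "g (f ?x) \<sim> g (f ?y)" by (rule g_tail[rotated 2])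
  moreover have "g (f ?x) \<sim> ?x" "g (f ?y) \<sim> ?y" using g_inv[of "run_state 1"] xy by simp_all
  ultimately have "?y \<sim> ?x" using tail_sym tail_trans by blast
  then have "occurs (marked N U) ?x" using occurs_tail_iter[OF _ occurs_self] by simp
  then show False using marked_occurs_iter_other[OF V(2) U(2)] ne by blast
qed

text \<open>Interchanging after \<open>f\<close> must give the periods of interchanging before
  \<open>f\<close>, up to rotation. Comparing the two composites behind a long power of
  \<open>?A\<close>, with and without one more copy, gives the equations of
  \<open>conc_conjugate_mset\<close>.\<close>

lemma alpha_swap:
  assumes N: "k \<le> N" "2 \<le> N" and V: "V \<in> W" "admissible N V" and U: "U \<in> W" "admissible N U" and ne: "V \<noteq> U"
    and xy: "\<alpha> N V = x @ y" and pre: "Sublist.prefix (marked N V) (y @ x)"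
  shows "mset (swap_list (marked N V) (marked N U) (y @ x)) = mset (\<alpha> N U)"
proof -
  interpret s: swap_pair n "marked N V" "marked N U"
    by (rule swap_pair_marked) (use V U ne in auto)
  let ?A = "marked N V" and ?B = "marked N U" and ?c = "y @ x"
  have fH: "f \<in> state_maps T" by (simp add: state_maps_def)
  let ?l = "\<lambda>x. s.\<phi> (f x)" and ?r = "\<lambda>x. f (s.\<phi> x)"
  have synchronizing: "synchronizing ?l" "synchronizing ?r" using mult_involution(2,4)[OF T fH s.involution_swap] by blast+
  obtain K where K: "\<And>w. w \<in> W \<Longrightarrow> K \<le> length w \<Longrightarrow> loc ?l w = loc ?r w"
    using recurrent_eq_imp_loc_eq[OF synchronizing comm[OF s.involution_swap, of "run_state 1"]] by auto
  \<comment> \<open>\<open>expand\<close> uses up two of the \<open>Suc m\<close> copies, so exactly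
    \<open>K\<close> full periods remain.\<close>
  define m where "m = Suc K"
  let ?w = "concat (replicate (Suc m) ?A)"
  have w: "?w \<in> W" by (rule s.concat_replicate_in_lists[OF s.AW])
  have "Suc m * 1 \<le> Suc m * length ?A" using s.nonempty(5) by (intro mult_le_mono2) linarith
  moreover have "K \<le> Suc m * 1" by (simp add: m_def)
  ultimately have Kw: "K \<le> length ?w" unfolding length_power by (rule order.trans[rotated])
  have f_pow: "f (concat (replicate j (marked N V')) \<frown> z) = concat (replicate j (\<alpha> N V')) \<frown> f z"
    if "V' \<in> W" "z \<in> I" for j V' z
  proof (induction j)
    case (Suc j)
    have cI: "concat (replicate j (marked N V')) \<frown> z \<in> I"
      using that marked_in_W[of V' N] s.concat_replicate_in_lists by simp
    have "f (marked N V' \<frown> (concat (replicate j (marked N V')) \<frown> z)) = \<alpha> N V' \<frown> (concat (replicate j (\<alpha> N V')) \<frown> f z)"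
      unfolding f_marked[OF that(1) N(1) cI] Suc ..
    then show ?case by simp
  qed simp
  have sI: "s.\<phi> z \<in> I" if "z \<in> I" for z by (rule s.swap_in_I[OF that])
  have spr: "spread ?r"
  proof -
    obtain z z' where z: "z \<in> I" "z' \<in> I" "f z 0 \<noteq> f z' 0" using spread_f unfolding spread_def by blast
    then show ?thesis unfolding spread_def
      by (intro bexI[of _ "s.\<phi> z"] bexI[of _ "s.\<phi> z'"]) (simp_all add: s.swap_swap sI)
  qed
  have "?r (?w \<frown> z) = concat (replicate (Suc m) (\<alpha> N U)) \<frown> ?r z" if "z \<in> I" for z
    unfolding s.swap_power_A by (rule f_pow[OF U(1) sI[OF that]])
  then have "loc ?r ?w = restrict ?r I" by (rule loc_unique(2)[OF w _ spr])
  then have lw: "loc ?l ?w = restrict ?r I" using K[OF w Kw] by simp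
  define d where "d = lcp ?l ?w"
  \<comment> \<open>Behind this power both composites act as \<open>?r\<close>; \<open>d\<close> is
    the prefix already written by \<open>?l\<close>.\<close>
  have E1: "s.\<phi> (concat (replicate (Suc m) (\<alpha> N V)) \<frown> f z) = d \<frown> f (s.\<phi> z)" if z: "z \<in> I" for z
  proof -
    have "good ?l" using synchronizing unfolding synchronizing_def by blast
    from loc_decomp[OF this w z] show ?thesis using z
      by (simp only: f_pow[OF V(1) z] lw d_def[symmetric] restrict_apply if_True)
  qed
  have rot: "concat (replicate (Suc j) (\<alpha> N V)) \<frown> f z = x \<frown> (concat (replicate j ?c) \<frown> (y \<frown> f z))" for j z
    unfolding xy power_rotate by simp
  have cpre: "omega_prefix ?A (?c \<frown> z)" for z using pre omega_prefix_mono omega_prefix_conc by blast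
  have cutc: "s.\<phi> (v \<frown> (?c \<frown> z)) = s.\<rho> v \<frown> s.\<phi> (?c \<frown> z)" for v z
    by (rule s.swap_cut, rule s.cut_before[of ?A]) (use cpre in simp_all)
  have pow: "s.\<phi> (concat (replicate (Suc j) ?c) \<frown> z) = concat (replicate j (s.\<rho> ?c)) \<frown> s.\<phi> (?c \<frown> z)" for j z
  proof (induction j)
    case (Suc j)
    have r: "concat (replicate (Suc (Suc j)) ?c) \<frown> z = ?c \<frown> (?c \<frown> (concat (replicate j ?c) \<frown> z))"
      "concat (replicate (Suc j) ?c) \<frown> z = ?c \<frown> (concat (replicate j ?c) \<frown> z)" by simp_all
    show ?case using Suc unfolding r(1) cutc unfolding r(2) by simp
  qed simp
  let ?R = "\<lambda>z. s.\<phi> (?c \<frown> (y \<frown> f z))"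
  have expand: "s.\<phi> (concat (replicate (Suc (Suc j)) (\<alpha> N V)) \<frown> f z)
      = s.\<rho> x \<frown> (concat (replicate j (s.\<rho> ?c)) \<frown> ?R z)" for j z
  proof -
    have r: "concat (replicate (Suc (Suc j)) (\<alpha> N V)) \<frown> f z = x \<frown> (?c \<frown> (concat (replicate j ?c) \<frown> (y \<frown> f z)))"
      unfolding rot by simp
    have r': "?c \<frown> (concat (replicate j ?c) \<frown> (y \<frown> f z)) = concat (replicate (Suc j) ?c) \<frown> (y \<frown> f z)" by simp
    show ?thesis unfolding r cutc unfolding r' pow ..
  qed
  let ?s = "s.\<rho> x @ concat (replicate K (s.\<rho> ?c))"
  have 1: "?s \<frown> ?R z = d \<frown> f (s.\<phi> z)" if "z \<in> I" for z
    using E1[OF that] unfolding m_def expand by simp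
  \<comment> \<open>One more copy of \<open>?A\<close> in the input inserts one period on each side:
    the interchanged \<open>?c\<close> on the left, \<open>\<alpha> N U\<close> on the
    right.\<close>
  have 2: "?s \<frown> (s.\<rho> ?c \<frown> ?R z) = d \<frown> (\<alpha> N U \<frown> f (s.\<phi> z))" if z: "z \<in> I" for z
  proof -
    have Az: "?A \<frown> z \<in> I" using z s.AW by simp
    have r1: "?s \<frown> (s.\<rho> ?c \<frown> ?R z) = s.\<rho> x \<frown> (concat (replicate (Suc K) (s.\<rho> ?c)) \<frown> ?R z)"
      using replicate_concat_snoc[of K "s.\<rho> ?c"] by simp
    have r2: "concat (replicate (Suc (Suc m)) (\<alpha> N V)) = concat (replicate (Suc m) (\<alpha> N V)) @ \<alpha> N V"
      using replicate_concat_snoc[of "Suc m" "\<alpha> N V"] by simp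
    have r3: "concat (replicate (Suc (Suc m)) (\<alpha> N V)) \<frown> f z = concat (replicate (Suc m) (\<alpha> N V)) \<frown> f (?A \<frown> z)"
      unfolding r2 f_marked[OF V(1) N(1) z] by (simp only: conc_conc)
    have "?s \<frown> (s.\<rho> ?c \<frown> ?R z) = s.\<phi> (concat (replicate (Suc (Suc m)) (\<alpha> N V)) \<frown> f z)"
      unfolding r1 expand m_def ..
    also have "\<dots> = d \<frown> f (s.\<phi> (?A \<frown> z))" unfolding r3 by (rule E1[OF Az])
    also have "\<dots> = d \<frown> (\<alpha> N U \<frown> f (s.\<phi> z))"
      unfolding s.swap_A f_marked[OF U(1) N(1) sI[OF z]] ..
    finally show ?thesis .
  qed
  obtain z z' where z: "z \<in> I" "z' \<in> I" "f (s.\<phi> z) 0 \<noteq> f (s.\<phi> z') 0" using spr unfolding spread_def by blast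
  then have "f (s.\<phi> z) \<noteq> f (s.\<phi> z')" by auto
  from conc_conjugate_mset[of I ?s ?R d "\<lambda>z. f (s.\<phi> z)" "s.\<rho> ?c" "\<alpha> N U", OF 1 2 z(1,2) this]
  show ?thesis .
qed

text \<open>\<open>c\<close> counts the copies of the own marker in a suitably rotated period. No
  other marker interferes, so interchanging changes the letters exactly \<open>c\<close>
  times.\<close>

lemma alpha_structure:
  assumes N: "k \<le> N" "2 \<le> N" and V: "V \<in> W" "admissible N V"
  obtains c where "0 < c"
    "\<And>U. U \<in> W \<Longrightarrow> admissible N U \<Longrightarrow> U \<noteq> V \<Longrightarrow>
       mset (\<alpha> N U) + repeat_mset c (mset (marked N V)) = mset (\<alpha> N V) + repeat_mset c (mset (marked N U))"
    "c * length (marked N V) = length (\<alpha> N V) \<Longrightarrow>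
       \<exists>x y. \<alpha> N V = x @ y \<and> y @ x = concat (replicate c (marked N V))"
proof -
  note a = f_iter[OF V(1) N(1)]
  note occ = own_marker_present[OF N V]
  obtain x y where xy: "\<alpha> N V = x @ y" "omega_prefix (marked N V) ((y @ x)\<^sup>\<omega>)"
    using occurs_iter_rotate[OF a(2) occ] by blast
  let ?c = "y @ x"
  have c: "?c \<noteq> []" using a(2) xy(1) by auto
  have "length (marked N V) \<le> length ?c"
    using marked_occurs_iter_length[OF V(2) a(2) occ] xy(1) by simp
  then have pre: "Sublist.prefix (marked N V) ?c"
    using xy(2) omega_prefix_conc_iff[of "marked N V" ?c "?c\<^sup>\<omega>"] iter_eq[OF c] by simp
  show thesis
  proof (rule that[of "greedy_count (marked N V) ?c"])
    show "0 < greedy_count (marked N V) ?c" by (rule greedy_count_pos[OF _ pre]) simp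
    show "\<exists>x y. \<alpha> N V = x @ y \<and> y @ x = concat (replicate (greedy_count (marked N V) ?c) (marked N V))"
      if "greedy_count (marked N V) ?c * length (marked N V) = length (\<alpha> N V)"
      using greedy_count_length[of "marked N V" ?c] that xy(1) by (intro exI[of _ x] exI[of _ y]) simp
    fix U assume U: "U \<in> W" "admissible N U" "U \<noteq> V"
    have "\<not> sublist (marked N U) ?c"
    proof
      assume "sublist (marked N U) ?c"
      then obtain p q where pq: "?c = p @ marked N U @ q" unfolding sublist_def by blast
      have "?c\<^sup>\<omega> = (p @ marked N U @ q) \<frown> ?c\<^sup>\<omega>" using iter_eq[OF c] pq by metis
      also have "\<dots> = p \<frown> (marked N U \<frown> (q \<frown> ?c\<^sup>\<omega>))" by simp
      finally have "wdrop (length p) (?c\<^sup>\<omega>) = wdrop (length p) (p \<frown> (marked N U \<frown> (q \<frown> ?c\<^sup>\<omega>)))" by (rule arg_cong)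
      also have "\<dots> = marked N U \<frown> (q \<frown> ?c\<^sup>\<omega>)" by (rule wdrop_length_conc) simp
      finally have "occurs (marked N U) (?c\<^sup>\<omega>)" unfolding occurs_def using omega_prefix_conc by metis
      moreover have "?c\<^sup>\<omega> \<sim> (\<alpha> N V)\<^sup>\<omega>" using iter_rotate[of x y] a(2) xy(1) tail_conc by simp
      ultimately have "occurs (marked N U) ((\<alpha> N V)\<^sup>\<omega>)" by (rule occurs_tail_iter[OF c])
      then show False using other_marker_absent[OF N V U(1,2)] U(3) by blast
    qed
    from mset_swap_list[OF _ _ this, of "marked N V"] alpha_swap[OF N V U(1,2) _ xy(1) pre] U(3)
    show "mset (\<alpha> N U) + repeat_mset (greedy_count (marked N V) ?c) (mset (marked N V))
        = mset (\<alpha> N V) + repeat_mset (greedy_count (marked N V) ?c) (mset (marked N U))"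
      using xy(1) by (simp add: ac_simps)
  qed
qed

end

text \<open>A window of \<open>N + 1\<close> letters starting within a period meets the 1 at
  position \<open>N\<close> or the last letter of the period, at \<open>2 * N + 1\<close>.\<close>

lemma no_long_zero_run:
  assumes N: "0 < N" shows "\<not> occurs (replicate (Suc N) 0) ((marked N [])\<^sup>\<omega>)"
proof
  let ?m = "marked N []"
  assume "occurs (replicate (Suc N) 0) (?m\<^sup>\<omega>)"
  then obtain j where j: "omega_prefix (replicate (Suc N) 0) (wdrop j (?m\<^sup>\<omega>))" unfolding occurs_def by blast
  define i where "i = j mod length ?m"
  have i: "i < length ?m" by (simp add: i_def del: length_marked)
  have "omega_prefix (replicate (Suc N) 0) (wdrop i (?m\<^sup>\<omega>))"
    using j wdrop_iter_mod[of ?m j] by (simp add: i_def)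
  then have z: "(?m\<^sup>\<omega>) (i + l) = 0" if "l \<le> N" for l
    using that unfolding omega_prefix_iff by (auto simp del: replicate_Suc)
  have m: "?m ! (i + l) = 0" if "l \<le> N" "i + l < length ?m" for l
    using z[OF that(1)] that(2) by simp
  show False
  proof (cases "i \<le> N")
    case True
    have "?m ! (i + (N - i)) = 0" using True by (intro m) simp_all
    then show False using True marked_nth(2)[of N N "[]"] by simp
  next
    case False
    have "?m ! (i + (2 * N + 1 - i)) = 0" using False i by (intro m) simp_all
    moreover have "i + (2 * N + 1 - i) = 2 * N + 1" using i by simp
    moreover have "?m ! (2 * N + 1) = 1" using N by (intro marked_nth(3)) simp_all
    ultimately show False by simp
  qed
qed

context central
begin

section \<open>The multiplicity \<kappa> and the rotation\<close>

lemma mset_marked: "mset (marked N V) = mset (marked N []) + mset V"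
  by (simp add: marked_def)

text \<open>The multiplicities found by \<open>alpha_structure\<close> might depend on
  \<open>N\<close> and \<open>V\<close>. This number mentions neither and is shown to equal them
  when \<open>V\<close> is short compared with \<open>N\<close>.\<close>

definition \<kappa> :: nat where "\<kappa> = length (\<beta> [0]) - length (\<beta> [])"

text \<open>The parts of the output and of the markers that are common to \<open>U\<close> and
  \<open>V\<close> cancel.\<close>

lemma beta_mset_step:
  assumes N: "k \<le> N" "2 \<le> N" and U: "U \<in> W" and V: "V \<in> W"
    and c: "mset (\<alpha> N U) + repeat_mset c (mset (marked N V)) = mset (\<alpha> N V) + repeat_mset c (mset (marked N U))"
  shows "mset (\<beta> U) + repeat_mset c (mset V) = mset (\<beta> V) + repeat_mset c (mset U)"
  using c unfolding marked_outs(1)[OF U N(1)] marked_outs(1)[OF V N(1)] mset_marked[of N U] mset_marked[of N V]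
  by (simp add: repeat_mset_distrib2 ac_simps)

text \<open>Taking \<open>U = [0]\<close> and comparing sizes identifies the multiplicity with
  \<kappa>; \<open>N\<close> is at least 3 so that this \<open>U\<close> is short enough.\<close>

lemma alpha_structure_nil:
  assumes N: "k \<le> N" "3 \<le> N"
  shows "0 < \<kappa>"
    "\<And>U. U \<in> W \<Longrightarrow> length U + 2 \<le> N \<Longrightarrow> mset (\<beta> U) = mset (\<beta> []) + repeat_mset \<kappa> (mset U)"
proof -
  have N2: "2 \<le> N" using N by simp
  have ad: "admissible N []" using N by (intro admissible_short) simp
  obtain c where c: "0 < c"
    "\<And>U. U \<in> W \<Longrightarrow> admissible N U \<Longrightarrow> U \<noteq> [] \<Longrightarrow>
       mset (\<alpha> N U) + repeat_mset c (mset (marked N [])) = mset (\<alpha> N []) + repeat_mset c (mset (marked N U))"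
    by (rule alpha_structure[OF N(1) N2 lists.Nil ad]) (rule that; assumption)
  have b: "mset (\<beta> U) = mset (\<beta> []) + repeat_mset c (mset U)" if "U \<in> W" "length U + 2 \<le> N" for U
  proof (cases "U = []")
    case False
    from beta_mset_step[OF N(1) N2 that(1) _ c(2)[OF that(1) admissible_short[OF that(2)] False]]
    show ?thesis by simp
  qed simp
  have "mset (\<beta> [0]) = mset (\<beta> []) + repeat_mset c (mset [0])" by (rule b) (use N in simp_all)
  from arg_cong[OF this, of size] have c\<kappa>: "c = \<kappa>" by (simp add: \<kappa>_def)
  show "0 < \<kappa>" using c(1) c\<kappa> by simp
  show "mset (\<beta> U) = mset (\<beta> []) + repeat_mset \<kappa> (mset U)" if "U \<in> W" "length U + 2 \<le> N" for U
    using b[OF that] unfolding c\<kappa> .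
qed

lemma kappa_pos: "0 < \<kappa>"
  by (rule alpha_structure_nil(1)[of "k + 3"]) simp_all

text \<open>Neither \<beta> nor \<kappa> refers to \<open>N\<close>, which may therefore be chosen
  according to \<open>U\<close>.\<close>

lemma beta_mset: "U \<in> W \<Longrightarrow> mset (\<beta> U) = mset (\<beta> []) + repeat_mset \<kappa> (mset U)"
  by (rule alpha_structure_nil(2)[of "k + 3 + length U"]) simp_all

lemma length_beta: "U \<in> W \<Longrightarrow> length (\<beta> U) = length (\<beta> []) + \<kappa> * length U"
  using arg_cong[OF beta_mset[of U], of size] by simp

lemma alpha_rotation:
  assumes N: "k \<le> N" "3 \<le> N" and V: "V \<in> W" "length V + 2 \<le> N"
    and len: "length (\<alpha> N V) = \<kappa> * length (marked N V)"
  shows "\<exists>x y. \<alpha> N V = x @ y \<and> y @ x = concat (replicate \<kappa> (marked N V))"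
proof -
  have N2: "2 \<le> N" using N by simp
  obtain c where c: "0 < c"
    "\<And>U. U \<in> W \<Longrightarrow> admissible N U \<Longrightarrow> U \<noteq> V \<Longrightarrow>
       mset (\<alpha> N U) + repeat_mset c (mset (marked N V)) = mset (\<alpha> N V) + repeat_mset c (mset (marked N U))"
    "c * length (marked N V) = length (\<alpha> N V) \<Longrightarrow>
       \<exists>x y. \<alpha> N V = x @ y \<and> y @ x = concat (replicate c (marked N V))"
    by (rule alpha_structure[OF N(1) N2 V(1) admissible_short[OF V(2)]]) (rule that; assumption)
  \<comment> \<open>A comparison word of a different length, so that sizes determine
    \<open>c\<close>.\<close>
  define U :: "nat list" where "U = (if V = [] then [0] else [])"
  have U: "U \<in> W" "length U + 2 \<le> N" "U \<noteq> V" using N by (auto simp: U_def)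
  have "mset (\<beta> U) + repeat_mset c (mset V) = mset (\<beta> V) + repeat_mset c (mset U)"
    by (rule beta_mset_step[OF N(1) N2 U(1) V(1) c(2)[OF U(1) admissible_short[OF U(2)] U(3)]])
  then have "repeat_mset \<kappa> (mset U) + repeat_mset c (mset V) = repeat_mset \<kappa> (mset V) + repeat_mset c (mset U)"
    unfolding beta_mset[OF U(1)] beta_mset[OF V(1)] by simp
  from arg_cong[OF this, of size] have "\<kappa> * length U + c * length V = \<kappa> * length V + c * length U" by simp
  then have "c = \<kappa>" by (cases "V = []") (simp_all add: U_def)
  then show ?thesis using c(3) len by simp
qed

text \<open>Once a run has synchronized the state, one more equal letter inserts one copy of
  \<open>u0\<close> or \<open>u1\<close> and changes nothing else.\<close>

lemma beta_zero_one:
  "\<beta> (replicate (k + 1) 0) = outs T (1 # replicate k 0) (run_state 0) @ u0 @ outs T (0 # replicate k 1) (run_state 0)"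
  "\<beta> (replicate k 0) = outs T (1 # replicate k 0) (run_state 0) @ outs T (0 # replicate k 1) (run_state 0)"
  "\<beta> (replicate (k + 1) 1) = outs T (1 # replicate k 1) (run_state 0) @ u1 @ outs T (0 # replicate k 1) (run_state 1)"
  "\<beta> (replicate k 1) = outs T (1 # replicate k 1) (run_state 0) @ outs T (0 # replicate k 1) (run_state 1)"
proof -
  have s: "steps T (1 # replicate k 0) (run_state 0) = run_state 0" using steps_to_run_state[of "run_state 0" "[1]" 0 k] by simp
  have s': "steps T (1 # replicate k 1) (run_state 0) = run_state 1" using steps_to_run_state[of "run_state 0" "[1]" 1 k] by simp
  have l: "1 # replicate (k + 1) a @ 0 # replicate k 1 = (1 # replicate k a) @ [a] @ 0 # replicate k 1"
    "1 # replicate k a @ 0 # replicate k 1 = (1 # replicate k a) @ 0 # replicate k 1" for a :: nat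
    by (simp_all add: replicate_append_same[symmetric] replicate_add)
  have t0: "steps T [0] (run_state 0) = run_state 0" and t1: "steps T [1] (run_state 1) = run_state 1"
    using steps_run_state[of 0 1] steps_run_state[of 1 1] by simp_all
  show "\<beta> (replicate (k + 1) 0) = outs T (1 # replicate k 0) (run_state 0) @ u0 @ outs T (0 # replicate k 1) (run_state 0)"
    unfolding \<beta>_def l u0_def outs_append[of _ "1 # replicate k 0"] s outs_append[of _ "[0]"] t0 ..
  show "\<beta> (replicate k 0) = outs T (1 # replicate k 0) (run_state 0) @ outs T (0 # replicate k 1) (run_state 0)"
    unfolding \<beta>_def l outs_append[of _ "1 # replicate k 0"] s ..
  show "\<beta> (replicate (k + 1) 1) = outs T (1 # replicate k 1) (run_state 0) @ u1 @ outs T (0 # replicate k 1) (run_state 1)"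
    unfolding \<beta>_def l u1_def outs_append[of _ "1 # replicate k 1"] s' outs_append[of _ "[1]"] t1 ..
  show "\<beta> (replicate k 1) = outs T (1 # replicate k 1) (run_state 0) @ outs T (0 # replicate k 1) (run_state 1)"
    unfolding \<beta>_def l outs_append[of _ "1 # replicate k 1"] s' ..
qed

lemma mset_eq_replicate: "mset xs = repeat_mset m (mset [a]) \<Longrightarrow> xs = replicate m a"
proof -
  assume eq: "mset xs = repeat_mset m (mset [a])"
  have "length xs = m" using arg_cong[OF eq, of size] by simp
  moreover have "set xs \<subseteq> {a}" using arg_cong[OF eq, of set_mset] by (auto split: if_splits)
  ultimately show ?thesis by (intro replicate_eqI) auto
qed

text \<open>The difference in letter counts between runs of length \<open>k + 1\<close> and
  \<open>k\<close> is \<kappa> copies of one letter, and a word in a single letter is determined by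
  its count.\<close>

lemma u0_u1: "u0 = replicate \<kappa> 0" "u1 = replicate \<kappa> 1"
proof -
  have r: "mset (\<beta> (replicate (k + 1) a)) = mset (\<beta> (replicate k a)) + repeat_mset \<kappa> (mset [a])"
    if "a < n" for a
    using beta_mset[of "replicate (k + 1) a"] beta_mset[of "replicate k a"] that
    by (simp add: repeat_mset_distrib2 ac_simps)
  have "mset u0 = repeat_mset \<kappa> (mset [0])" using r[of 0] unfolding beta_zero_one by (simp add: ac_simps)
  then show "u0 = replicate \<kappa> 0" by (rule mset_eq_replicate)
  have "mset u1 = repeat_mset \<kappa> (mset [1])" using r[of 1] unfolding beta_zero_one by (simp add: ac_simps)
  then show "u1 = replicate \<kappa> 1" by (rule mset_eq_replicate)
qed

text \<open>Reading a word that itself contains the pattern between two markers determines the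
  total length of the constant parts of the output.\<close>

lemma length_E_beta: "length E + length (\<beta> []) = \<kappa> * (2 * k + 2)"
proof -
  let ?V = "0 # replicate k 1 @ replicate k 0 @ [1] :: nat list"
  let ?b = "1 # [] @ 0 # replicate k 1 :: nat list"
  have V: "?V \<in> W" by simp
  \<comment> \<open>This word passes the empty pattern twice with a run of \<open>k\<close> zeros in
    between, so its output consists of \<open>\<beta> []\<close>, \<open>E\<close> and
    \<open>\<beta> []\<close>.\<close>
  have w: "1 # ?V @ 0 # replicate k 1 = ?b @ replicate k 0 @ ?b" by simp
  have s: "steps T ?b (run_state 0) = run_state 1" by (rule outs_after_marker(2)) simp_all
  have s': "steps T (replicate k 0) (run_state 1) = run_state 0" using steps_to_run_state[of "run_state 1" "[]" 0 k] by simp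
  have "\<beta> ?V = \<beta> [] @ E @ \<beta> []"
    unfolding \<beta>_def w outs_append[of _ ?b] s outs_append[of _ "replicate k 0"] s' E_def ..
  then have "length (\<beta> ?V) = 2 * length (\<beta> []) + length E" by simp
  moreover have "length (\<beta> ?V) = length (\<beta> []) + \<kappa> * length ?V" by (rule length_beta[OF V])
  ultimately show ?thesis by (simp add: algebra_simps)
qed

lemma length_alpha:
  assumes V: "V \<in> W" and N: "k \<le> N"
  shows "length (\<alpha> N V) = \<kappa> * length (marked N V)"
proof -
  have "length (\<alpha> N V) = (length E + length (\<beta> [])) + \<kappa> * length V + 2 * ((N - k) * \<kappa>)"
    unfolding marked_outs(1)[OF V N] u0_u1 by (simp add: length_beta[OF V] length_power)
  also have "\<dots> = \<kappa> * (2 * k + 2 + length V + 2 * (N - k))"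
    unfolding length_E_beta by (simp add: algebra_simps)
  also have "2 * k + 2 + length V + 2 * (N - k) = length (marked N V)" using N by simp
  finally show ?thesis .
qed

lemma concat_replicate_replicate: "concat (replicate i (replicate j a)) = replicate (i * j) a"
  by (induction i) (simp_all add: replicate_add)

lemma kappa_eq_1: "\<kappa> = 1"
proof (rule ccontr)
  assume "\<kappa> \<noteq> 1"
  then have \<kappa>: "2 \<le> \<kappa>" using kappa_pos by simp
  \<comment> \<open>Then \<open>2 * (N - k)\<close> exceeds \<open>N\<close>: with \<kappa> at least
    2 the zeros written in the run are more than any period of markers contains in a row.\<close>
  define N where "N = 2 * k + 3"
  have N: "k \<le> N" "3 \<le> N" by (simp_all add: N_def)
  have a: "\<alpha> N [] = E @ replicate ((N - k) * \<kappa>) 0 @ \<beta> [] @ concat (replicate (N - k) u1)"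
    using marked_outs(1)[OF _ N(1), of "[]"] by (simp add: u0_u1 concat_replicate_replicate)
  have "Suc N \<le> (N - k) * 2" by (simp add: N_def)
  also have "\<dots> \<le> (N - k) * \<kappa>" using \<kappa> by (rule mult_le_mono2)
  finally obtain l where "(N - k) * \<kappa> = Suc N + l" using le_Suc_ex by blast
  then have a': "\<alpha> N [] = E @ replicate (Suc N) 0 @ (replicate l 0 @ \<beta> [] @ concat (replicate (N - k) u1))"
    unfolding a by (simp only: replicate_add append_assoc)
  have ne: "\<alpha> N [] \<noteq> []" unfolding a' by simp
  have "(\<alpha> N [])\<^sup>\<omega> = \<alpha> N [] \<frown> (\<alpha> N [])\<^sup>\<omega>" by (rule iter_eq[OF ne, symmetric])
  also have "\<dots> = E \<frown> (replicate (Suc N) 0 \<frown> ((replicate l 0 @ \<beta> [] @ concat (replicate (N - k) u1)) \<frown> (\<alpha> N [])\<^sup>\<omega>))"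
    by (subst a') (simp only: conc_conc append_assoc)
  finally have "wdrop (length E) ((\<alpha> N [])\<^sup>\<omega>)
      = replicate (Suc N) 0 \<frown> ((replicate l 0 @ \<beta> [] @ concat (replicate (N - k) u1)) \<frown> (\<alpha> N [])\<^sup>\<omega>)"
    by (metis wdrop_length_conc)
  then have occ: "occurs (replicate (Suc N) 0) ((\<alpha> N [])\<^sup>\<omega>)"
    unfolding occurs_def by (metis omega_prefix_conc)
  obtain x y where xy: "\<alpha> N [] = x @ y" "y @ x = concat (replicate \<kappa> (marked N []))"
    using alpha_rotation[OF N _ _ length_alpha[OF _ N(1)], of "[]"] N by auto
  have "y @ x \<noteq> []" using xy(1) ne by auto
  then have c: "concat (replicate \<kappa> (marked N [])) \<noteq> []" unfolding xy(2) .
  have pw: "concat (replicate j v) \<frown> v\<^sup>\<omega> = v\<^sup>\<omega>" if "v \<noteq> []" for j and v :: "nat list"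
  proof (induction j)
    case (Suc j)
    have "concat (replicate (Suc j) v) \<frown> v\<^sup>\<omega> = v \<frown> (concat (replicate j v) \<frown> v\<^sup>\<omega>)" by simp
    then show ?case unfolding Suc iter_eq[OF that] .
  qed simp
  have "(marked N [])\<^sup>\<omega> = (concat (replicate \<kappa> (marked N [])))\<^sup>\<omega>"
    by (rule iter_unique[OF c pw[symmetric]]) simp
  also have "\<dots> = y \<frown> (\<alpha> N [])\<^sup>\<omega>" using iter_rotate[of x y] xy ne by simp
  finally have "occurs (replicate (Suc N) 0) ((marked N [])\<^sup>\<omega>)" using occurs_conc[OF occ] by simp
  then show False using no_long_zero_run[of N] N(2) by simp
qed

lemma rotation_of_rotation:
  assumes "a @ z = x @ y"
  shows "\<exists>p q. y @ x = p @ q \<and> z @ a = q @ p"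
proof -
  obtain us where "a @ us = x \<and> z = us @ y \<or> a = x @ us \<and> us @ z = y"
    using assms by (auto simp: append_eq_append_conv2)
  then show ?thesis
  proof
    assume "a @ us = x \<and> z = us @ y"
    then show ?thesis by (intro exI[of _ "y @ a"] exI[of _ us]) auto
  next
    assume "a = x @ us \<and> us @ z = y"
    then show ?thesis by (intro exI[of _ us] exI[of _ "z @ x"]) auto
  qed
qed

text \<open>Up to rotation the output period is the marker itself. Its \<open>N - k\<close> zeros
  fit only into the initial run, so the rotation moves by at most \<open>k\<close>, and behind the
  remaining zeros the output must continue with \<open>1 # V\<close>.\<close>

lemma output_after_marker:
  assumes V: "V \<in> W"
  shows "\<exists>N i. i \<le> k \<and> (\<forall>x\<in>I. omega_prefix (replicate i 0 @ 1 # V) (state_map T (run_state 0) ((1 # V @ 0 # replicate N 1) \<frown> x)))"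
proof -
  \<comment> \<open>\<open>length V\<close> makes the run of zeros too long for the inside of the
    marker; \<open>length E\<close> keeps the prefix compared below clear of the final
    \<open>E\<close>.\<close>
  define N where "N = k + 3 + length V + length E"
  have N: "k \<le> N" "3 \<le> N" "length V + 2 \<le> N" by (simp_all add: N_def)
  let ?m = "marked N V"
  let ?Z = "replicate (N - k) 0 @ \<beta> V @ replicate (N - k) 1"
  have a: "\<alpha> N V = E @ ?Z"
    using marked_outs(1)[OF V N(1)] by (simp add: u0_u1 concat_replicate_replicate kappa_eq_1)
  obtain x y where xy: "\<alpha> N V = x @ y" "y @ x = ?m"
    using alpha_rotation[OF N(1,2) V N(3) length_alpha[OF V N(1)]] by (auto simp: kappa_eq_1)
  have "E @ ?Z = x @ y" using a xy(1) by simp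
  from rotation_of_rotation[OF this] obtain p' q' where pq': "?m = p' @ q'" "?Z @ E = q' @ p'" unfolding xy(2) by blast
  \<comment> \<open>A rotation by the whole period is replaced by the trivial one, so that the
    offset \<open>length p\<close> is smaller than the period.\<close>
  obtain p q where pq: "?m = p @ q" "?Z @ E = q @ p" "q \<noteq> []"
  proof (cases "q' = []")
    case True
    then have "?m = [] @ ?m" "?Z @ E = ?m @ []" "?m \<noteq> []"
      unfolding pq'(2) by (simp_all add: pq'(1) flip: pq'(1)) (simp add: pq'(1))
    then show thesis by (rule that)
  qed (use that[of p' q'] pq' in blast)
  define l where "l = length p"
  have lm: "l < length ?m" using pq(1,3) unfolding l_def by (metis length_append length_greater_0_conv less_add_same_cancel1)
  have zero: "?m ! (l + i) = 0" if "i < N - k" "l + i < length ?m" for i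
  proof -
    have "length ?m = length p + length q" unfolding pq(1) by simp
    then have iq: "i < length q" using that(2) unfolding l_def by linarith
    have "?m ! (l + i) = q ! i" unfolding pq(1) l_def by simp
    also have "\<dots> = (q @ p) ! i" using iq by (simp add: nth_append)
    also have "\<dots> = (?Z @ E) ! i" by (simp only: pq(2))
    also have "\<dots> = 0" using that(1) by (simp add: nth_append)
    finally show ?thesis .
  qed
  \<comment> \<open>For a larger offset the run of zeros would reach the 1 at position
    \<open>N\<close>, the first of the final ones, or start on a final 1.\<close>
  have lk: "l \<le> k"
  proof (rule ccontr)
    assume lk: "\<not> l \<le> k"
    consider "l \<le> N" | "N < l" "l < N + 2 + length V" | "N + 2 + length V \<le> l" by linarith
    then show False
    proof cases
      case 1
      have "?m ! (l + (N - l)) = 0" using 1 lk by (intro zero) auto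
      then show False using 1 marked_nth(2)[of N N V] by simp
    next
      case 2
      have "?m ! (l + (N + 2 + length V - l)) = 0" using 2 N(2) by (intro zero) (auto simp: N_def)
      moreover have "?m ! (N + 2 + length V) = 1" using N(2) by (intro marked_nth(3)) simp_all
      ultimately show False using 2 by simp
    next
      case 3
      have "?m ! (l + 0) = 0" using lm by (intro zero) (simp_all add: N_def)
      moreover have "?m ! l = 1" using 3 lm by (intro marked_nth(3)) simp_all
      ultimately show False by simp
    qed
  qed
  have split: "replicate N 0 = replicate l 0 @ replicate (N - k) 0 @ replicate (k - l) (0::nat)"
    using lk N(1) by (simp flip: replicate_add)
  have m: "?m = replicate l 0 @ (replicate (N - k) 0 @ replicate (k - l) 0 @ 1 # V @ 0 # replicate N 1)"
    unfolding marked_def split by simp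
  have p: "p = replicate l 0" and q: "q = replicate (N - k) 0 @ replicate (k - l) 0 @ 1 # V @ 0 # replicate N 1"
    using pq(1) m unfolding l_def by (metis append_eq_append_conv length_replicate)+
  have eq: "(\<beta> V @ replicate (N - k) 1) @ E = (replicate (k - l) 0 @ 1 # V) @ (0 # replicate N 1 @ replicate l 0)"
    using pq(2) unfolding p q by simp
  from arg_cong[OF eq, of length] have len: "length (replicate (k - l) 0 @ 1 # V) \<le> length (\<beta> V @ replicate (N - k) 1)"
    by (simp add: N_def)
  have "Sublist.prefix (replicate (k - l) 0 @ 1 # V) (\<beta> V @ replicate (N - k) 1)"
    by (rule prefix_length_prefix[OF _ _ len, of "(\<beta> V @ replicate (N - k) 1) @ E"]) (subst eq, simp_all)
  moreover have "omega_prefix (\<beta> V @ replicate (N - k) 1) (state_map T (run_state 0) ((1 # V @ 0 # replicate N 1) \<frown> x))" if "x \<in> I" for x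
  proof -
    have "1 # V @ 0 # replicate N 1 \<in> W" using V by simp
    from state_map_conc[OF tr _ that this, of "run_state 0"] show ?thesis
      using outs_after_marker(1)[OF V N(1)] by (simp add: u0_u1 concat_replicate_replicate kappa_eq_1)
  qed
  ultimately have "\<forall>x\<in>I. omega_prefix (replicate (k - l) 0 @ 1 # V) (state_map T (run_state 0) ((1 # V @ 0 # replicate N 1) \<frown> x))"
    using omega_prefix_mono by blast
  then show ?thesis by (intro exI[of _ N] exI[of _ "k - l"]) simp
qed

section \<open>A state acting as the identity\<close>

lemma zeros_then_one_unique:
  assumes "omega_prefix (replicate i 0 @ [1::nat]) y" "omega_prefix (replicate j 0 @ [1]) y" shows "i = j"
proof -
  have *: "\<not> i < j" if "omega_prefix (replicate i 0 @ [1::nat]) y" "omega_prefix (replicate j 0 @ [1]) y" for i j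
  proof
    assume "i < j"
    then have "y i = 0" using that(2) by (auto simp: omega_prefix_iff nth_append)
    moreover have "y i = 1" using that(1) by (auto simp: omega_prefix_iff nth_append)
    ultimately show False by simp
  qed
  then show ?thesis using *[OF assms] *[OF assms(2,1)] by simp
qed

text \<open>Continuity passes from prefixes of \<open>y\<close> to \<open>y\<close>. The number of
  zeros is the same for all prefixes because the first 1 of one fixed output determines it.\<close>

lemma image_of_one:
  assumes y: "y \<in> I"
  shows "\<exists>i\<le>k. state_map T (run_state 0) ([1] \<frown> y) = (replicate i 0 @ [1]) \<frown> y"
proof -
  let ?f = "state_map T (run_state 0)"
  have gf: "good ?f" by (rule minimal_inj_good[OF T]) simp
  have yI: "[1] \<frown> y \<in> I" using y by simp
  have "\<exists>i\<le>k. omega_prefix (replicate i 0 @ 1 # wtake m y) (?f ([1] \<frown> y))" for m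
  proof -
    obtain K where K: "\<And>x z. x \<in> I \<Longrightarrow> z \<in> I \<Longrightarrow> agree K x z \<Longrightarrow> agree (k + 1 + m) (?f x) (?f z)"
      using good_ucontD[OF gf, of "k + 1 + m"] by blast
    \<comment> \<open>\<open>K\<close> letters for the continuity of the map and \<open>m\<close>
      letters for the desired prefix.\<close>
    let ?V = "wtake (m + K) y"
    have V: "?V \<in> W" using y by simp
    obtain N i where Ni: "i \<le> k" "omega_prefix (replicate i 0 @ 1 # ?V) (?f ((1 # ?V @ 0 # replicate N 1) \<frown> (\<lambda>_. 0)))"
      using output_after_marker[OF V] zero_in_I by blast
    let ?z = "(1 # ?V @ 0 # replicate N 1) \<frown> (\<lambda>_. 0)"
    have zI: "?z \<in> I" using V by simp
    have "agree (length (1 # ?V)) ([1] \<frown> y) ?z"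
    proof -
      have "[1] \<frown> y = (1 # ?V) \<frown> wdrop (m + K) y"
        using prefix_suffix[of y "m + K"] by (metis append_Cons append_Nil conc_conc)
      moreover have "?z = (1 # ?V) \<frown> ((0 # replicate N 1) \<frown> (\<lambda>_. 0))" by simp
      ultimately show ?thesis using agree_conc by metis
    qed
    then have "agree K ([1] \<frown> y) ?z" by (rule agree_mono) simp
    then have ag: "agree (k + 1 + m) (?f ([1] \<frown> y)) (?f ?z)" by (rule K[OF yI zI])
    have "Sublist.prefix (replicate i 0 @ 1 # wtake m y) (replicate i 0 @ 1 # ?V)"
      unfolding wtake_add by simp
    then have "omega_prefix (replicate i 0 @ 1 # wtake m y) (?f ?z)" using Ni(2) omega_prefix_mono by blast
    then have "omega_prefix (replicate i 0 @ 1 # wtake m y) (?f ([1] \<frown> y))"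
      using ag Ni(1) unfolding omega_prefix_iff agree_def by simp
    then show ?thesis using Ni(1) by blast
  qed
  then obtain i where i: "\<And>m. i m \<le> k" "\<And>m. omega_prefix (replicate (i m) 0 @ 1 # wtake m y) (?f ([1] \<frown> y))" by metis
  have one: "omega_prefix (replicate (i m) 0 @ [1]) (?f ([1] \<frown> y))" for m
    by (rule omega_prefix_mono[OF _ i(2)[of m]]) simp
  have i0: "i m = i 0" for m by (rule zeros_then_one_unique[OF one one])
  have "?f ([1] \<frown> y) l = ((replicate (i 0) 0 @ [1]) \<frown> y) l" for l
  proof -
    have "omega_prefix (replicate (i 0) 0 @ 1 # wtake (Suc l) y) ((replicate (i 0) 0 @ [1]) \<frown> y)"
      using prefix_suffix[of y "Suc l"] by (metis append.assoc append_Cons append_Nil conc_conc omega_prefix_conc)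
    moreover have "omega_prefix (replicate (i 0) 0 @ 1 # wtake (Suc l) y) (?f ([1] \<frown> y))"
      using i(2)[of "Suc l"] unfolding i0[of "Suc l"] .
    moreover have "l < length (replicate (i 0) 0 @ 1 # wtake (Suc l) y)" by simp
    ultimately show ?thesis unfolding omega_prefix_iff by metis
  qed
  then show ?thesis using i(1) by blast
qed

text \<open>The number of zeros in \<open>image_of_one\<close> is locally constant, so it is
  absorbed into the output on a fixed word \<open>?w\<close>, and the state behind \<open>?w\<close>
  acts as the identity. One state map determines the whole of \<open>T\<close>.\<close>

lemma state_maps_eq_id: "state_maps T = recurrent (\<lambda>x. x)"
proof -
  let ?f = "state_map T (run_state 0)"
  have gf: "good ?f" by (rule minimal_inj_good[OF T]) simp
  \<comment> \<open>\<open>k + 1\<close> letters of output show the complete block of at most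
    \<open>k\<close> zeros and the 1 behind it.\<close>
  obtain K where K: "\<And>x z. x \<in> I \<Longrightarrow> z \<in> I \<Longrightarrow> agree K x z \<Longrightarrow> agree (k + 1) (?f x) (?f z)"
    using good_ucontD[OF gf, of "k + 1"] by blast
  let ?w = "1 # replicate K 0 :: nat list"
  have w: "?w \<in> W" by simp
  have wc: "?w \<frown> x = [1] \<frown> (replicate K 0 \<frown> x)" for x :: "nat word" by simp
  have cI: "replicate K 0 \<frown> x \<in> I" if "x \<in> I" for x using that by simp
  obtain i where i: "i \<le> k" "?f (?w \<frown> (\<lambda>_. 0)) = (replicate i 0 @ [1]) \<frown> (replicate K 0 \<frown> (\<lambda>_. 0))"
    using image_of_one[OF cI[OF zero_in_I]] unfolding wc by blast
  have "?f (?w \<frown> x) = (replicate i 0 @ ?w) \<frown> x" if x: "x \<in> I" for x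
  proof -
    obtain j where j: "j \<le> k" "?f (?w \<frown> x) = (replicate j 0 @ [1]) \<frown> (replicate K 0 \<frown> x)"
      using image_of_one[OF cI[OF x]] unfolding wc by blast
    have "agree (length ?w) (?w \<frown> (\<lambda>_. 0)) (?w \<frown> x)" by (rule agree_conc)
    then have "agree K (?w \<frown> (\<lambda>_. 0)) (?w \<frown> x)" by (rule agree_mono) simp
    moreover have "?w \<frown> (\<lambda>_. 0) \<in> I" "?w \<frown> x \<in> I" using w x zero_in_I conc_in_inf_words by blast+
    ultimately have ag: "agree (k + 1) (?f (?w \<frown> (\<lambda>_. 0))) (?f (?w \<frown> x))" using K by blast
    have "omega_prefix (replicate i 0 @ [1]) (?f (?w \<frown> (\<lambda>_. 0)))" unfolding i(2) by (rule omega_prefix_conc)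
    then have "omega_prefix (replicate i 0 @ [1]) (?f (?w \<frown> x))"
      using ag i(1) unfolding omega_prefix_iff agree_def by simp
    moreover have "omega_prefix (replicate j 0 @ [1]) (?f (?w \<frown> x))" unfolding j(2) by (rule omega_prefix_conc)
    ultimately have "i = j" by (rule zeros_then_one_unique)
    then show ?thesis unfolding j(2) by simp
  qed
  moreover have "spread (\<lambda>x. x)" unfolding spread_def
    by (rule bexI[of _ "\<lambda>_. 0"], rule bexI[of _ "\<lambda>_. Suc 0"]) simp_all
  ultimately have "loc ?f ?w = restrict (\<lambda>x. x) I" by (rule loc_unique(2)[OF w, where g = "\<lambda>x. x"])
  then have eq: "state_map T (steps T ?w (run_state 0)) = restrict (\<lambda>x. x) I"
    using minimal_inj_loc(1)[OF T _ w, of "run_state 0"] by simp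
  have s: "steps T ?w (run_state 0) \<in> states T" by (rule steps_in_states[OF tr w]) simp
  have "state_maps T = recurrent (state_map T (steps T ?w (run_state 0)))" by (rule minimal_inj_recurrent[OF T s, symmetric])
  also have "\<dots> = recurrent (\<lambda>x. x)" unfolding eq by (rule recurrent_cong) simp
  finally show ?thesis .
qed

end

context alphabet
begin

lemma centre_trivial: "centre (O_nr n r) = {\<one>\<^bsub>M_monoid n\<^esub>}"
proof (intro equalityI subsetI)
  fix z assume "z \<in> {\<one>\<^bsub>M_monoid n\<^esub>}"
  then have z: "z = transducers_of (recurrent (\<lambda>x. x))" by (simp add: one_eq)
  have "z \<otimes>\<^bsub>M_monoid n\<^esub> a = a \<otimes>\<^bsub>M_monoid n\<^esub> z" if a: "a \<in> carrier (O_nr n r)" for a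
  proof -
    obtain T where T: "minimal_inj T" "a = transducers_of (state_maps T)" using O_nrD[OF a] by blast
    obtain q where "q \<in> states T" using minimal_injD(1)[OF T(1)] by (auto simp: transducer_def)
    then have "state_map T q \<in> state_maps T" by (simp add: state_maps_def)
    then show ?thesis using mult_involution(1,3)[OF T(1) _ involution_id] unfolding z T(2) by metis
  qed
  moreover have "z \<in> carrier (O_nr n r)" unfolding z by (rule involution_O_nr[OF involution_id])
  ultimately show "z \<in> centre (O_nr n r)" by (simp add: centre_def)
next
  fix z assume z: "z \<in> centre (O_nr n r)"
  then have zc: "z \<in> carrier (O_nr n r)" by (simp add: centre_def)
  obtain T U where T: "minimal_inj T" and U: "minimal_inj U" and zT: "z = transducers_of (state_maps T)"
    and TU: "\<forall>f\<in>state_maps T. \<forall>g\<in>state_maps U. recurrent (\<lambda>x. g (f x)) = recurrent (\<lambda>x. x) \<and> synchronizing (\<lambda>x. g (f x))"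
    using O_nrD[OF zc] by (elim exE conjE) (rule that)
  obtain k where k: "sync_level n T k" using minimal_injD(6)[OF T] by blast
  obtain p where p: "p \<in> states U" using minimal_injD(1)[OF U] by (auto simp: transducer_def)
  have pH: "state_map U p \<in> state_maps U" using p by (simp add: state_maps_def)
  have si: "synchronizing (\<lambda>x. x)" using involution_id unfolding involution_def by blast
  \<comment> \<open>Centrality is applied to involutions, which all belong to the group; the second
    factor \<open>U\<close> supplies the inverse.\<close>
  interpret central n T k "state_map U p"
  proof
    show "minimal_inj T" by (rule T)
    show "sync_level n T k" by (rule k)
    show "recurrent (\<lambda>x. f (state_map T q x)) = recurrent (\<lambda>x. state_map T q (f x))" if f: "involution f" and q: "q \<in> states T" for f q
    proof -
      have qH: "state_map T q \<in> state_maps T" using q by (simp add: state_maps_def)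
      have "z \<otimes>\<^bsub>M_monoid n\<^esub> transducers_of (recurrent f) = transducers_of (recurrent f) \<otimes>\<^bsub>M_monoid n\<^esub> z"
        using z involution_O_nr[OF f, of r] by (simp add: centre_def)
      then have "transducers_of (recurrent (\<lambda>x. f (state_map T q x))) = transducers_of (recurrent (\<lambda>x. state_map T q (f x)))"
        unfolding zT mult_involution(1,3)[OF T qH f] .
      then show ?thesis by (rule transducers_of_recurrent_inject[OF mult_involution(2)[OF T qH f]])
    qed
    show "state_map U p x \<sim> state_map U p y" if "x \<in> I" "y \<in> I" "x \<sim> y" for x y
      by (rule synchronizing_respects_tail[OF minimal_inj_synchronizing[OF U p] that])
    show "state_map U p (state_map T q x) \<sim> x" if q: "q \<in> states T" and x: "x \<in> I" for q x
    proof -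
      have "state_map T q \<in> state_maps T" using q by (simp add: state_maps_def)
      from bspec[OF bspec[OF TU this] pH] show ?thesis
        using recurrent_eq_imp_tail[of "\<lambda>x. state_map U p (state_map T q x)" "\<lambda>x. x", OF _ si _ x] by blast
    qed
  qed
  show "z \<in> {\<one>\<^bsub>M_monoid n\<^esub>}" unfolding zT state_maps_eq_id one_eq by simp
qed

end

theorem corollary1p5:
  fixes n r :: nat
  assumes "1 \<le> r" and "r < n"
  shows "centre (O_nr n r) = {\<one>\<^bsub>O_nr n r\<^esub>} \<and>
         infinite (rcosets\<^bsub>O_nr n r\<^esub> (L_nr n r))"
proof -
  interpret alphabet n by unfold_locales (use assms in simp)
  show ?thesis using centre_trivial infinite_rcosets by simp
qed

end
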